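(* Let $\Gamma$ be a consistent dimer model with dual quiver $Q$, let $0\in Q_0$ be a chosen vertex, let $\theta$ be a $0$-generated stability parameter, and let $\sigma_\pm\in\Sigma_\theta(3)$ be adjacent cones with $\tau=\sigma_+\cap\sigma_-\in\Sigma_\theta(2)$. Then the source vertices of the quivers $Q(\tau)^+$ and $Q(\tau)^-$ coincide.
   Context: Dimer models. A dimer model $\Gamma$ is a polygonal cell decomposition of the real 2-torus $\mathbb{T}=\mathbb{R}^2/\mathbb{Z}^2$ with nodes $\Gamma_0$, edges $\Gamma_1$ and tiles $\Gamma_2$, such that nodes are coloured black or white, every edge joins a black node to a white node, every tile is a simply-connected convex polygon, and there are no bivalent nodes. The dual quiver $Q=(Q_0,Q_1)$ has one vertex in each tile and one arrow $a$ crossing each edge $\mathfrak{e}_a\in\Gamma_1$, with the white endnode of $\mathfrak{e}_a$ to the right of $a$; write $\mathsf{t}(a),\mathsf{h}(a)$ for tail and head. The arrows around the white (resp. black) endnode of $\mathfrak{e}_a$ form a cycle $ap_a^+$ (resp. $ap_a^-$), with $p_a^\pm$ paths from $\mathsf{h}(a)$ to $\mathsf{t}(a)$. The Jacobian algebra is $A=\mathbb{C}Q/\langle p_a^+-p_a^-\mid a\in Q_1\rangle$. A zig-zag path is a path in the graph $(\Gamma_0,\Gamma_1)$ turning maximally right at white nodes and maximally left at black nodes. $\Gamma$ is consistent if there is no homologically trivial zig-zag path, no zig-zag path intersects itself on the universal cover, and no pair of zig-zag paths intersect each other on the universal cover in the same direction more than once. A perfect matching is a set of edges $\Pi$ such that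 every node is an endnode of a unique edge in $\Pi$. Moduli. $A$-modules are representations of $Q$ satisfying the relations. Let $\mathbf{v}=(1,\dots,1)\in\mathbb{N}^{Q_0}$. For $\theta\in\operatorname{Hom}(\mathbb{Z}^{Q_0},\mathbb{Q})$ with $\theta(\mathbf{v})=0$, an $A$-module of dimension vector $\mathbf{v}$ is $\theta$-stable if $\theta(\dim M')>0$ for every nonzero proper submodule $M'$. $\theta$ is $0$-generated if $\theta_i>0$ for all $i\neq 0$. For such $\theta$, $\mathcal{M}_\theta$ is the fine moduli space of $\theta$-stable $A$-modules of dimension vector $\mathbf{v}$; it is a smooth toric threefold, a projective crepant resolution of the Gorenstein affine toric threefold $\operatorname{Spec}Z(A)$, with fan $\Sigma_\theta$; $\Sigma_\theta(d)$ is the set of $d$-dimensional cones. Let $T$ be the tautological bundle; its fibre $T_y$ is the $\theta$-stable module parametrised by $y$. Modules $M_\sigma$. For $\rho\in\Sigma_\theta(1)$, let $y$ be any point of the 2-dimensional torus orbit $O_\rho$ and $(v_a)$ a representation giving $T_y$; then $\Pi_\rho=\{\mathfrak{e}_a\mid v_a=0\}$ is a perfect matching independent of choices. For $\sigma\in\Sigma_\theta$, $M_\sigma$ is the representation of dimension vector $\mathbf{v}$ with $v_a=0$ if $\mathfrak{e}_a\in\bigcup_{\rho\subseteq\sigma}\Pi_\rho$ and $v_a=1$ otherwise; it is a $\theta$-stable $A$-module. For $\sigma\in\Sigma_\theta(3)$, $Q^\sigma\subset Q$ is the subquiver with vertex set $Q_0$ and arrows those $a$ with $v_a\neq 0$ in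 $M_\sigma$. The quivers $Q(\tau)^\pm$. Let $\rho_0,\rho_1,\rho_2$ be the rays of $\sigma_+$ and $\rho_1,\rho_2,\rho_3$ those of $\sigma_-$. A jigsaw piece for $\tau$ is the closure of a connected component of $\mathbb{T}\setminus\bigcup_{0\le k\le 3}\Pi_{\rho_k}$; it is a union of tiles. The zero jigsaw piece $\mathrm{J}_0$ is the one containing the tile dual to $0$. $Q(\tau)^\pm$ is the subquiver of $Q^{\sigma_\pm}$ whose vertices are those dual to tiles not in $\mathrm{J}_0$ and whose arrows are all arrows of $Q^{\sigma_\pm}$ with head and tail both dual to tiles not in $\mathrm{J}_0$. A source vertex is one that is not the head of any arrow of the quiver. *)

theory Defs
  imports
    "HOL-Analysis.Analysis"
    "HOL-Library.Function_Algebras"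
    "Graph_Theory.Digraph_Component"
begin

section \<open>Dimer models\<close>

text \<open>
  The universal cover \<open>\<real>\<^sup>2\<close> of the torus \<open>\<real>\<^sup>2/\<int>\<^sup>2\<close> is the complex plane, and the torus itself is
  realised as the product of two unit circles. Nodes, edges and tiles of the torus are literally
  the images under \<open>torus_proj\<close> of nodes, (closed) edges and (open) tiles of the cover.
\<close>

definition int_lattice :: "complex set" where
  "int_lattice = {z. Re z \<in> \<int> \<and> Im z \<in> \<int>}"

definition torus :: "(complex \<times> complex) set" where
  "torus = sphere 0 1 \<times> sphere 0 1"

definition torus_proj :: "complex \<Rightarrow> complex \<times> complex" where
  "torus_proj z = (cis (2 * pi * Re z), cis (2 * pi * Im z))"

text \<open>A lifted edge is the pair (white endnode, black endnode).\<close>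

type_synonym lifted_edge = "complex \<times> complex"
type_synonym torus_edge = "(complex \<times> complex) set"
type_synonym torus_tile = "(complex \<times> complex) set"

record dimer =
  white :: "complex set"
  black :: "complex set"
  edges :: "lifted_edge set"

definition segment :: "lifted_edge \<Rightarrow> complex set" where
  "segment e = closed_segment (fst e) (snd e)"

definition skeleton :: "dimer \<Rightarrow> complex set" where
  "skeleton D = white D \<union> black D \<union> (\<Union>e\<in>edges D. segment e)"

definition lifted_tiles :: "dimer \<Rightarrow> complex set set" where
  "lifted_tiles D = components (- skeleton D)"

definition edge_proj :: "lifted_edge \<Rightarrow> torus_edge" where
  "edge_proj e = torus_proj ` segment e"

definition edges_at :: "dimer \<Rightarrow> complex \<Rightarrow> lifted_edge set" where
  "edges_at D n = {e \<in> edges D. fst e = n \<or> snd e = n}"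

text \<open>
  A bounded convex component of the complement of the skeleton is the interior of a convex polygon;
  a corner of the tile is a node of \<open>\<Gamma>\<close>, and angles equal to \<open>\<pi>\<close> are allowed. It is automatically
  disjoint from its nonzero lattice translates, hence maps injectively to the torus.
\<close>

definition dimer_model :: "dimer \<Rightarrow> bool" where
  "dimer_model D \<longleftrightarrow>
     white D \<inter> black D = {} \<and>
     edges D \<subseteq> white D \<times> black D \<and>
     (\<forall>z\<in>int_lattice. (\<lambda>n. n + z) ` white D = white D \<and> (\<lambda>n. n + z) ` black D = black D \<and>
        (\<lambda>(w, b). (w + z, b + z)) ` edges D = edges D) \<and>
     finite (torus_proj ` (white D \<union> black D)) \<and>
     finite (edge_proj ` edges D) \<and>
     (\<forall>e\<in>edges D. segment e \<inter> (white D \<union> black D) = {fst e, snd e}) \<and>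
     (\<forall>e\<in>edges D. \<forall>e'\<in>edges D. e \<noteq> e' \<longrightarrow>
        open_segment (fst e) (snd e) \<inter> open_segment (fst e') (snd e') = {}) \<and>
     (\<forall>C\<in>lifted_tiles D. bounded C \<and> convex C) \<and>
     (\<forall>n\<in>white D \<union> black D. card (edges_at D n) \<noteq> 2)"

section \<open>Zig-zag paths and consistency\<close>

text \<open>
  For a finite set \<open>S\<close> of points seen from \<open>c\<close> in pairwise distinct directions: the first point of
  \<open>S\<close> after \<open>x\<close> when rotating about \<open>c\<close>. \<open>Arg2pi (q / p)\<close> is the counterclockwise angle from
  \<open>p\<close> to \<open>q\<close>.
\<close>

definition next_ccw :: "complex set \<Rightarrow> complex \<Rightarrow> complex \<Rightarrow> complex" where
  "next_ccw S c x = arg_min (\<lambda>y. Arg2pi ((y - c) / (x - c))) (\<lambda>y. y \<in> S - {x})"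

definition next_cw :: "complex set \<Rightarrow> complex \<Rightarrow> complex \<Rightarrow> complex" where
  "next_cw S c x = arg_min (\<lambda>y. Arg2pi ((x - c) / (y - c))) (\<lambda>y. y \<in> S - {x})"

definition ccw_white :: "dimer \<Rightarrow> lifted_edge \<Rightarrow> lifted_edge" where
  "ccw_white D e = (fst e, next_ccw {b. (fst e, b) \<in> edges D} (fst e) (snd e))"

definition cw_white :: "dimer \<Rightarrow> lifted_edge \<Rightarrow> lifted_edge" where
  "cw_white D e = (fst e, next_cw {b. (fst e, b) \<in> edges D} (fst e) (snd e))"

definition ccw_black :: "dimer \<Rightarrow> lifted_edge \<Rightarrow> lifted_edge" where
  "ccw_black D e = (next_ccw {w. (w, snd e) \<in> edges D} (snd e) (fst e), snd e)"

definition cw_black :: "dimer \<Rightarrow> lifted_edge \<Rightarrow> lifted_edge" where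
  "cw_black D e = (next_cw {w. (w, snd e) \<in> edges D} (snd e) (fst e), snd e)"

text \<open>
  A lift of a zig-zag path to the universal cover, as a bi-infinite sequence of edges. Edges in even
  position are traversed from black to white, those in odd position from white to black. Arriving at
  a node along an edge, the maximal right (left) turn is onto the next edge counterclockwise
  (clockwise) about that node.
\<close>

definition zigzag :: "dimer \<Rightarrow> (int \<Rightarrow> lifted_edge) \<Rightarrow> bool" where
  "zigzag D z \<longleftrightarrow> (\<forall>i. z i \<in> edges D) \<and>
     (\<forall>i. z (i + 1) = (if even i then ccw_white D (z i) else cw_black D (z i)))"

text \<open>A loop in the torus is homologically trivial iff its lifts to \<open>\<real>\<^sup>2\<close> close up.\<close>

definition homologically_trivial :: "(int \<Rightarrow> lifted_edge) \<Rightarrow> bool" where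
  "homologically_trivial z \<longleftrightarrow> (\<exists>p>0. even p \<and> (\<forall>i. z (i + p) = z i))"

definition same_zigzag :: "(int \<Rightarrow> lifted_edge) \<Rightarrow> (int \<Rightarrow> lifted_edge) \<Rightarrow> bool" where
  "same_zigzag z z' \<longleftrightarrow> (\<exists>s. even s \<and> (\<forall>i. z' i = z (i + s)))"

text \<open>
  Zig-zag paths intersect along common edges (not at common nodes). Two of them intersect more than
  once in the same direction if two common edges are met in the same order by both.
\<close>

definition meet_twice_same_direction ::
    "(int \<Rightarrow> lifted_edge) \<Rightarrow> (int \<Rightarrow> lifted_edge) \<Rightarrow> bool" where
  "meet_twice_same_direction z z' \<longleftrightarrow> (\<exists>i j k l. i < j \<and> k < l \<and> z i = z' k \<and> z j = z' l)"

definition consistent :: "dimer \<Rightarrow> bool" where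
  "consistent D \<longleftrightarrow>
     (\<forall>z. zigzag D z \<longrightarrow> \<not> homologically_trivial z) \<and>
     (\<forall>z. zigzag D z \<longrightarrow> inj z) \<and>
     (\<forall>z z'. zigzag D z \<and> zigzag D z' \<and> \<not> same_zigzag z z' \<longrightarrow>
        \<not> meet_twice_same_direction z z')"

section \<open>The dual quiver\<close>

text \<open>
  Looking from the white to the black endnode of an edge, the arrow crosses from left to right, so
  that the white endnode is on its right. Below, \<open>\<i> * (b - w)\<close> points to the left of the edge.
\<close>

definition left_tile :: "dimer \<Rightarrow> lifted_edge \<Rightarrow> complex set" where
  "left_tile D e = (THE C. C \<in> lifted_tiles D \<and>
     eventually (\<lambda>\<epsilon>. midpoint (fst e) (snd e) + of_real \<epsilon> * \<i> * (snd e - fst e) \<in> C) (at_right 0))"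

definition right_tile :: "dimer \<Rightarrow> lifted_edge \<Rightarrow> complex set" where
  "right_tile D e = (THE C. C \<in> lifted_tiles D \<and>
     eventually (\<lambda>\<epsilon>. midpoint (fst e) (snd e) - of_real \<epsilon> * \<i> * (snd e - fst e) \<in> C) (at_right 0))"

text \<open>
  The vertex dual to a tile is the tile itself, the arrow \<open>a\<close> crossing an edge is the edge itself.
\<close>

definition dual_quiver :: "dimer \<Rightarrow> (torus_tile, torus_edge) pre_digraph" where
  "dual_quiver D =
     \<lparr> verts = (\<lambda>C. torus_proj ` C) ` lifted_tiles D,
       arcs = edge_proj ` edges D,
       tail = (\<lambda>a. THE i. \<exists>e\<in>edges D. a = edge_proj e \<and> i = torus_proj ` left_tile D e),
       head = (\<lambda>a. THE i. \<exists>e\<in>edges D. a = edge_proj e \<and> i = torus_proj ` right_tile D e) \<rparr>"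

text \<open>
  The paths \<open>p\<^sub>a\<^sup>+\<close> and \<open>p\<^sub>a\<^sup>-\<close> for the arrow \<open>a\<close> crossing the lifted edge \<open>e\<close>, as lists of arrows in
  the order in which they are traversed. The arrows run clockwise around white nodes and
  counterclockwise around black nodes.
\<close>

definition plus_path :: "dimer \<Rightarrow> lifted_edge \<Rightarrow> torus_edge list" where
  "plus_path D e = map (\<lambda>j. edge_proj ((cw_white D ^^ j) e)) [1..<card (edges_at D (fst e))]"

definition minus_path :: "dimer \<Rightarrow> lifted_edge \<Rightarrow> torus_edge list" where
  "minus_path D e = map (\<lambda>j. edge_proj ((ccw_black D ^^ j) e)) [1..<card (edges_at D (snd e))]"

section \<open>Modules of dimension vector \<open>(1,\<dots>,1)\<close> and their moduli\<close>

text \<open>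
  Modules over the Jacobian algebra with dimension vector \<open>(1,\<dots>,1)\<close>, given by a scalar for each
  arrow. Values outside the arrow set are normalised to be zero.
\<close>

definition reps :: "dimer \<Rightarrow> (torus_edge \<Rightarrow> complex) set" where
  "reps D = {v. (\<forall>a. a \<notin> arcs (dual_quiver D) \<longrightarrow> v a = 0) \<and>
     (\<forall>e\<in>edges D. prod_list (map v (plus_path D e)) = prod_list (map v (minus_path D e)))}"

definition submodule ::
    "dimer \<Rightarrow> (torus_edge \<Rightarrow> complex) \<Rightarrow> (torus_tile \<Rightarrow> complex set) \<Rightarrow> bool" where
  "submodule D v N \<longleftrightarrow>
     (\<forall>i\<in>verts (dual_quiver D). vector_space_over_itself.subspace (N i)) \<and>
     (\<forall>a\<in>arcs (dual_quiver D).
        (\<lambda>x. v a * x) ` N (tail (dual_quiver D) a) \<subseteq> N (head (dual_quiver D) a))"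

definition stable :: "dimer \<Rightarrow> (torus_tile \<Rightarrow> rat) \<Rightarrow> (torus_edge \<Rightarrow> complex) \<Rightarrow> bool" where
  "stable D \<theta> v \<longleftrightarrow> (\<forall>N. submodule D v N \<and>
     (\<exists>i\<in>verts (dual_quiver D). N i \<noteq> {0}) \<and> (\<exists>i\<in>verts (dual_quiver D). N i \<noteq> UNIV) \<longrightarrow>
     (\<Sum>i\<in>verts (dual_quiver D). \<theta> i * of_nat (vector_space_over_itself.dim (N i))) > 0)"

text \<open>A homomorphism \<open>\<theta> : \<int>\<^bsup>Q\<^sub>0\<^esup> \<rightarrow> \<rat>\<close> is given by its values on the standard basis.\<close>

definition zero_generated :: "dimer \<Rightarrow> torus_tile \<Rightarrow> (torus_tile \<Rightarrow> rat) \<Rightarrow> bool" where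
  "zero_generated D i0 \<theta> \<longleftrightarrow> (\<Sum>i\<in>verts (dual_quiver D). \<theta> i) = 0 \<and>
     (\<forall>i\<in>verts (dual_quiver D) - {i0}. \<theta> i > 0)"

definition stable_reps :: "dimer \<Rightarrow> (torus_tile \<Rightarrow> rat) \<Rightarrow> (torus_edge \<Rightarrow> complex) set" where
  "stable_reps D \<theta> = {v \<in> reps D. stable D \<theta> v}"

definition iso_class :: "dimer \<Rightarrow> (torus_edge \<Rightarrow> complex) \<Rightarrow> (torus_edge \<Rightarrow> complex) set" where
  "iso_class D v =
     {\<lambda>a. if a \<in> arcs (dual_quiver D)
          then g (head (dual_quiver D) a) * v a / g (tail (dual_quiver D) a) else 0 | g.
      \<forall>i\<in>verts (dual_quiver D). g i \<noteq> (0::complex)}"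

text \<open>
  The moduli space \<open>\<M>\<^sub>\<theta>\<close>: its points, and its classical (analytic) topology, which is the
  quotient topology from the space of stable representations.
\<close>

definition moduli :: "dimer \<Rightarrow> (torus_tile \<Rightarrow> rat) \<Rightarrow> (torus_edge \<Rightarrow> complex) set set" where
  "moduli D \<theta> = iso_class D ` stable_reps D \<theta>"

definition moduli_topology ::
    "dimer \<Rightarrow> (torus_tile \<Rightarrow> rat) \<Rightarrow> (torus_edge \<Rightarrow> complex) set topology" where
  "moduli_topology D \<theta> =
     topology (\<lambda>U. U \<subseteq> moduli D \<theta> \<and> openin (top_of_set (stable_reps D \<theta>)) (\<Union>U))"

section \<open>The toric fan of the moduli space\<close>

text \<open>
  The dense torus of \<open>\<M>\<^sub>\<theta>\<close> consists of the classes of representations with all \<open>v\<^sub>a \<noteq> 0\<close>; it acts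
  by multiplication of representations.
\<close>

definition torus_reps :: "dimer \<Rightarrow> (torus_edge \<Rightarrow> complex) set" where
  "torus_reps D = {s \<in> reps D. \<forall>a\<in>arcs (dual_quiver D). s a \<noteq> 0}"

definition torus_orbit ::
    "dimer \<Rightarrow> (torus_edge \<Rightarrow> complex) set \<Rightarrow> (torus_edge \<Rightarrow> complex) set set" where
  "torus_orbit D y = {iso_class D (\<lambda>a. s a * v a) | s v. s \<in> torus_reps D \<and> v \<in> y}"

definition torus_orbits :: "dimer \<Rightarrow> (torus_tile \<Rightarrow> rat) \<Rightarrow> (torus_edge \<Rightarrow> complex) set set set" where
  "torus_orbits D \<theta> = torus_orbit D ` moduli D \<theta>"

text \<open>
  The lattice \<open>N\<close> of one-parameter subgroups of this torus is the group of integral weights \<open>k\<close>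
  below modulo the integral functions \<open>a \<mapsto> m (head a) - m (tail a)\<close>, and \<open>k\<close> acts on a
  representation by \<open>(t\<^bsup>k a\<^esup>)\<^sub>a\<close>. A subset of \<open>N\<^sub>\<real>\<close> is encoded throughout by its preimage under the
  quotient map from real weights, i.e. by a set of real weights saturated under \<open>coboundaries\<close>.
\<close>

definition int_weights :: "dimer \<Rightarrow> (torus_edge \<Rightarrow> int) set" where
  "int_weights D = {k. (\<forall>a. a \<notin> arcs (dual_quiver D) \<longrightarrow> k a = 0) \<and>
     (\<forall>e\<in>edges D. sum_list (map k (plus_path D e)) = sum_list (map k (minus_path D e)))}"

definition coboundaries :: "dimer \<Rightarrow> (torus_edge \<Rightarrow> real) set" where
  "coboundaries D =
     {\<lambda>a. if a \<in> arcs (dual_quiver D)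
          then m (head (dual_quiver D) a) - m (tail (dual_quiver D) a) else 0 | m. True}"

definition one_parameter :: "dimer \<Rightarrow> (torus_edge \<Rightarrow> int) \<Rightarrow> complex \<Rightarrow> torus_edge \<Rightarrow> complex" where
  "one_parameter D k t = (\<lambda>a. if a \<in> arcs (dual_quiver D) then t powi k a else 0)"

text \<open>
  In the toric variety of a fan \<open>\<Sigma>\<close>, the limit as \<open>t \<rightarrow> 0\<close> of a one-parameter subgroup \<open>k \<in> N\<close>
  exists and lies in the orbit \<open>O\<^sub>\<sigma>\<close> iff \<open>k\<close> is in the relative interior of \<open>\<sigma> \<in> \<Sigma>\<close>. Hence \<open>\<sigma>\<close> is the
  closed convex cone generated by those \<open>k\<close>.
\<close>

definition limit_weights ::
    "dimer \<Rightarrow> (torus_tile \<Rightarrow> rat) \<Rightarrow> (torus_edge \<Rightarrow> complex) set set \<Rightarrow> (torus_edge \<Rightarrow> int) set" where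
  "limit_weights D \<theta> Orb = {k \<in> int_weights D.
     \<exists>y\<in>Orb. limitin (moduli_topology D \<theta>) (\<lambda>t. iso_class D (one_parameter D k t)) y (at 0)}"

definition orbit_cone ::
    "dimer \<Rightarrow> (torus_tile \<Rightarrow> rat) \<Rightarrow> (torus_edge \<Rightarrow> complex) set set \<Rightarrow> (torus_edge \<Rightarrow> real) set" where
  "orbit_cone D \<theta> Orb = closure
     {\<lambda>a. \<Sum>k\<in>K. c k * real_of_int (k a) | K c.
        finite K \<and> K \<subseteq> limit_weights D \<theta> Orb \<and> (\<forall>k\<in>K. c k \<ge> 0)}"

definition fan :: "dimer \<Rightarrow> (torus_tile \<Rightarrow> rat) \<Rightarrow> (torus_edge \<Rightarrow> real) set set" where
  "fan D \<theta> = orbit_cone D \<theta> ` torus_orbits D \<theta>"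

definition weight_dim :: "(torus_edge \<Rightarrow> real) set \<Rightarrow> nat" where
  "weight_dim S = vector_space.dim (\<lambda>c u. \<lambda>a. c * u a) S"

text \<open>The set \<open>\<Sigma>\<^sub>\<theta>(d)\<close>; the coboundaries are the kernel of the map onto \<open>N\<^sub>\<real>\<close>.\<close>

definition fan_cones :: "dimer \<Rightarrow> (torus_tile \<Rightarrow> rat) \<Rightarrow> nat \<Rightarrow> (torus_edge \<Rightarrow> real) set set" where
  "fan_cones D \<theta> d = {\<sigma> \<in> fan D \<theta>. weight_dim \<sigma> = d + weight_dim (coboundaries D)}"

section \<open>The quivers associated to cones\<close>

definition orbit_of ::
    "dimer \<Rightarrow> (torus_tile \<Rightarrow> rat) \<Rightarrow> (torus_edge \<Rightarrow> real) set \<Rightarrow> (torus_edge \<Rightarrow> complex) set set" where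
  "orbit_of D \<theta> \<sigma> = (THE Orb. Orb \<in> torus_orbits D \<theta> \<and> orbit_cone D \<theta> Orb = \<sigma>)"

text \<open>The perfect matching \<open>\<Pi>\<^sub>\<rho>\<close>, which does not depend on the chosen point or representative.\<close>

definition ray_matching ::
    "dimer \<Rightarrow> (torus_tile \<Rightarrow> rat) \<Rightarrow> (torus_edge \<Rightarrow> real) set \<Rightarrow> torus_edge set" where
  "ray_matching D \<theta> \<rho> =
     (let v = (SOME v. v \<in> stable_reps D \<theta> \<and> iso_class D v \<in> orbit_of D \<theta> \<rho>)
      in {a \<in> arcs (dual_quiver D). v a = 0})"

definition rays :: "dimer \<Rightarrow> (torus_tile \<Rightarrow> rat) \<Rightarrow> (torus_edge \<Rightarrow> real) set \<Rightarrow>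
    (torus_edge \<Rightarrow> real) set set" where
  "rays D \<theta> \<sigma> = {\<rho> \<in> fan_cones D \<theta> 1. \<rho> \<subseteq> \<sigma>}"

definition cone_module ::
    "dimer \<Rightarrow> (torus_tile \<Rightarrow> rat) \<Rightarrow> (torus_edge \<Rightarrow> real) set \<Rightarrow> torus_edge \<Rightarrow> complex" where
  "cone_module D \<theta> \<sigma> = (\<lambda>a. if a \<in> arcs (dual_quiver D) \<and>
       a \<notin> (\<Union>\<rho>\<in>rays D \<theta> \<sigma>. ray_matching D \<theta> \<rho>) then 1 else 0)"

definition cone_quiver ::
    "dimer \<Rightarrow> (torus_tile \<Rightarrow> rat) \<Rightarrow> (torus_edge \<Rightarrow> real) set \<Rightarrow>
     (torus_tile, torus_edge) pre_digraph" where
  "cone_quiver D \<theta> \<sigma> =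
     (dual_quiver D)\<lparr>arcs := {a \<in> arcs (dual_quiver D). cone_module D \<theta> \<sigma> a \<noteq> 0}\<rparr>"

text \<open>
  For \<open>\<tau> = \<sigma>\<^sub>+ \<inter> \<sigma>\<^sub>-\<close>. The removed edges are closed, i.e. contain their endnodes; as every
  \<open>\<Pi>\<^sub>\<rho>\<close> is a perfect matching, all nodes are removed.
\<close>

definition jigsaw_pieces ::
    "dimer \<Rightarrow> (torus_tile \<Rightarrow> rat) \<Rightarrow> (torus_edge \<Rightarrow> real) set \<Rightarrow> (torus_edge \<Rightarrow> real) set \<Rightarrow>
     (complex \<times> complex) set set" where
  "jigsaw_pieces D \<theta> \<sigma>p \<sigma>m = closure `
     components (torus - \<Union>(\<Union>\<rho>\<in>rays D \<theta> \<sigma>p \<union> rays D \<theta> \<sigma>m. ray_matching D \<theta> \<rho>))"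

definition zero_piece ::
    "dimer \<Rightarrow> torus_tile \<Rightarrow> (torus_tile \<Rightarrow> rat) \<Rightarrow> (torus_edge \<Rightarrow> real) set \<Rightarrow>
     (torus_edge \<Rightarrow> real) set \<Rightarrow> (complex \<times> complex) set" where
  "zero_piece D i0 \<theta> \<sigma>p \<sigma>m = (THE J. J \<in> jigsaw_pieces D \<theta> \<sigma>p \<sigma>m \<and> i0 \<subseteq> J)"

text \<open>
  The quivers \<open>Q(\<tau>)\<^sup>+\<close> and \<open>Q(\<tau>)\<^sup>-\<close> are obtained for \<open>\<sigma> = \<sigma>\<^sub>+\<close> and \<open>\<sigma> = \<sigma>\<^sub>-\<close> respectively.
\<close>

definition tau_quiver ::
    "dimer \<Rightarrow> torus_tile \<Rightarrow> (torus_tile \<Rightarrow> rat) \<Rightarrow> (torus_edge \<Rightarrow> real) set \<Rightarrow>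
     (torus_edge \<Rightarrow> real) set \<Rightarrow> (torus_edge \<Rightarrow> real) set \<Rightarrow>
     (torus_tile, torus_edge) pre_digraph" where
  "tau_quiver D i0 \<theta> \<sigma>p \<sigma>m \<sigma> =
     cone_quiver D \<theta> \<sigma> \<restriction> {i \<in> verts (dual_quiver D). \<not> i \<subseteq> zero_piece D i0 \<theta> \<sigma>p \<sigma>m}"

definition source_vertices :: "('a, 'b) pre_digraph \<Rightarrow> 'a set" where
  "source_vertices G = {i \<in> verts G. in_arcs G i = {}}"

end

theory Submission imports Defs begin

text \<open>The rays of a cone are perfect matchings, and the cone corresponds to the union of its matchings.
  The difference of two perfect matchings is a flow without sources on the lifted graph; its class is
  given by two periods, so any three differences satisfy an integer relation up to a potential
  \<open>m\<close> on the tiles. For the matchings of two cones adjacent along a wall this gives a relation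
  \<open>c0 \<Pi>0 + c1 \<Pi>1 + c2 \<Pi>2 + c3 \<Pi>3 = dm\<close> with \<open>c0, c3 > 0\<close>. The potential is constant on jigsaw pieces
  and increases along the arrows of either cone quiver. A source of one quiver is reached from the
  zero piece by one arrow and therefore has the least value that is possible outside this piece; an
  arrow of the other quiver ending there starts at a smaller value, hence in the zero piece.\<close>

text \<open>A cone of the fan is given through limits of one-parameter subgroups in a quotient
  topology, and neither smoothness nor simpliciality of the cones is at hand. The proof therefore
  replaces a cone by the set \<open>Z\<close> of arrows that vanish on its orbit. As the stability
  parameter is \<open>0\<close>-generated, stability says that every vertex can be reached from
  \<open>i0\<close> along arrows outside \<open>Z\<close>. A weight that becomes nonnegative and
  vanishes outside \<open>Z\<close> after adding a coboundary then determines this coboundary, so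
  that weights can be compared between cones. A maximal cone is not known to have a single ray
  outside the wall, hence \<open>Zm\<close> might contain several matchings in the role of
  \<open>M3\<close>; \<open>wall_matchings_agree\<close> shows that they coincide on the arrows
  outside \<open>Zp\<close>, which is what the last step requires. In that step \<open>M0\<close>
  and \<open>M3\<close> are not fixed beforehand but chosen through two arrows ending at the
  source.\<close>

hide_const (open) Digraph_Component.connected

subsection \<open>Cyclic orders\<close>

text \<open>Covers both senses of rotation at once: \<open>D x y\<close> is the angle from
  \<open>x\<close> to \<open>y\<close> in the chosen sense, \<open>T\<close> is a full turn, and
  \<open>D_diff\<close> is subtraction modulo \<open>T\<close>. White nodes use the clockwise
  instance, black nodes the counterclockwise one.\<close>

locale cyclic_order =
  fixes S :: "'a set" and D :: "'a \<Rightarrow> 'a \<Rightarrow> real" and nxt :: "'a \<Rightarrow> 'a" and T :: real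
  assumes finS: "finite S"
    and D_nonneg: "x \<in> S \<Longrightarrow> y \<in> S \<Longrightarrow> 0 \<le> D x y \<and> D x y < T"
    and D_eq0: "x \<in> S \<Longrightarrow> y \<in> S \<Longrightarrow> D x y = 0 \<longleftrightarrow> x = y"
    and D_diff: "x \<in> S \<Longrightarrow> y \<in> S \<Longrightarrow> z \<in> S \<Longrightarrow>
      D y z = (if D x z \<ge> D x y then D x z - D x y else D x z - D x y + T)"
    and nxt: "y \<in> S \<Longrightarrow> nxt y = arg_min (D y) (\<lambda>z. z \<in> S - {y})"
begin

lemma nxt_in: "y \<in> S \<Longrightarrow> S \<noteq> {y} \<Longrightarrow> nxt y \<in> S - {y}"
  and nxt_least: "y \<in> S \<Longrightarrow> z \<in> S - {y} \<Longrightarrow> D y (nxt y) \<le> D y z"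
proof -
  assume y: "y \<in> S" "S \<noteq> {y}"
  then show "nxt y \<in> S - {y}"
    using arg_min_if_finite(1)[of "S - {y}" "D y"] finS nxt[OF y(1)] by (auto simp: arg_min_on_def)
next
  assume y: "y \<in> S" and z: "z \<in> S - {y}"
  show "D y (nxt y) \<le> D y z"
    using arg_min_least[of "S - {y}" z "D y"] finS z nxt[OF y] by (auto simp: arg_min_on_def)
qed

lemma D_inj: "x \<in> S \<Longrightarrow> y \<in> S \<Longrightarrow> z \<in> S \<Longrightarrow> D x y = D x z \<Longrightarrow> y = z"
  using D_diff[of x y z] D_eq0[of y z] by auto

text \<open>Counting the elements up to the angle of the current iterate shows that
  \<open>nxt\<close> visits \<open>S\<close> in increasing order of angle: as long as some element
  lies ahead, the successor is the nearest of these and raises the count by one.\<close>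

lemma iterate:
  assumes x: "x \<in> S" and "j < card S"
  shows "(nxt ^^ j) x \<in> S \<and> card {z \<in> S. D x z \<le> D x ((nxt ^^ j) x)} = Suc j"
  using assms(2)
proof (induction j)
  case 0
  have "{z \<in> S. D x z \<le> D x x} = {x}"
  proof (intro equalityI subsetI)
    fix w assume w: "w \<in> {z \<in> S. D x z \<le> D x x}"
    then have "D x w = 0" using D_eq0[OF x x] D_nonneg[OF x, of w] by auto
    then show "w \<in> {x}" using D_eq0[OF x, of w] w by auto
  qed (use x in auto)
  then show ?case using x by simp
next
  case (Suc j)
  define y where "y = (nxt ^^ j) x"
  have yS: "y \<in> S" and cy: "card {z \<in> S. D x z \<le> D x y} = Suc j"
    using Suc unfolding y_def by auto
  have "\<exists>z\<in>S. D x y < D x z"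
  proof (rule ccontr)
    assume "\<not> ?thesis"
    then have "{z \<in> S. D x z \<le> D x y} = S" by force
    then show False using cy Suc.prems by simp
  qed
  then obtain z where z: "z \<in> S" "D x y < D x z" by auto
  have ny: "nxt y \<in> S" "nxt y \<noteq> y" using nxt_in[OF yS] z by auto
  have dz: "D y z = D x z - D x y" using D_diff[OF x yS z(1)] z by simp
  \<comment> \<open>A successor that wrapped around past \<open>x\<close> would be at distance at
    least \<open>T - D x y\<close> from \<open>y\<close>, farther than \<open>z\<close>, which lies
    ahead of \<open>y\<close>.\<close>
  have above: "D x y < D x (nxt y)"
  proof (rule ccontr)
    assume *: "\<not> ?thesis"
    then have "D x (nxt y) < D x y" using D_inj[OF x ny(1) yS] ny(2) by force
    then have "D y (nxt y) = D x (nxt y) - D x y + T" using D_diff[OF x yS ny(1)] by simp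
    moreover have "D y (nxt y) \<le> D y z" using nxt_least[OF yS] z by force
    moreover have "D x z < T" "0 \<le> D x (nxt y)" using D_nonneg x z(1) ny(1) by auto
    ultimately show False using dz by simp
  qed
  have le: "D x (nxt y) \<le> D x w" if "w \<in> S" "D x y < D x w" for w
    using nxt_least[OF yS, of w] D_diff[OF x yS that(1)] D_diff[OF x yS ny(1)] that above by force
  have "{z \<in> S. D x z \<le> D x (nxt y)} = insert (nxt y) {z \<in> S. D x z \<le> D x y}"
  proof (intro equalityI subsetI)
    fix w assume w: "w \<in> {z \<in> S. D x z \<le> D x (nxt y)}"
    show "w \<in> insert (nxt y) {z \<in> S. D x z \<le> D x y}"
    proof (cases "D x y < D x w")
      case True
      then have "D x w = D x (nxt y)" using w le[of w] by auto
      then show ?thesis using D_inj[OF x _ ny(1)] w by auto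
    qed (use w in auto)
  qed (use above ny(1) in auto)
  moreover have "nxt y \<notin> {z \<in> S. D x z \<le> D x y}" using above by simp
  ultimately have "card {z \<in> S. D x z \<le> D x (nxt y)} = Suc (Suc j)"
    using cy finS by simp
  then show ?case using ny(1) unfolding y_def by simp
qed

lemma iterate_bij:
  assumes x: "x \<in> S"
  shows "bij_betw (\<lambda>j. (nxt ^^ j) x) {..<card S} S"
proof -
  have "inj_on (\<lambda>j. (nxt ^^ j) x) {..<card S}"
  proof (rule inj_onI)
    fix i j assume "i \<in> {..<card S}" "j \<in> {..<card S}" and e: "(nxt ^^ i) x = (nxt ^^ j) x"
    then have "Suc i = Suc j" using iterate[OF x, of i] iterate[OF x, of j] unfolding e by (metis lessThan_iff)
    then show "i = j" by simp
  qed
  moreover have "(\<lambda>j. (nxt ^^ j) x) ` {..<card S} \<subseteq> S" using iterate[OF x] by auto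
  ultimately show ?thesis unfolding bij_betw_def
    using card_subset_eq[OF finS, of "(\<lambda>j. (nxt ^^ j) x) ` {..<card S}"]
      card_image[of "\<lambda>j. (nxt ^^ j) x" "{..<card S}"] by simp
qed

text \<open>After \<open>card S - 1\<close> steps the largest angle is reached, so the successor
  wraps around to the smallest one, which belongs to \<open>x\<close>. A singleton is excluded
  because \<open>nxt\<close> would minimise over the empty set.\<close>

lemma iterate_closes:
  assumes x: "x \<in> S" and "S \<noteq> {x}"
  shows "(nxt ^^ card S) x = x"
proof -
  define n where "n = card S - 1"
  have cS: "card S = Suc n" unfolding n_def using x finS card_gt_0_iff[of S] by auto
  define y where "y = (nxt ^^ n) x"
  have yS: "y \<in> S" and cy: "card {z \<in> S. D x z \<le> D x y} = Suc n"
    using iterate[OF x, of n] unfolding y_def by (auto simp: cS)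
  have "{z \<in> S. D x z \<le> D x y} = S"
    using cy cS finS by (intro card_subset_eq) auto
  then have le: "z \<in> S \<Longrightarrow> D x z \<le> D x y" for z by blast
  have "x \<noteq> y"
  proof
    assume "x = y"
    then have "z \<in> S \<Longrightarrow> z = x" for z
      using le[of z] D_eq0[OF x x] D_eq0[OF x, of z] D_nonneg[OF x, of z] by (metis order_antisym)
    then show False using assms by blast
  qed
  have nyS: "nxt y \<in> S - {y}" using nxt_in[OF yS] x \<open>x \<noteq> y\<close> by auto
  have lt: "D x z < D x y" if "z \<in> S - {y}" for z
    using le[of z] D_inj[OF x yS, of z] that by (metis DiffE order_le_less singletonI)
  have "D y (nxt y) \<le> D y x" using nxt_least[OF yS, of x] x \<open>x \<noteq> y\<close> by auto
  then have "D x (nxt y) \<le> D x x"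
    using D_diff[OF x yS, of "nxt y"] D_diff[OF x yS x] lt[OF nyS] lt[of x] nyS x \<open>x \<noteq> y\<close>
    by (simp split: if_splits)
  then have "nxt y = x"
    using D_eq0[OF x x] D_eq0[OF x, of "nxt y"] D_nonneg[OF x, of "nxt y"] nyS by (metis DiffE order_antisym)
  then show ?thesis unfolding cS y_def by simp
qed

end

text \<open>The hypothesis excludes that two points of \<open>S\<close> lie on one ray from \<open>c\<close>.\<close>

lemma cyclic_order_ccw:
  assumes "finite S" "c \<notin> S" and dir: "\<And>x y. x \<in> S \<Longrightarrow> y \<in> S \<Longrightarrow> Arg2pi ((y - c) / (x - c)) = 0 \<Longrightarrow> x = y"
  shows "cyclic_order S (\<lambda>x y. Arg2pi ((y - c) / (x - c))) (next_ccw S c) (2 * pi)"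
proof
  fix x y z assume S: "x \<in> S" "y \<in> S" "z \<in> S"
  then have nz: "x - c \<noteq> 0" "y - c \<noteq> 0" "z - c \<noteq> 0" using assms(2) by auto
  show "Arg2pi ((z - c) / (y - c)) = (if Arg2pi ((y - c) / (x - c)) \<le> Arg2pi ((z - c) / (x - c))
        then Arg2pi ((z - c) / (x - c)) - Arg2pi ((y - c) / (x - c))
        else Arg2pi ((z - c) / (x - c)) - Arg2pi ((y - c) / (x - c)) + 2 * pi)"
    using Arg2pi_diff[of "(z - c) / (x - c)" "(y - c) / (x - c)"] nz by (auto split: if_splits)
next
  fix x y assume S: "x \<in> S" "y \<in> S"
  then have nz: "x - c \<noteq> 0" using assms(2) by auto
  then show "(Arg2pi ((y - c) / (x - c)) = 0) = (x = y)"
    using dir[OF S] Arg2pi_real[of 1] by auto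
qed (use assms in \<open>auto simp: next_ccw_def Arg2pi\<close>)

lemma cyclic_order_cw:
  assumes "finite S" "c \<notin> S" and dir: "\<And>x y. x \<in> S \<Longrightarrow> y \<in> S \<Longrightarrow> Arg2pi ((y - c) / (x - c)) = 0 \<Longrightarrow> x = y"
  shows "cyclic_order S (\<lambda>x y. Arg2pi ((x - c) / (y - c))) (next_cw S c) (2 * pi)"
proof
  fix x y z assume S: "x \<in> S" "y \<in> S" "z \<in> S"
  then have nz: "x - c \<noteq> 0" "y - c \<noteq> 0" "z - c \<noteq> 0" using assms(2) by auto
  show "Arg2pi ((y - c) / (z - c)) = (if Arg2pi ((x - c) / (y - c)) \<le> Arg2pi ((x - c) / (z - c))
        then Arg2pi ((x - c) / (z - c)) - Arg2pi ((x - c) / (y - c))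
        else Arg2pi ((x - c) / (z - c)) - Arg2pi ((x - c) / (y - c)) + 2 * pi)"
    using Arg2pi_diff[of "(x - c) / (z - c)" "(x - c) / (y - c)"] nz by (auto split: if_splits)
next
  fix x y assume S: "x \<in> S" "y \<in> S"
  then have nz: "x - c \<noteq> 0" using assms(2) by auto
  then show "(Arg2pi ((x - c) / (y - c)) = 0) = (x = y)"
    using dir[OF S(2) S(1)] Arg2pi_real[of 1] by auto
qed (use assms in \<open>auto simp: next_cw_def Arg2pi\<close>)

subsection \<open>Angles and crossing numbers\<close>

text \<open>The signed principal value, in contrast to \<open>Arg2pi\<close> in the cyclic orders:
  within a half plane it is a plain difference of arguments, without correction by a full
  turn.\<close>

definition angle :: "complex \<Rightarrow> complex \<Rightarrow> complex \<Rightarrow> real" where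
  "angle n x y = Arg ((y - n) / (x - n))"

lemma Arg_divide_Re_pos:
  assumes "Re u > 0" "Re v > 0"
  shows "Arg (u / v) = Arg u - Arg v"
proof -
  have "u \<noteq> 0" "v \<noteq> 0" using assms by auto
  moreover have "\<bar>Arg u\<bar> < pi / 2" "\<bar>Arg v\<bar> < pi / 2" using assms Arg_Re_pos by auto
  ultimately show ?thesis using Arg_divide'[of u v] by auto
qed

text \<open>Rotating by \<open>cnj a\<close> moves the half plane \<open>a \<bullet> u > 0\<close> to the right half plane, where
  \<open>Arg\<close> is additive.\<close>

lemma Arg_divide_half_plane:
  assumes "a \<bullet> u > 0" "a \<bullet> v > 0"
  shows "Arg (u / v) = Arg (cnj a * u) - Arg (cnj a * v)"
proof -
  have "a \<noteq> 0" using assms by auto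
  then have "u / v = (cnj a * u) / (cnj a * v)" by simp
  then show ?thesis using assms Arg_divide_Re_pos[of "cnj a * u" "cnj a * v"]
    by (simp add: inner_complex_def)
qed

lemma angle_half_plane:
  assumes "a \<bullet> (x - n) > 0" "a \<bullet> (y - n) > 0"
  shows "angle n x y = Arg (cnj a * (y - n)) - Arg (cnj a * (x - n))"
  unfolding angle_def using assms by (rule Arg_divide_half_plane[rotated])

text \<open>For \<open>n\<close> off the sides of the triangle this is \<open>2 * pi\<close> times
  its winding number about \<open>n\<close>.\<close>

definition winding :: "complex \<Rightarrow> complex \<Rightarrow> complex \<Rightarrow> complex \<Rightarrow> real" where
  "winding n x y z = angle n x y + angle n y z + angle n z x"

text \<open>A line separating \<open>n\<close> from the triangle puts the three directions into one
  half plane, where the angles are differences of arguments and cancel cyclically.\<close>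

lemma winding_outside:
  assumes "n \<notin> convex hull {x, y, z}"
  shows "winding n x y z = 0"
proof -
  obtain a b where ab: "a \<bullet> n < b" "\<And>u. u \<in> convex hull {x, y, z} \<Longrightarrow> a \<bullet> u > b"
    using separating_hyperplane_closed_point[of "convex hull {x, y, z}" n, OF convex_convex_hull
        compact_imp_closed[OF finite_imp_compact_convex_hull] assms] by auto
  have "x \<in> convex hull {x, y, z}" "y \<in> convex hull {x, y, z}" "z \<in> convex hull {x, y, z}"
    by (simp_all add: hull_inc)
  then have "a \<bullet> (x - n) > 0" "a \<bullet> (y - n) > 0" "a \<bullet> (z - n) > 0"
    using ab by (force simp: inner_diff_right)+
  then show ?thesis unfolding winding_def by (simp add: angle_half_plane[of a])
qed

text \<open>The number of signed crossings of the path \<open>[x, y]\<close> with the segment \<open>[w, b]\<close>: the angle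
  under which the segment is seen from a moving point changes continuously by the variation of the
  directions to \<open>b\<close> and \<open>w\<close>, except that its principal value jumps at each crossing.\<close>

definition crossing :: "complex \<Rightarrow> complex \<Rightarrow> lifted_edge \<Rightarrow> real" where
  "crossing x y e = (angle y (fst e) (snd e) - angle x (fst e) (snd e)
      - angle (snd e) x y + angle (fst e) x y) / (2 * pi)"

text \<open>A line separates the path from the segment. The segment seen from the path lies in one
  half plane, the path seen from the segment in the opposite one, so all four angles are differences
  of the same four arguments and cancel.\<close>

lemma crossing_disjoint:
  assumes "closed_segment x y \<inter> segment e = {}"
  shows "crossing x y e = 0"
proof -
  obtain a b where ab: "\<And>u. u \<in> closed_segment x y \<Longrightarrow> a \<bullet> u < b" "\<And>u. u \<in> segment e \<Longrightarrow> a \<bullet> u > b"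
    using separating_hyperplane_compact_closed[of "closed_segment x y" "segment e"] assms
    by (force simp: segment_def)
  have *: "a \<bullet> (fst e - x) > 0" "a \<bullet> (fst e - y) > 0" "a \<bullet> (snd e - x) > 0" "a \<bullet> (snd e - y) > 0"
    using ab(1)[of x] ab(1)[of y] ab(2)[of "fst e"] ab(2)[of "snd e"]
    by (auto simp: inner_diff_right segment_def)
  have "angle n x y = Arg (cnj a * (n - y)) - Arg (cnj a * (n - x))"
    if "a \<bullet> (n - x) > 0" "a \<bullet> (n - y) > 0" for n
  proof -
    have "(-a) \<bullet> (x - n) > 0" "(-a) \<bullet> (y - n) > 0" using that by (simp_all add: inner_diff_right)
    then have "angle n x y = Arg (cnj (-a) * (y - n)) - Arg (cnj (-a) * (x - n))"
      by (rule angle_half_plane)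
    moreover have "cnj (-a) * (u - n) = cnj a * (n - u)" for u by (simp add: algebra_simps)
    ultimately show ?thesis by simp
  qed
  then show ?thesis unfolding crossing_def using *
    by (simp add: angle_half_plane[of a "fst e" _ "snd e"])
qed

text \<open>Around a closed triangle the angles under which the segment is seen telescope, and only
  the windings about its two ends remain. This turns a sum over edges into sums over nodes.\<close>

lemma crossing_triangle:
  "crossing x y e + crossing y z e + crossing z x e =
     (winding (fst e) x y z - winding (snd e) x y z) / (2 * pi)"
  unfolding crossing_def winding_def by (simp add: field_simps)

lemma crossing_translate [simp]:
  "crossing (x + t) (y + t) (fst e + t, snd e + t) = crossing x y e"
  by (simp add: crossing_def angle_def)

text \<open>The four angles are arguments of quotients formed from the same four differences. Taken
  with their signs, these quotients cancel after normalisation, so the total angle is a multiple of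
  a full turn.\<close>

lemma crossing_integer:
  assumes nz: "x \<noteq> fst e" "x \<noteq> snd e" "y \<noteq> fst e" "y \<noteq> snd e"
  shows "crossing x y e \<in> \<int>"
proof -
  have c: "cis (Arg u) = u / norm u" if "u \<noteq> 0" for u
    using that by (simp add: cis_Arg sgn_eq)
  have "cis (2 * pi * crossing x y e) = 
     cis (Arg ((snd e - y) / (fst e - y))) * inverse (cis (Arg ((snd e - x) / (fst e - x)))) *
     inverse (cis (Arg ((y - snd e) / (x - snd e)))) * cis (Arg ((y - fst e) / (x - fst e)))"
    unfolding crossing_def angle_def by (simp add: cis_mult)
  also have "\<dots> = 1"
  proof -
    let ?s = "\<lambda>u. u / complex_of_real (norm u)"
    define p q r s where "p = snd e - y" and "q = fst e - y" and "r = snd e - x" and "s = fst e - x"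
    have nz': "p \<noteq> 0" "q \<noteq> 0" "r \<noteq> 0" "s \<noteq> 0" using nz by (auto simp: p_def q_def r_def s_def)
    have "?s (p / q) * inverse (?s (r / s)) * inverse (?s (p / r)) * ?s (q / s) = 1"
      using nz' by (simp add: norm_divide)
    moreover have "y - snd e = - p" "x - snd e = - r" "y - fst e = - q" "x - fst e = - s"
      by (simp_all add: p_def q_def r_def s_def)
    ultimately show ?thesis using nz'
      unfolding p_def[symmetric] q_def[symmetric] r_def[symmetric] s_def[symmetric]
      by (simp only: c minus_divide_divide divide_eq_0_iff simp_thms)
  qed
  finally have "cis (2 * pi * crossing x y e) = 1" .
  then obtain n :: int where "2 * pi * crossing x y e = of_int n * (2 * pi)"
    by (auto simp: cis_conv_exp exp_eq_1)
  then show ?thesis by auto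
qed

text \<open>Fixes the sign: the path passes from the left to the right of the edge, as an arrow of
  the quiver does when \<open>w\<close> is white. With \<open>b - w\<close> as unit all differences
  are \<open>p\<close> or \<open>q\<close> up to sign, and \<open>q\<close> is the conjugate of
  \<open>p\<close>, so every angle is expressed by \<open>t\<close>.\<close>

lemma crossing_midpoint:
  fixes w b :: complex and \<epsilon> :: real
  assumes "w \<noteq> b" "\<epsilon> > 0"
  shows "crossing (midpoint w b + of_real \<epsilon> * \<i> * (b - w)) (midpoint w b - of_real \<epsilon> * \<i> * (b - w)) (w, b) = -1"
proof -
  define v where "v = b - w"
  define x y where "x = midpoint w b + of_real \<epsilon> * \<i> * v" and "y = midpoint w b - of_real \<epsilon> * \<i> * v"
  have v: "v \<noteq> 0" using assms by (simp add: v_def)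
  define p where "p = Complex (1/2) \<epsilon>"
  define q where "q = Complex (1/2) (-\<epsilon>)"
  have m: "b - midpoint w b = v * Complex (1/2) 0" "w - midpoint w b = - (v * Complex (1/2) 0)"
    by (auto simp: v_def midpoint_def complex_eq_iff field_simps)
  have e: "of_real \<epsilon> * \<i> * v = v * Complex 0 \<epsilon>" by (auto simp: complex_eq_iff)
  have pts: "b - y = v * p" "w - y = - (v * q)" "b - x = v * q" "w - x = - (v * p)"
    using m e unfolding x_def y_def p_def q_def
    by (auto simp: complex_eq_iff field_simps)
  have pts': "y - b = - (v * p)" "y - w = v * q" "x - b = - (v * q)" "x - w = v * p"
    using pts by (metis minus_diff_eq minus_minus)+
  have pq: "p \<noteq> 0" "q \<noteq> 0" by (auto simp: p_def q_def complex_eq_iff)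
  define t where "t = Arg p"
  have Rep: "Re p > 0" "Im p > 0" "Re q > 0" using assms by (auto simp: p_def q_def)
  then have t: "0 < t" "t < pi / 2"
    using Arg_lt_pi[of p] Arg_Re_pos[of p] unfolding t_def by auto
  have "q = cnj p" by (simp add: p_def q_def complex_eq_iff)
  then have tq: "Arg q = - t" using Arg_cnj[of p] Rep t
    by (auto simp: t_def complex_is_Real_iff)
  have "Arg (p / q) = 2 * t" "Arg (q / p) = - 2 * t"
    using Arg_divide_Re_pos Rep tq by (auto simp: t_def)
  then have "Arg (- (p / q)) = 2 * t - pi" "Arg (- (q / p)) = pi - 2 * t"
    using Arg_minus[of "p / q"] Arg_minus[of "q / p"] pq t by auto
  then show ?thesis unfolding crossing_def angle_def
    using \<open>Arg (p / q) = 2 * t\<close> \<open>Arg (q / p) = - 2 * t\<close> v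
    unfolding v_def[symmetric] x_def[symmetric] y_def[symmetric] fst_conv snd_conv pts pts'
    by simp
qed

subsection \<open>The integer lattice and the torus\<close>

lemma int_lattice_uminus: "x \<in> int_lattice \<Longrightarrow> - x \<in> int_lattice"
  by (auto simp: int_lattice_def)

lemma int_lattice_range: "int_lattice = range (\<lambda>(m::int, n::int). Complex (of_int m) (of_int n))"
proof (intro equalityI subsetI)
  fix z assume "z \<in> int_lattice"
  then obtain m n where "Re z = of_int m" "Im z = of_int n" by (auto simp: int_lattice_def elim!: Ints_cases)
  then have "z = (case (m, n) of (m, n) \<Rightarrow> Complex (of_int m) (of_int n))" by (simp add: complex_eq_iff)
  then show "z \<in> range (\<lambda>(m::int, n::int). Complex (of_int m) (of_int n))" by blast
qed (auto simp: int_lattice_def)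

lemma finite_int_lattice_Int:
  assumes "bounded B" shows "finite (int_lattice \<inter> B)"
proof -
  obtain R where R: "\<And>x. x \<in> B \<Longrightarrow> norm x \<le> R" using assms bounded_iff by blast
  define N where "N = \<lceil>R\<rceil>"
  have "int_lattice \<inter> B \<subseteq> (\<lambda>(m::int, n::int). Complex (of_int m) (of_int n)) ` ({-N..N} \<times> {-N..N})"
  proof
    fix z assume "z \<in> int_lattice \<inter> B"
    then obtain m n :: int where z: "z = Complex (of_int m) (of_int n)" "z \<in> B"
      unfolding int_lattice_range by auto
    have "\<bar>Re z\<bar> \<le> R" "\<bar>Im z\<bar> \<le> R"
      using R[OF z(2)] abs_Re_le_cmod[of z] abs_Im_le_cmod[of z] by linarith+
    then have "\<bar>m\<bar> \<le> N" "\<bar>n\<bar> \<le> N" unfolding z(1) N_def by simp_all linarith+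
    then show "z \<in> (\<lambda>(m::int, n::int). Complex (of_int m) (of_int n)) ` ({-N..N} \<times> {-N..N})"
      using z(1) by (auto intro!: image_eqI[of _ _ "(m, n)"])
  qed
  then show ?thesis by (rule finite_subset) simp
qed

lemma cis_2pi_eq_iff: "cis (2 * pi * a) = cis (2 * pi * b) \<longleftrightarrow> a - b \<in> \<int>"
proof
  assume "cis (2 * pi * a) = cis (2 * pi * b)"
  then obtain n :: int where "2 * pi * a = 2 * pi * b + of_int n * (2 * pi)"
    unfolding cis_conv_exp exp_eq by (auto simp: complex_eq_iff)
  then have "2 * pi * (a - b) = 2 * pi * of_int n" by (simp add: algebra_simps)
  then have "a - b = of_int n" by simp
  then show "a - b \<in> \<int>" by simp
next
  assume "a - b \<in> \<int>"
  then obtain n where "a = b + of_int n" by (metis Ints_cases add.commute diff_add_cancel)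
  then show "cis (2 * pi * a) = cis (2 * pi * b)"
    using cis_multiple_2pi[of "of_int n"] by (simp add: distrib_left mult.assoc flip: cis_mult)
qed

lemma torus_proj_eq_iff: "torus_proj x = torus_proj y \<longleftrightarrow> y - x \<in> int_lattice"
proof -
  have "a - b \<in> \<int> \<longleftrightarrow> b - a \<in> (\<int> :: real set)" for a b by (metis Ints_minus minus_diff_eq)
  then show ?thesis unfolding torus_proj_def int_lattice_def by (simp add: cis_2pi_eq_iff)
qed

lemma torus_proj_add_lattice: "z \<in> int_lattice \<Longrightarrow> torus_proj (x + z) = torus_proj x"
  using torus_proj_eq_iff[of x "x + z"] by simp

lemma continuous_on_torus_proj: "continuous_on A torus_proj"
  unfolding torus_proj_def cis_conv_exp by (intro continuous_intros)

lemma torus_proj_in_torus: "torus_proj x \<in> torus"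
  by (simp add: torus_proj_def torus_def)

lemma torus_proj_surj: "p \<in> torus \<Longrightarrow> \<exists>x. torus_proj x = p"
proof -
  assume "p \<in> torus"
  then have n: "norm (fst p) = 1" "norm (snd p) = 1" by (auto simp: torus_def)
  have "cis (2 * pi * (Arg u / (2 * pi))) = u" if "norm u = 1" for u
    using that cis_Arg[of u] by (force simp: sgn_eq)
  then have "torus_proj (Complex (Arg (fst p) / (2 * pi)) (Arg (snd p) / (2 * pi))) = p"
    unfolding torus_proj_def using n by (simp add: prod_eq_iff)
  then show ?thesis by blast
qed

text \<open>A continuous local section of \<open>torus_proj\<close> through \<open>x\<close> is given by principal arguments.\<close>

lemma openin_torus_proj_image:
  assumes "open U"
  shows "openin (top_of_set torus) (torus_proj ` U)"
  unfolding openin_subopen[of _ "torus_proj ` U"]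
proof
  fix p assume "p \<in> torus_proj ` U"
  then obtain x where x: "x \<in> U" "p = torus_proj x" by auto
  define s where "s q = x + Complex (Arg (fst q / fst p) / (2 * pi)) (Arg (snd q / snd p) / (2 * pi))" for q
  have p: "fst p \<noteq> 0" "snd p \<noteq> 0" "norm (fst p) = 1" "norm (snd p) = 1" by (auto simp: x(2) torus_proj_def)
  have ps: "torus_proj (s q) = q" if "q \<in> torus" for q
  proof -
    have q: "norm (fst q) = 1" "norm (snd q) = 1" using that by (auto simp: torus_def)
    have c: "cis (2 * pi * (r + Arg (u / cis (2 * pi * r)) / (2 * pi))) = u" if "norm u = 1" for u r
    proof -
      have "cis (Arg (u / cis (2 * pi * r))) = u / cis (2 * pi * r)"
        using that by (subst cis_Arg) (auto simp: sgn_eq norm_divide)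
      then show ?thesis by (simp add: distrib_left flip: cis_mult)
    qed
    show ?thesis unfolding torus_proj_def s_def x(2) using c[OF q(1), of "Re x"] c[OF q(2), of "Im x"]
      by (simp add: prod_eq_iff torus_proj_def)
  qed
  have "isCont s p"
    unfolding s_def Complex_eq using p
    by (intro continuous_intros isCont_o2[OF _ continuous_at_Arg]) (auto simp: complex_nonpos_Reals_iff)
  moreover have "s p = x" using p(1,2) unfolding s_def by (simp add: Complex_eq)
  ultimately obtain V where V: "open V" "p \<in> V" "\<And>q. q \<in> V \<Longrightarrow> s q \<in> U"
    using assms x(1) unfolding continuous_at_open by metis
  have "torus \<inter> V \<subseteq> torus_proj ` U"
  proof
    fix q assume "q \<in> torus \<inter> V"
    then show "q \<in> torus_proj ` U" using ps[of q] V(3)[of q] by (metis IntE imageI)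
  qed
  then show "\<exists>T. openin (top_of_set torus) T \<and> p \<in> T \<and> T \<subseteq> torus_proj ` U"
    using V x torus_proj_in_torus by (intro exI[of _ "torus \<inter> V"]) auto
qed

lemma segment_translate: "segment (fst e + z, snd e + z) = (\<lambda>x. x + z) ` segment e"
  using closed_segment_translation[of z "fst e" "snd e"] by (simp add: segment_def add.commute)

lemma compact_edge: "compact (segment e)"
  by (simp add: segment_def)

subsection \<open>Local finiteness of a dimer model\<close>

locale dimer_geometry =
  fixes D :: dimer
  assumes dimer_model: "dimer_model D"
begin

definition nodes :: "complex set" where
  "nodes = white D \<union> black D"

lemma white_Int_black: "white D \<inter> black D = {}"
  and edges_sub: "edges D \<subseteq> white D \<times> black D"
  and finite_torus_nodes: "finite (torus_proj ` nodes)"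
  and finite_torus_edges: "finite (edge_proj ` edges D)"
  and segment_nodes: "e \<in> edges D \<Longrightarrow> segment e \<inter> nodes = {fst e, snd e}"
  and edges_disjoint: "e \<in> edges D \<Longrightarrow> e' \<in> edges D \<Longrightarrow> e \<noteq> e' \<Longrightarrow>
    open_segment (fst e) (snd e) \<inter> open_segment (fst e') (snd e') = {}"
  and tile_bounded: "C \<in> lifted_tiles D \<Longrightarrow> bounded C"
  and tile_convex: "C \<in> lifted_tiles D \<Longrightarrow> convex C"
  using dimer_model unfolding dimer_model_def nodes_def by (elim conjE; simp)+

lemma lattice_images:
  assumes "z \<in> int_lattice"
  shows "(\<lambda>n. n + z) ` white D = white D" "(\<lambda>n. n + z) ` black D = black D"
    "(\<lambda>(w, b). (w + z, b + z)) ` edges D = edges D"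
  using dimer_model assms unfolding dimer_model_def by (elim conjE; simp)+

lemma white_translate: "n \<in> white D \<Longrightarrow> z \<in> int_lattice \<Longrightarrow> n + z \<in> white D"
  and black_translate: "n \<in> black D \<Longrightarrow> z \<in> int_lattice \<Longrightarrow> n + z \<in> black D"
  and edge_translate: "e \<in> edges D \<Longrightarrow> z \<in> int_lattice \<Longrightarrow> (fst e + z, snd e + z) \<in> edges D"
proof -
  assume "n \<in> white D" "z \<in> int_lattice"
  then show "n + z \<in> white D" using lattice_images(1) by blast
next
  assume "n \<in> black D" "z \<in> int_lattice"
  then show "n + z \<in> black D" using lattice_images(2) by blast
next
  assume "e \<in> edges D" "z \<in> int_lattice"
  then have "(case e of (w, b) \<Rightarrow> (w + z, b + z)) \<in> edges D" using lattice_images(3) by blast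
  then show "(fst e + z, snd e + z) \<in> edges D" by (simp add: case_prod_beta)
qed

lemma node_translate: "n \<in> nodes \<Longrightarrow> z \<in> int_lattice \<Longrightarrow> n + z \<in> nodes"
  using white_translate black_translate unfolding nodes_def by blast

lemma edge_ends: "e \<in> edges D \<Longrightarrow> fst e \<in> white D \<and> snd e \<in> black D \<and> fst e \<noteq> snd e
    \<and> fst e \<in> nodes \<and> snd e \<in> nodes"
  using edges_sub white_Int_black unfolding nodes_def by (cases e) auto

lemma edge_eq_of_common_point:
  assumes "e \<in> edges D" "e' \<in> edges D" "x \<in> open_segment (fst e) (snd e)" "x \<in> segment e'"
  shows "e = e'"
proof -
  have "x \<notin> nodes" using segment_nodes[OF assms(1)] assms(3) unfolding segment_def open_segment_def by auto
  then have "x \<in> open_segment (fst e') (snd e')"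
    using assms(4) segment_nodes[OF assms(2)] unfolding segment_def open_segment_def by auto
  then show ?thesis using edges_disjoint[OF assms(1,2)] assms(3) by blast
qed

text \<open>Distinct edges may share nodes, so equality is detected at the midpoint of
  \<open>e\<close>: some translate of \<open>e\<close> has this inner point in common with
  \<open>e'\<close>.\<close>

lemma edge_proj_eq_iff:
  assumes "e \<in> edges D" "e' \<in> edges D"
  shows "edge_proj e = edge_proj e' \<longleftrightarrow> (\<exists>z\<in>int_lattice. e' = (fst e + z, snd e + z))"
proof
  assume eq: "edge_proj e = edge_proj e'"
  define x where "x = midpoint (fst e) (snd e)"
  have x: "x \<in> open_segment (fst e) (snd e)" using edge_ends[OF assms(1)] by (simp add: x_def)
  then have "torus_proj x \<in> edge_proj e"
    unfolding edge_proj_def segment_def using open_closed_segment by blast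
  then have "torus_proj x \<in> torus_proj ` segment e'" using eq by (simp add: edge_proj_def)
  then obtain y where y: "y \<in> segment e'" "torus_proj x = torus_proj y" by auto
  define z where "z = y - x"
  have z: "z \<in> int_lattice" using y(2) torus_proj_eq_iff z_def by simp
  have "x + z \<in> open_segment (fst e + z) (snd e + z)"
    using x open_segment_translation_eq[of z x "fst e" "snd e"] by (simp add: add.commute)
  then have "(fst e + z, snd e + z) = e'"
    using edge_eq_of_common_point[OF edge_translate[OF assms(1) z] assms(2), of y] y(1) by (simp add: z_def)
  then show "\<exists>z\<in>int_lattice. e' = (fst e + z, snd e + z)" using z by auto
next
  assume "\<exists>z\<in>int_lattice. e' = (fst e + z, snd e + z)"
  then show "edge_proj e = edge_proj e'"
    by (auto simp: edge_proj_def segment_translate image_image torus_proj_add_lattice)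
qed

lemma finite_translates_meeting:
  assumes "bounded A" "bounded B"
  shows "finite {z \<in> int_lattice. (\<lambda>x. x + z) ` A \<inter> B \<noteq> {}}"
proof -
  have "{z \<in> int_lattice. (\<lambda>x. x + z) ` A \<inter> B \<noteq> {}} \<subseteq> int_lattice \<inter> (\<lambda>(x, y). x - y) ` (B \<times> A)"
  proof
    fix z assume "z \<in> {z \<in> int_lattice. (\<lambda>x. x + z) ` A \<inter> B \<noteq> {}}"
    then obtain y where "z \<in> int_lattice" "y \<in> A" "y + z \<in> B" by auto
    moreover have "z = (y + z) - y" by simp
    ultimately show "z \<in> int_lattice \<inter> (\<lambda>(x, y). x - y) ` (B \<times> A)" by force
  qed
  then show ?thesis
    using finite_int_lattice_Int[OF bounded_minus[OF assms(2,1)]] by (rule finite_subset)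
qed

lemma finite_edges_meeting:
  assumes "bounded B"
  shows "finite {e \<in> edges D. segment e \<inter> B \<noteq> {}}"
proof -
  obtain F where F: "F \<subseteq> edges D" "finite F" "edge_proj ` edges D = edge_proj ` F"
    using finite_subset_image[OF finite_torus_edges order_refl] by blast
  let ?tr = "\<lambda>f z. (fst f + z, snd f + z) :: lifted_edge"
  have "{e \<in> edges D. segment e \<inter> B \<noteq> {}} \<subseteq>
    (\<Union>f\<in>F. ?tr f ` {z \<in> int_lattice. (\<lambda>x. x + z) ` segment f \<inter> B \<noteq> {}})"
  proof
    fix e assume e: "e \<in> {e \<in> edges D. segment e \<inter> B \<noteq> {}}"
    then obtain f where f: "f \<in> F" "edge_proj e = edge_proj f" using F(3) by blast
    then obtain z where "z \<in> int_lattice" "e = ?tr f z"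
      using edge_proj_eq_iff[of f e] F(1) e by auto
    then show "e \<in> (\<Union>f\<in>F. ?tr f ` {z \<in> int_lattice. (\<lambda>x. x + z) ` segment f \<inter> B \<noteq> {}})"
      using f(1) e by (auto simp: segment_translate)
  qed
  moreover have "finite (\<Union>f\<in>F. ?tr f ` {z \<in> int_lattice. (\<lambda>x. x + z) ` segment f \<inter> B \<noteq> {}})"
    using F(2) assms compact_imp_bounded[OF compact_edge] by (intro finite_UN_I finite_imageI finite_translates_meeting)
  ultimately show ?thesis by (rule finite_subset)
qed

lemma finite_nodes_Int:
  assumes "bounded B"
  shows "finite (nodes \<inter> B)"
proof -
  obtain F where F: "F \<subseteq> nodes" "finite F" "torus_proj ` nodes = torus_proj ` F"
    using finite_subset_image[OF finite_torus_nodes order_refl] by blast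
  have "nodes \<inter> B \<subseteq> (\<Union>f\<in>F. (\<lambda>z. f + z) ` {z \<in> int_lattice. (\<lambda>x. x + z) ` {f} \<inter> B \<noteq> {}})"
  proof
    fix n assume n: "n \<in> nodes \<inter> B"
    then obtain f where f: "f \<in> F" "torus_proj f = torus_proj n" using F(3) by (metis IntD1 imageE imageI)
    then have "n - f \<in> int_lattice" "n = f + (n - f)" using torus_proj_eq_iff by auto
    then show "n \<in> (\<Union>f\<in>F. (\<lambda>z. f + z) ` {z \<in> int_lattice. (\<lambda>x. x + z) ` {f} \<inter> B \<noteq> {}})"
      using f(1) n by (intro UN_I[OF f(1)] image_eqI[of _ _ "n - f"]) auto
  qed
  moreover have "finite (\<Union>f\<in>F. (\<lambda>z. f + z) ` {z \<in> int_lattice. (\<lambda>x. x + z) ` {f} \<inter> B \<noteq> {}})"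
    using F(2) assms by (intro finite_UN_I finite_imageI finite_translates_meeting) auto
  ultimately show ?thesis by (rule finite_subset)
qed

lemma countable_nodes: "countable nodes"
proof -
  have "nodes = (\<Union>k::nat. nodes \<inter> ball 0 (real k))"
  proof (intro equalityI subsetI)
    fix x assume "x \<in> nodes"
    moreover obtain k :: nat where "norm x < real k" using reals_Archimedean2 by blast
    ultimately show "x \<in> (\<Union>k::nat. nodes \<inter> ball 0 (real k))" by auto
  qed auto
  moreover have "countable (nodes \<inter> ball 0 (real k))" for k :: nat
    by (intro countable_finite finite_nodes_Int bounded_ball)
  ultimately show ?thesis using countable_UN[of UNIV "\<lambda>k::nat. nodes \<inter> ball 0 (real k)"] by simp
qed

lemma countable_edges: "countable (edges D)"
  using countable_nodes edges_sub
  by (intro countable_subset[OF _ countable_SIGMA[OF countable_nodes countable_nodes]]) (auto simp: nodes_def)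

lemma finite_edges_at: "finite (edges_at D n)"
  by (rule finite_subset[OF _ finite_edges_meeting[of "{n}"]]) (auto simp: edges_at_def segment_def)

text \<open>A convergent sequence is bounded and therefore meets only finitely many of the
  segments.\<close>

lemma closed_Union_segments:
  assumes "E \<subseteq> edges D"
  shows "closed (\<Union>e\<in>E. segment e)"
  unfolding closed_sequential_limits
proof (intro allI impI, elim conjE)
  fix X l assume X: "\<forall>n. X n \<in> (\<Union>e\<in>E. segment e)" "X \<longlonglongrightarrow> l"
  define F where "F = {e \<in> E. segment e \<inter> range X \<noteq> {}}"
  have "finite F"
    by (rule finite_subset[OF _ finite_edges_meeting[OF convergent_imp_bounded[OF X(2)]]])
      (use assms in \<open>auto simp: F_def\<close>)
  then have "closed (\<Union>e\<in>F. segment e)"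
    by (intro closed_UN) (auto intro: compact_imp_closed[OF compact_edge])
  moreover have "\<forall>n. X n \<in> (\<Union>e\<in>F. segment e)" using X(1) by (fastforce simp: F_def)
  ultimately have "l \<in> (\<Union>e\<in>F. segment e)" using X(2) closed_sequential_limits by blast
  then show "l \<in> (\<Union>e\<in>E. segment e)" by (auto simp: F_def)
qed

lemma closed_subset_nodes:
  assumes "N \<subseteq> nodes"
  shows "closed N"
proof -
  have "\<not> x islimpt N" for x
  proof
    assume "x islimpt N"
    then have "infinite (N \<inter> ball x 1)" by (simp add: islimpt_eq_infinite_ball)
    moreover have "N \<inter> ball x 1 \<subseteq> nodes \<inter> ball x 1" using assms by auto
    ultimately show False using finite_nodes_Int[OF bounded_ball] finite_subset by blast
  qed
  then show ?thesis by (simp add: closed_limpt)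
qed

lemma skeleton_eq: "skeleton D = nodes \<union> (\<Union>e\<in>edges D. segment e)"
  by (simp add: skeleton_def nodes_def)

lemma closed_skeleton: "closed (skeleton D)"
  unfolding skeleton_eq using closed_subset_nodes closed_Union_segments by auto

lemma skeleton_translate:
  assumes "z \<in> int_lattice"
  shows "x + z \<in> skeleton D \<longleftrightarrow> x \<in> skeleton D"
proof -
  have "x + z \<in> skeleton D" if x: "x \<in> skeleton D" and z: "z \<in> int_lattice" for x z
  proof (cases "x \<in> nodes")
    case False
    then obtain e where "e \<in> edges D" "x \<in> segment e" using x unfolding skeleton_eq by blast
    then show ?thesis using edge_translate[of e z] z segment_translate[of e z]
      unfolding skeleton_eq by blast
  qed (use node_translate x z in \<open>auto simp: skeleton_eq\<close>)
  from this[of x z] this[of "x + z" "- z"] show ?thesis using assms int_lattice_uminus by auto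
qed

text \<open>Provides generic points: every nonempty open set meets a tile, whatever the skeleton
  looks like nearby.\<close>

lemma negligible_skeleton: "negligible (skeleton D)"
proof -
  have "negligible (segment e)" for e
    unfolding segment_def by (simp add: negligible_convex_interior interior_closed_segment_ge2)
  then have "negligible (\<Union>(segment ` edges D))"
    using countable_edges by (intro negligible_countable_Union) auto
  moreover have "negligible (\<Union>((\<lambda>n. {n}) ` nodes))"
    using countable_nodes by (intro negligible_countable_Union) auto
  ultimately show ?thesis unfolding skeleton_eq by (simp add: negligible_Un)
qed

lemma nonskeleton_point:
  assumes "open U" "U \<noteq> {}" shows "\<exists>x\<in>U. x \<notin> skeleton D"
  using open_not_negligible[OF assms] negligible_subset[OF negligible_skeleton] by blast


subsection \<open>Tiles and their sides\<close>

definition tile_of :: "complex \<Rightarrow> complex set" where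
  "tile_of x = connected_component_set (- skeleton D) x"

lemma tile_of_mem: "x \<notin> skeleton D \<Longrightarrow> x \<in> tile_of x"
  by (simp add: tile_of_def connected_component_refl)

lemma tile_of_tile: "x \<notin> skeleton D \<Longrightarrow> tile_of x \<in> lifted_tiles D"
  by (auto simp: lifted_tiles_def tile_of_def intro: componentsI)

lemma tile_disjoint_skeleton: "C \<in> lifted_tiles D \<Longrightarrow> x \<in> C \<Longrightarrow> x \<notin> skeleton D"
  using in_components_subset unfolding lifted_tiles_def by blast

lemma tile_eq: "C \<in> lifted_tiles D \<Longrightarrow> x \<in> C \<Longrightarrow> C = tile_of x"
  unfolding lifted_tiles_def tile_of_def
  by (metis components_iff connected_component_eq)

lemma tile_nonempty: "C \<in> lifted_tiles D \<Longrightarrow> C \<noteq> {}"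
  unfolding lifted_tiles_def by (rule in_components_nonempty)

lemma tile_connected: "C \<in> lifted_tiles D \<Longrightarrow> connected C"
  unfolding lifted_tiles_def by (rule in_components_connected)

lemma tile_open: "C \<in> lifted_tiles D \<Longrightarrow> open C"
  unfolding lifted_tiles_def using closed_skeleton open_components open_Compl by blast

lemma tile_of_eq:
  assumes "connected S" "S \<inter> skeleton D = {}" "x \<in> S" "y \<in> S"
  shows "tile_of x = tile_of y"
proof -
  have "connected_component (- skeleton D) x y"
    unfolding connected_component_def using assms by (intro exI[of _ S]) auto
  then show ?thesis unfolding tile_of_def by (simp add: connected_component_eq)
qed

lemma tile_translate:
  assumes "C \<in> lifted_tiles D" "z \<in> int_lattice"
  shows "(\<lambda>x. x + z) ` C \<in> lifted_tiles D"
proof -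
  have sub: "(\<lambda>x. x + z) ` tile_of x \<subseteq> tile_of (x + z)" if "x \<notin> skeleton D" "z \<in> int_lattice" for x z
  proof
    fix y assume "y \<in> (\<lambda>x. x + z) ` tile_of x"
    moreover have "tile_of y' = tile_of (x + z)" if "y' \<in> (\<lambda>x. x + z) ` tile_of x" for y'
    proof (rule tile_of_eq)
      show "connected ((\<lambda>x. x + z) ` tile_of x)"
        using tile_connected[OF tile_of_tile[OF \<open>x \<notin> skeleton D\<close>]]
        by (intro connected_continuous_image continuous_intros)
      show "(\<lambda>x. x + z) ` tile_of x \<inter> skeleton D = {}"
        using tile_disjoint_skeleton[OF tile_of_tile[OF \<open>x \<notin> skeleton D\<close>]]
          skeleton_translate[OF \<open>z \<in> int_lattice\<close>] by blast
      show "x + z \<in> (\<lambda>x. x + z) ` tile_of x" using tile_of_mem[OF \<open>x \<notin> skeleton D\<close>] by blast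
    qed (rule that)
    ultimately have "tile_of y = tile_of (x + z)" "y \<notin> skeleton D"
      using tile_disjoint_skeleton[OF tile_of_tile[OF that(1)]] skeleton_translate[OF that(2)] by blast+
    then show "y \<in> tile_of (x + z)" using tile_of_mem by blast
  qed
  obtain x where x: "x \<in> C" using tile_nonempty assms(1) by blast
  then have C: "C = tile_of x" and xs: "x \<notin> skeleton D"
    using tile_eq[OF assms(1)] tile_disjoint_skeleton[OF assms(1)] by auto
  have xz: "x + z \<notin> skeleton D" using xs skeleton_translate[OF assms(2)] by simp
  \<comment> \<open>The reverse inclusion is \<open>sub\<close> for the translation by
    \<open>- z\<close>.\<close>
  have "tile_of (x + z) = (\<lambda>x. x + z) ` ((\<lambda>x. x + - z) ` tile_of (x + z))"
    by (simp add: image_image)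
  also have "\<dots> \<subseteq> (\<lambda>x. x + z) ` tile_of (x + z + - z)"
    using sub[OF xz int_lattice_uminus[OF assms(2)]] by (rule image_mono)
  finally have "(\<lambda>x. x + z) ` C = tile_of (x + z)"
    using sub[OF xs assms(2)] C by auto
  then show ?thesis using tile_of_tile[OF xz] by simp
qed

lemma tile_of_translate:
  assumes "x \<notin> skeleton D" "z \<in> int_lattice"
  shows "tile_of (x + z) = (\<lambda>x. x + z) ` tile_of x"
  using tile_eq[OF tile_translate[OF tile_of_tile[OF assms(1)] assms(2)], of "x + z"] tile_of_mem[OF assms(1)]
  by auto

definition adj :: "complex \<Rightarrow> complex \<Rightarrow> bool" where
  "adj p q \<longleftrightarrow> (p, q) \<in> edges D \<or> (q, p) \<in> edges D"

lemma adj_sym: "adj p q \<Longrightarrow> adj q p"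
  by (auto simp: adj_def)

lemma adj_neq: "adj p q \<Longrightarrow> p \<noteq> q"
  using edge_ends unfolding adj_def by fastforce

lemma adj_translate: "adj p q \<Longrightarrow> z \<in> int_lattice \<Longrightarrow> adj (p + z) (q + z)"
  using edge_translate unfolding adj_def by fastforce

lemma adj_edge: "adj p q \<Longrightarrow> \<exists>e\<in>edges D. segment e = closed_segment p q \<and>
    open_segment (fst e) (snd e) = open_segment p q \<and> (e = (p, q) \<or> e = (q, p))"
  unfolding adj_def segment_def by (metis closed_segment_commute open_segment_commute fst_conv snd_conv)

lemma Im_segment_eq_0: "y \<in> closed_segment p q \<Longrightarrow> Im ((y - p) / (q - p)) = 0"
proof -
  assume "y \<in> closed_segment p q"
  then obtain u where "y = (1 - u) *\<^sub>R p + u *\<^sub>R q" by (auto simp: in_segment)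
  then have "y - p = of_real u * (q - p)" by (simp add: scaleR_conv_of_real algebra_simps)
  then show ?thesis by (cases "p = q") auto
qed

text \<open>A compact part of an open edge has positive distance from the closed union of all nodes
  and all other edges.\<close>

lemma strip:
  assumes "adj p q" "x1 \<in> open_segment p q" "x2 \<in> open_segment p q"
  shows "\<exists>\<delta>>0. \<forall>x\<in>closed_segment x1 x2. \<forall>y. dist y x < \<delta> \<longrightarrow> y \<in> skeleton D \<longrightarrow> y \<in> closed_segment p q"
proof -
  obtain e where e: "e \<in> edges D" "segment e = closed_segment p q" "open_segment (fst e) (snd e) = open_segment p q"
    using adj_edge[OF assms(1)] by blast
  define T where "T = nodes \<union> (\<Union>e'\<in>edges D - {e}. segment e')"
  have "closed T" unfolding T_def using closed_subset_nodes closed_Union_segments by auto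
  have sub: "closed_segment x1 x2 \<subseteq> open_segment (fst e) (snd e)"
    unfolding e(3) by (rule closed_segment_subset[OF assms(2,3) convex_open_segment])
  have "closed_segment x1 x2 \<inter> T = {}"
  proof -
    have "x \<notin> T" if x: "x \<in> open_segment (fst e) (snd e)" for x
    proof -
      have "x \<notin> nodes" using segment_nodes[OF e(1)] x unfolding segment_def open_segment_def by auto
      moreover have "x \<notin> segment e'" if "e' \<in> edges D - {e}" for e'
        using edge_eq_of_common_point[OF e(1) _ x, of e'] that by blast
      ultimately show ?thesis by (auto simp: T_def)
    qed
    then show ?thesis using sub by blast
  qed
  then obtain \<delta> where d: "\<delta> > 0" "\<And>x y. x \<in> closed_segment x1 x2 \<Longrightarrow> y \<in> T \<Longrightarrow> \<delta> \<le> dist x y"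
    using separate_compact_closed[OF compact_segment(1) \<open>closed T\<close>, of x1 x2] by metis
  show ?thesis
  proof (intro exI[of _ \<delta>] conjI ballI allI impI)
    fix x y assume "x \<in> closed_segment x1 x2" "dist y x < \<delta>" "y \<in> skeleton D"
    then have "y \<notin> T" using d(2)[of x y] by (auto simp: dist_commute)
    then show "y \<in> closed_segment p q" using \<open>y \<in> skeleton D\<close> e unfolding T_def skeleton_eq by blast
  qed (rule d(1))
qed

text \<open>The tile to the left of the oriented segment from \<open>p\<close> to \<open>q\<close>.
  It does not refer to colours, so corners at white and at black nodes are treated alike; exchanging
  the arguments gives the right tile.\<close>

definition side :: "complex \<Rightarrow> complex \<Rightarrow> complex set" where
  "side p q = (THE C. C \<in> lifted_tiles D \<and>
     eventually (\<lambda>\<epsilon>. midpoint p q + of_real \<epsilon> * \<i> * (q - p) \<in> C) (at_right 0))"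

lemma left_tile_side: "left_tile D e = side (fst e) (snd e)"
  by (simp add: left_tile_def side_def)

lemma right_tile_side: "right_tile D e = side (snd e) (fst e)"
proof -
  have "midpoint b w + of_real \<epsilon> * \<i> * (w - b) = midpoint w b - of_real \<epsilon> * \<i> * (b - w)" for w b :: complex and \<epsilon> :: real
    by (simp add: midpoint_sym algebra_simps)
  then show ?thesis by (simp add: right_tile_def side_def)
qed

text \<open>The condition on \<open>Im\<close> says that \<open>y\<close> lies to the left of the
  line from \<open>p\<close> to \<open>q\<close>. A thin left neighbourhood \<open>H\<close> of the
  part of the edge between its midpoint and \<open>x\<close> is convex and avoids the skeleton,
  hence lies in one tile; thus the tile found at the midpoint is the same along the whole
  edge.\<close>

lemma side_properties:
  assumes "adj p q"
  shows "side p q \<in> lifted_tiles D"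
    and "x \<in> open_segment p q \<Longrightarrow> \<exists>\<delta>>0. \<forall>y. dist y x < \<delta> \<and> Im ((y - p) / (q - p)) > 0 \<longrightarrow> y \<in> side p q"
proof -
  define m where "m = midpoint p q"
  define pt where "pt \<epsilon> = m + of_real \<epsilon> * \<i> * (q - p)" for \<epsilon> :: real
  have pq: "p \<noteq> q" using adj_neq[OF assms] .
  have m: "m \<in> open_segment p q" using pq by (simp add: m_def)
  have Impt: "Im ((pt \<epsilon> - p) / (q - p)) = \<epsilon>" for \<epsilon>
  proof -
    have "pt \<epsilon> - p = (q - p) * Complex (1/2) \<epsilon>"
      by (auto simp: pt_def m_def midpoint_def complex_eq_iff field_simps)
    then show ?thesis using pq by simp
  qed
  have dpt: "dist (pt \<epsilon>) m = \<epsilon> * norm (q - p)" if "\<epsilon> > 0" for \<epsilon>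
    using that by (simp add: pt_def dist_norm norm_mult)
  have key: "\<exists>\<delta>>0. \<exists>C\<in>lifted_tiles D. \<forall>y. (dist y m < \<delta> \<or> dist y x < \<delta>) \<and> Im ((y - p) / (q - p)) > 0 \<longrightarrow> y \<in> C"
    if x: "x \<in> open_segment p q" for x
  proof -
    obtain \<delta> where d: "\<delta> > 0" "\<And>x' y. x' \<in> closed_segment m x \<Longrightarrow> dist y x' < \<delta> \<Longrightarrow> y \<in> skeleton D \<Longrightarrow> y \<in> closed_segment p q"
      using strip[OF assms m x] by blast
    define H where "H = {y. Im ((y - p) / (q - p)) > 0} \<inter> (\<Union>x\<in>closed_segment m x. \<Union>y\<in>ball 0 \<delta>. {x + y})"
    have conv: "convex H"
    proof -
      have "convex {y. Im ((y - p) / (q - p)) > 0}"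
      proof (rule convexI)
        fix x y :: complex and u v :: real
        assume xy: "x \<in> {y. Im ((y - p) / (q - p)) > 0}" "y \<in> {y. Im ((y - p) / (q - p)) > 0}" and uv: "u \<ge> 0" "v \<ge> 0" "u + v = 1"
        have "u *\<^sub>R x + v *\<^sub>R y - (u + v) *\<^sub>R p = u *\<^sub>R (x - p) + v *\<^sub>R (y - p)" by (simp add: algebra_simps)
        then have "(u *\<^sub>R x + v *\<^sub>R y - p) / (q - p) = u *\<^sub>R ((x - p) / (q - p)) + v *\<^sub>R ((y - p) / (q - p))"
          using uv(3) unfolding scaleR_conv_of_real by (simp add: add_divide_distrib)
        then have "Im ((u *\<^sub>R x + v *\<^sub>R y - p) / (q - p)) = u * Im ((x - p) / (q - p)) + v * Im ((y - p) / (q - p))"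
          by simp
        moreover have "u * Im ((x - p) / (q - p)) + v * Im ((y - p) / (q - p)) > 0"
          using xy uv by (cases "u = 0") (auto intro: add_pos_nonneg)
        ultimately show "u *\<^sub>R x + v *\<^sub>R y \<in> {y. Im ((y - p) / (q - p)) > 0}" by simp
      qed
      then show ?thesis unfolding H_def by (intro convex_Int convex_sums) auto
    qed
    have Hskel: "H \<inter> skeleton D = {}"
    proof -
      have "y \<notin> skeleton D" if y: "y \<in> H" for y
      proof
        assume sk: "y \<in> skeleton D"
        obtain x' v where "x' \<in> closed_segment m x" "v \<in> ball 0 \<delta>" "y = x' + v" using y unfolding H_def by blast
        then have "y \<in> closed_segment p q" using d(2)[of x' y] sk by (simp add: dist_norm)
        then show False using Im_segment_eq_0 y unfolding H_def by force
      qed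
      then show ?thesis by blast
    qed
    have inH: "y \<in> H" if "x' \<in> closed_segment m x" "dist y x' < \<delta>" "Im ((y - p) / (q - p)) > 0" for y x'
    proof -
      have "y = x' + (y - x')" "y - x' \<in> ball 0 \<delta>" using that(2) by (simp_all add: dist_norm norm_minus_commute)
      then show ?thesis unfolding H_def using that by blast
    qed
    define \<epsilon> where "\<epsilon> = \<delta> / (2 * norm (q - p))"
    have "\<epsilon> > 0" using d(1) pq by (simp add: \<epsilon>_def)
    moreover have "\<epsilon> * norm (q - p) < \<delta>" using d(1) pq by (simp add: \<epsilon>_def)
    ultimately have "pt \<epsilon> \<in> H" using inH[of m "pt \<epsilon>"] dpt Impt by simp
    have mem: "y \<in> tile_of (pt \<epsilon>)" if "y \<in> H" for y
    proof -
      have "tile_of y = tile_of (pt \<epsilon>)"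
        using tile_of_eq[OF convex_connected[OF conv] Hskel that \<open>pt \<epsilon> \<in> H\<close>] .
      moreover have "y \<notin> skeleton D" using Hskel that by blast
      ultimately show ?thesis using tile_of_mem by blast
    qed
    have "tile_of (pt \<epsilon>) \<in> lifted_tiles D" using Hskel \<open>pt \<epsilon> \<in> H\<close> by (intro tile_of_tile) auto
    then show ?thesis using d(1) mem inH by (meson ends_in_segment)
  qed
  have ev: "eventually (\<lambda>\<epsilon>. dist (pt \<epsilon>) m < \<delta> \<and> Im ((pt \<epsilon> - p) / (q - p)) > 0) (at_right 0)" if "\<delta> > 0" for \<delta>
  proof -
    have "\<delta> / norm (q - p) > 0" using that pq by simp
    then have "eventually (\<lambda>\<epsilon>. \<epsilon> \<in> {0<..<\<delta> / norm (q - p)}) (at_right (0::real))"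
      by (rule eventually_at_right_real)
    then show ?thesis
      by eventually_elim (use pq in \<open>auto simp: dpt Impt field_simps\<close>)
  qed
  have uniq: "C = C'" if "C \<in> lifted_tiles D" "C' \<in> lifted_tiles D"
    "eventually (\<lambda>\<epsilon>. pt \<epsilon> \<in> C) (at_right 0)" "eventually (\<lambda>\<epsilon>. pt \<epsilon> \<in> C') (at_right 0)" for C C'
  proof -
    have "\<exists>\<epsilon>. pt \<epsilon> \<in> C \<and> pt \<epsilon> \<in> C'"
      using eventually_happens'[OF _ eventually_conj[OF that(3,4)]] by (auto simp: trivial_limit_at_right_real)
    then show ?thesis using tile_eq that(1,2) by metis
  qed
  have side: "side p q = C" if C: "C \<in> lifted_tiles D" and d: "\<delta> > 0"
      "\<And>y. dist y m < \<delta> \<Longrightarrow> Im ((y - p) / (q - p)) > 0 \<Longrightarrow> y \<in> C" for C \<delta>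
  proof -
    have *: "eventually (\<lambda>\<epsilon>. pt \<epsilon> \<in> C) (at_right 0)" using ev[OF d(1)] by eventually_elim (use d(2) in auto)
    show ?thesis unfolding side_def
    proof (rule the_equality)
      show "C \<in> lifted_tiles D \<and> eventually (\<lambda>\<epsilon>. midpoint p q + of_real \<epsilon> * \<i> * (q - p) \<in> C) (at_right 0)"
        using C * by (simp add: pt_def m_def)
    qed (use uniq[OF _ C _ *] in \<open>auto simp: pt_def m_def\<close>)
  qed
  show "side p q \<in> lifted_tiles D" using key[OF m] side by metis
  show "\<exists>\<delta>>0. \<forall>y. dist y x < \<delta> \<and> Im ((y - p) / (q - p)) > 0 \<longrightarrow> y \<in> side p q" if x: "x \<in> open_segment p q"
  proof -
    obtain \<delta> C where C: "\<delta> > 0" "C \<in> lifted_tiles D"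
      "\<And>y. (dist y m < \<delta> \<or> dist y x < \<delta>) \<and> Im ((y - p) / (q - p)) > 0 \<Longrightarrow> y \<in> C"
      using key[OF x] by blast
    then have "side p q = C" using side by blast
    then show ?thesis using C by blast
  qed
qed

lemma side_eqI:
  assumes "adj p q" "C \<in> lifted_tiles D" "x \<in> open_segment p q"
    and "\<And>\<delta>. \<delta> > 0 \<Longrightarrow> \<exists>y\<in>C. dist y x < \<delta> \<and> Im ((y - p) / (q - p)) > 0"
  shows "side p q = C"
proof -
  obtain \<delta> where "\<delta> > 0" "\<And>y. dist y x < \<delta> \<and> Im ((y - p) / (q - p)) > 0 \<Longrightarrow> y \<in> side p q"
    using side_properties(2)[OF assms(1,3)] by blast
  then obtain y where "y \<in> C" "y \<in> side p q" using assms(4) by blast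
  then show ?thesis using tile_eq assms(2) side_properties(1)[OF assms(1)] by metis
qed

lemma side_translate:
  assumes "adj p q" "z \<in> int_lattice"
  shows "side (p + z) (q + z) = (\<lambda>x. x + z) ` side p q"
proof (rule side_eqI)
  let ?m = "midpoint p q"
  have m: "?m \<in> open_segment p q" using adj_neq[OF assms(1)] by simp
  show "?m + z \<in> open_segment (p + z) (q + z)"
    using m open_segment_translation_eq[of z ?m p q] by (simp add: add.commute)
  fix \<delta> :: real assume "\<delta> > 0"
  obtain \<delta>' where d: "\<delta>' > 0" "\<And>y. dist y ?m < \<delta>' \<and> Im ((y - p) / (q - p)) > 0 \<Longrightarrow> y \<in> side p q"
    using side_properties(2)[OF assms(1) m] by blast
  define \<epsilon> where "\<epsilon> = min \<delta> \<delta>' / (2 * norm (q - p))"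
  define y where "y = ?m + of_real \<epsilon> * \<i> * (q - p)"
  have pq: "q - p \<noteq> 0" using adj_neq[OF assms(1)] by simp
  have e: "\<epsilon> > 0" "\<epsilon> * norm (q - p) < \<delta>" "\<epsilon> * norm (q - p) < \<delta>'"
    using pq \<open>\<delta> > 0\<close> d(1) by (auto simp: \<epsilon>_def min_def)
  have "y - p = (q - p) * Complex (1/2) \<epsilon>"
    by (auto simp: y_def midpoint_def complex_eq_iff field_simps)
  then have Im: "Im ((y - p) / (q - p)) > 0" using pq e(1) by simp
  have dist: "dist y ?m = \<epsilon> * norm (q - p)" using e(1) by (simp add: y_def dist_norm norm_mult)
  then have "y \<in> side p q" using d(2) Im e(3) by simp
  then show "\<exists>y\<in>(\<lambda>x. x + z) ` side p q. dist y (?m + z) < \<delta> \<and> Im ((y - (p + z)) / (q + z - (p + z))) > 0"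
    using Im dist e(2) by (intro bexI[of _ "y + z"]) auto
qed (use assms adj_translate tile_translate side_properties(1) in auto)


subsection \<open>Tiles around a node\<close>

definition nbrs :: "complex \<Rightarrow> complex set" where
  "nbrs c = {x. adj c x}"

lemma nbrs_white: "c \<in> white D \<Longrightarrow> {b. (c, b) \<in> edges D} = nbrs c"
  and nbrs_black: "c \<in> black D \<Longrightarrow> {w. (w, c) \<in> edges D} = nbrs c"
  using edges_sub white_Int_black by (auto simp: nbrs_def adj_def)

lemma point_in_closed_segment:
  fixes c y :: complex
  assumes "0 \<le> t" "t \<le> 1"
  shows "c + of_real t * (y - c) \<in> closed_segment c y"
  unfolding in_segment using assms
  by (intro exI[of _ t]) (auto simp: scaleR_conv_of_real algebra_simps)

lemma point_in_open_segment:
  fixes c y :: complex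
  assumes "0 < t" "t < 1" "c \<noteq> y"
  shows "c + of_real t * (y - c) \<in> open_segment c y"
  unfolding in_segment using assms
  by (auto intro!: exI[of _ t] simp: scaleR_conv_of_real algebra_simps)

lemma finite_nbrs: "finite (nbrs c)"
proof -
  have "nbrs c \<subseteq> fst ` edges_at D c \<union> snd ` edges_at D c"
    unfolding nbrs_def adj_def edges_at_def by force
  then show ?thesis using finite_edges_at finite_subset by blast
qed

lemma not_nbrs_self: "c \<notin> nbrs c"
  using adj_neq by (auto simp: nbrs_def)

text \<open>Two edges leaving \<open>c\<close> in the same direction would overlap near
  \<open>c\<close> in inner points, which makes them equal.\<close>

lemma nbrs_direction:
  assumes "x \<in> nbrs c" "y \<in> nbrs c" "Arg2pi ((y - c) / (x - c)) = 0"
  shows "x = y"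
proof -
  have nz: "x - c \<noteq> 0" "y - c \<noteq> 0" using assms(1,2) not_nbrs_self by auto
  define r where "r = Re ((y - c) / (x - c))"
  have "(y - c) / (x - c) = of_real r" "r \<ge> 0"
    using assms(3) unfolding Arg2pi_eq_0 r_def by auto
  then have r: "y - c = of_real r * (x - c)" "r > 0"
    using nz by (auto simp: field_simps order_le_less)
  \<comment> \<open>The bounds \<open>t < 1\<close> and \<open>t < r\<close> make \<open>p\<close>
    an inner point of the first edge and a point of the second.\<close>
  define t where "t = min 1 r / 2"
  have t: "0 < t" "t < 1" "t < r" using r(2) by (auto simp: t_def min_def)
  define p where "p = c + of_real t * (x - c)"
  have p1: "p \<in> open_segment c x"
    unfolding p_def using nz t by (intro point_in_open_segment) auto
  have "p = c + of_real (t / r) * (y - c)" using r by (simp add: p_def)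
  then have p2: "p \<in> closed_segment c y"
    using t r by (metis point_in_closed_segment divide_le_eq_1_pos divide_nonneg_pos less_imp_le)
  obtain e where e: "e \<in> edges D" "open_segment (fst e) (snd e) = open_segment c x" "e = (c, x) \<or> e = (x, c)"
    using adj_edge assms(1) unfolding nbrs_def by blast
  obtain e' where e': "e' \<in> edges D" "segment e' = closed_segment c y" "e' = (c, y) \<or> e' = (y, c)"
    using adj_edge assms(2) unfolding nbrs_def by blast
  have "e = e'" using edge_eq_of_common_point[OF e(1) e'(1)] p1 p2 e(2) e'(2) by auto
  then show ?thesis using e(3) e'(3) nz by auto
qed

lemma node_ball:
  assumes "c \<in> nodes"
  shows "\<exists>\<rho>>0. \<forall>y. dist y c < \<rho> \<longrightarrow> y \<in> skeleton D \<longrightarrow> y = c \<or> (\<exists>z\<in>nbrs c. y \<in> closed_segment c z)"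
proof -
  define T where "T = (nodes - {c}) \<union> (\<Union>e\<in>edges D - edges_at D c. segment e)"
  have "closed T" unfolding T_def using closed_subset_nodes closed_Union_segments by auto
  moreover have "c \<notin> T"
  proof -
    have "c \<notin> segment e" if "e \<in> edges D - edges_at D c" for e
    proof
      assume "c \<in> segment e"
      then have "c \<in> {fst e, snd e}" using segment_nodes[of e] assms that by blast
      then show False using that by (auto simp: edges_at_def)
    qed
    then show ?thesis by (auto simp: T_def)
  qed
  ultimately obtain \<rho> where r: "\<rho> > 0" "\<And>y. dist y c < \<rho> \<Longrightarrow> y \<notin> T"
    using open_dist[of "- T"] open_Compl[of T] by auto
  have "y = c \<or> (\<exists>z\<in>nbrs c. y \<in> closed_segment c z)" if y: "y \<in> skeleton D" "dist y c < \<rho>" for y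
  proof (cases "y = c")
    case False
    then obtain e where e: "e \<in> edges_at D c" "y \<in> segment e"
      using y(1) r(2)[OF y(2)] unfolding T_def skeleton_eq by blast
    then have "\<exists>z. adj c z \<and> segment e = closed_segment c z"
      unfolding edges_at_def adj_def segment_def by (cases e) (auto simp: closed_segment_commute)
    then show ?thesis using e(2) unfolding nbrs_def by blast
  qed auto
  then show ?thesis using r(1) by blast
qed

text \<open>The open circular sector between two consecutive edges is the image of a rectangle in
  polar coordinates, hence connected, and for small radius it avoids the skeleton. Its tile is the
  left side of the first edge and the right side of the second. The angle is given by
  \<open>cis \<alpha>\<close> and not by \<open>Arg2pi\<close> so that \<open>y = x\<close> with a
  full turn is allowed, as happens at a node with a single edge.\<close>

lemma corner:
  assumes c: "c \<in> nodes" and x: "x \<in> nbrs c" and y: "y \<in> nbrs c" and \<alpha>: "0 < \<alpha>" "\<alpha> \<le> 2 * pi"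
    and dir: "(y - c) / (x - c) = of_real r * cis \<alpha>" "r > 0"
    and empty: "\<And>z. z \<in> nbrs c \<Longrightarrow> Arg2pi ((z - c) / (x - c)) \<notin> {0<..<\<alpha>}"
  shows "side c x = side y c"
proof -
  obtain \<rho> where rho: "\<rho> > 0" "\<And>y. dist y c < \<rho> \<Longrightarrow> y \<in> skeleton D \<Longrightarrow> y = c \<or> (\<exists>z\<in>nbrs c. y \<in> closed_segment c z)"
    using node_ball[OF c] by blast
  define L where "L = norm (x - c)"
  define M where "M = norm (y - c)"
  define u where "u = (x - c) / of_real L"
  have nz: "x - c \<noteq> 0" "y - c \<noteq> 0" using x y not_nbrs_self by auto
  have LM: "L > 0" "M > 0" using nz by (auto simp: L_def M_def)
  have u: "norm u = 1" "u \<noteq> 0" "x - c = of_real L * u" using nz by (auto simp: u_def L_def norm_divide)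
  have M: "M = r * L"
  proof -
    have "y - c = of_real r * cis \<alpha> * (x - c)" using dir(1) nz by (simp add: field_simps)
    then show ?thesis using dir(2) unfolding M_def L_def by (simp add: norm_mult)
  qed
  have yc: "y - c = of_real M * u * cis \<alpha>"
    using dir(1) nz unfolding M by (simp add: field_simps u(3))
  define f where "f = (\<lambda>(s, \<phi>). c + of_real s * u * cis \<phi>)"
  define S where "S = f ` ({0<..<\<rho>} \<times> {0<..<\<alpha>})"
  have "connected S"
    unfolding S_def f_def cis_conv_exp case_prod_beta
    by (intro connected_continuous_image connected_Times continuous_intros) auto
  have "f (s, \<phi>) \<notin> skeleton D" if s: "0 < s" "s < \<rho>" and p: "0 < \<phi>" "\<phi> < \<alpha>" for s \<phi>
  proof
    assume sk: "f (s, \<phi>) \<in> skeleton D"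
    have "dist (f (s, \<phi>)) c < \<rho>" using s u by (simp add: f_def dist_norm norm_mult)
    moreover have "f (s, \<phi>) \<noteq> c" using s u by (simp add: f_def)
    ultimately obtain z where z: "z \<in> nbrs c" "f (s, \<phi>) \<in> closed_segment c z" using rho(2) sk by blast
    then obtain t where t: "0 \<le> t" "f (s, \<phi>) = (1 - t) *\<^sub>R c + t *\<^sub>R z" unfolding in_segment by auto
    then have tz: "of_real s * u * cis \<phi> = of_real t * (z - c)"
      by (simp add: f_def scaleR_conv_of_real algebra_simps)
    then have "t > 0" using s u t(1) by (cases "t = 0") auto
    then have "z - c = of_real (s / t) * u * cis \<phi>" using tz by (simp add: field_simps)
    then have "(z - c) / (x - c) = of_real (s / t / L) * exp (\<i> * of_real \<phi>)"
      using u LM by (simp add: field_simps cis_conv_exp)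
    then have "Arg2pi ((z - c) / (x - c)) = \<phi>"
      by (intro Arg2pi_unique[of "s / t / L"]) (use s p \<alpha> \<open>t > 0\<close> LM in auto)
    then show False using empty[OF z(1)] p by auto
  qed
  then have Ssk: "S \<inter> skeleton D = {}" by (auto simp: S_def)
  \<comment> \<open>Small enough for the sector to be clear, and for the points at radius
    \<open>s\<close> on the two bounding rays to be inner points of the edges.\<close>
  define s where "s = Min {\<rho>, L, M} / 2"
  have s: "0 < s" "s < \<rho>" "s < L" "s < M" using rho(1) LM by (auto simp: s_def min_def)
  define C where "C = tile_of (f (s, \<alpha> / 2))"
  have mid: "f (s, \<alpha> / 2) \<in> S" using s \<alpha> by (auto simp: S_def)
  have C: "C \<in> lifted_tiles D" unfolding C_def using mid Ssk by (intro tile_of_tile) auto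
  have SC: "v \<in> C" if "v \<in> S" for v
    using tile_of_eq[OF \<open>connected S\<close> Ssk that mid] tile_of_mem[of v] that Ssk unfolding C_def by auto
  \<comment> \<open>Points of the sector at angle \<open>\<phi>\<close> from a bounding ray
    approximate its point at radius \<open>s\<close>, and \<open>\<phi> < pi\<close> keeps them on
    the correct side of that edge.\<close>
  have small: "\<exists>\<phi>. 0 < \<phi> \<and> \<phi> < \<alpha> \<and> \<phi> < pi \<and> s * norm (cis \<phi> - 1) < \<delta> \<and> s * norm (cis (- \<phi>) - 1) < \<delta>" if "\<delta> > 0" for \<delta>
  proof -
    have "((\<lambda>\<phi>. s * norm (cis \<phi> - 1)) \<longlongrightarrow> s * norm (cis 0 - 1)) (at_right (0::real))"
      and "((\<lambda>\<phi>. s * norm (cis (- \<phi>) - 1)) \<longlongrightarrow> s * norm (cis (- 0) - 1)) (at_right (0::real))"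
      unfolding cis_conv_exp by (intro tendsto_intros tendsto_exp)+
    then have "eventually (\<lambda>\<phi>. s * norm (cis \<phi> - 1) < \<delta>) (at_right 0)"
      "eventually (\<lambda>\<phi>. s * norm (cis (- \<phi>) - 1) < \<delta>) (at_right 0)"
      using that by (auto intro: order_tendstoD(2))
    moreover have "eventually (\<lambda>\<phi>. \<phi> \<in> {0<..<min \<alpha> pi}) (at_right (0::real))"
      using \<alpha> by (intro eventually_at_right_real) auto
    ultimately have "eventually (\<lambda>\<phi>. 0 < \<phi> \<and> \<phi> < \<alpha> \<and> \<phi> < pi \<and> s * norm (cis \<phi> - 1) < \<delta> \<and> s * norm (cis (- \<phi>) - 1) < \<delta>) (at_right 0)"
      by eventually_elim auto
    then show ?thesis using eventually_happens'[of "at_right (0::real)"] by (auto simp: trivial_limit_at_right_real)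
  qed
  have "side c x = C"
  proof (rule side_eqI[where x = "f (s, 0)"])
    show "f (s, 0) \<in> open_segment c x"
    proof -
      have "f (s, 0) = c + of_real (s / L) * (x - c)" using LM by (simp add: f_def u_def)
      then show ?thesis using point_in_open_segment[of "s / L" c x] nz s LM by simp
    qed
    fix \<delta> :: real assume "\<delta> > 0"
    then obtain \<phi> where p: "0 < \<phi>" "\<phi> < \<alpha>" "\<phi> < pi" "s * norm (cis \<phi> - 1) < \<delta>" using small by blast
    have "f (s, \<phi>) \<in> C" using s p by (intro SC) (auto simp: S_def)
    moreover have "f (s, \<phi>) - f (s, 0) = of_real s * u * (cis \<phi> - 1)" by (simp add: f_def algebra_simps)
    then have "dist (f (s, \<phi>)) (f (s, 0)) < \<delta>" using p(4) s u by (simp add: dist_norm norm_mult)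
    moreover have "(f (s, \<phi>) - c) / (x - c) = of_real (s / L) * cis \<phi>" using u LM by (simp add: f_def field_simps)
    then have "Im ((f (s, \<phi>) - c) / (x - c)) > 0" using s LM p sin_gt_zero[of \<phi>] by simp
    ultimately show "\<exists>v\<in>C. dist v (f (s, 0)) < \<delta> \<and> Im ((v - c) / (x - c)) > 0" by blast
  qed (use C x in \<open>auto simp: nbrs_def\<close>)
  moreover have "side y c = C"
  proof (rule side_eqI[where x = "f (s, \<alpha>)"])
    have "f (s, \<alpha>) = c + of_real (s / M) * (y - c)" unfolding yc using LM by (simp add: f_def)
    then have "f (s, \<alpha>) \<in> open_segment c y"
      using point_in_open_segment[of "s / M" c y] nz s LM by simp
    then show "f (s, \<alpha>) \<in> open_segment y c" by (simp add: open_segment_commute)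
    fix \<delta> :: real assume "\<delta> > 0"
    then obtain \<phi> where p: "0 < \<phi>" "\<phi> < \<alpha>" "\<phi> < pi" "s * norm (cis (- \<phi>) - 1) < \<delta>" using small by blast
    have f: "f (s, \<alpha> - \<phi>) = c + of_real s * u * cis \<alpha> * cis (- \<phi>)"
      by (simp add: f_def mult.assoc cis_mult)
    have "f (s, \<alpha> - \<phi>) \<in> C" using s p by (intro SC) (auto simp: S_def)
    moreover have "f (s, \<alpha> - \<phi>) - f (s, \<alpha>) = of_real s * u * cis \<alpha> * (cis (- \<phi>) - 1)"
      unfolding f by (simp add: f_def algebra_simps)
    then have "dist (f (s, \<alpha> - \<phi>)) (f (s, \<alpha>)) < \<delta>" using p(4) s u by (simp add: dist_norm norm_mult)
    moreover have "(f (s, \<alpha> - \<phi>) - y) / (c - y) = of_real 1 - of_real (s / M) * cis (- \<phi>)"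
    proof -
      define w where "w = u * cis \<alpha>"
      have w: "w \<noteq> 0" using u by (simp add: w_def)
      have "y = c + w * of_real M" using yc by (simp add: w_def algebra_simps)
      then have "f (s, \<alpha> - \<phi>) - y = w * (of_real s * cis (- \<phi>) - of_real M)" "c - y = w * (- of_real M)"
        unfolding f by (simp_all add: w_def algebra_simps)
      then have "(f (s, \<alpha> - \<phi>) - y) / (c - y) = (of_real s * cis (- \<phi>) - of_real M) / (- of_real M)"
        using w by simp
      then show ?thesis using LM by (simp add: field_simps)
    qed
    then have "Im ((f (s, \<alpha> - \<phi>) - y) / (c - y)) > 0" using s LM p sin_gt_zero[of \<phi>] by simp
    ultimately show "\<exists>v\<in>C. dist v (f (s, \<alpha>)) < \<delta> \<and> Im ((v - y) / (c - y)) > 0" by blast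
  qed (use C y adj_sym in \<open>auto simp: nbrs_def\<close>)
  ultimately show ?thesis by simp
qed

lemma corner_single:
  assumes "c \<in> nodes" "nbrs c = {x}"
  shows "side c x = side x c"
proof (rule corner[where \<alpha> = "2 * pi" and r = 1])
  show "(x - c) / (x - c) = of_real 1 * cis (2 * pi)"
    using assms(2) not_nbrs_self[of c] by auto
  fix z assume "z \<in> nbrs c"
  then show "Arg2pi ((z - c) / (x - c)) \<notin> {0<..<2 * pi}"
    using assms(2) not_nbrs_self[of c] Arg2pi_real[of 1] by auto
qed (use assms in auto)

lemma cyclic_ccw: "cyclic_order (nbrs c) (\<lambda>x y. Arg2pi ((y - c) / (x - c))) (next_ccw (nbrs c) c) (2 * pi)"
  and cyclic_cw: "cyclic_order (nbrs c) (\<lambda>x y. Arg2pi ((x - c) / (y - c))) (next_cw (nbrs c) c) (2 * pi)"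
  using cyclic_order_ccw[OF finite_nbrs not_nbrs_self nbrs_direction]
    cyclic_order_cw[OF finite_nbrs not_nbrs_self nbrs_direction] by auto

lemma corner_Arg2pi:
  assumes "c \<in> nodes" "x \<in> nbrs c" "y \<in> nbrs c" "x \<noteq> y"
    and "\<And>z. z \<in> nbrs c \<Longrightarrow> Arg2pi ((z - c) / (x - c)) \<notin> {0<..<Arg2pi ((y - c) / (x - c))}"
  shows "side c x = side y c"
proof (rule corner[OF assms(1-3) _ _ _ _ assms(5)])
  let ?u = "(y - c) / (x - c)"
  show "Arg2pi ?u \<le> 2 * pi" using Arg2pi[of ?u] by auto
  show "0 < Arg2pi ?u" using Arg2pi[of ?u] nbrs_direction[OF assms(2,3)] assms(4) by (auto simp: order_le_less)
  show "?u = of_real (norm ?u) * cis (Arg2pi ?u)" using Arg2pi_eq[of ?u] by (simp add: cis_conv_exp)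
  show "norm ?u > 0" using assms(2,3) not_nbrs_self by auto
qed

lemma corner_ccw:
  assumes "c \<in> nodes" "x \<in> nbrs c" "nbrs c \<noteq> {x}"
  shows "side c x = side (next_ccw (nbrs c) c x) c"
proof -
  interpret cyclic_order "nbrs c" "\<lambda>x y. Arg2pi ((y - c) / (x - c))" "next_ccw (nbrs c) c" "2 * pi"
    by (rule cyclic_ccw)
  define y where "y = next_ccw (nbrs c) c x"
  have y: "y \<in> nbrs c" "y \<noteq> x" using nxt_in[OF assms(2,3)] by (auto simp: y_def)
  have "side c x = side y c"
  proof (rule corner_Arg2pi[OF assms(1,2) y(1) y(2)[symmetric]])
    fix z assume "z \<in> nbrs c"
    then show "Arg2pi ((z - c) / (x - c)) \<notin> {0<..<Arg2pi ((y - c) / (x - c))}"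
      using nxt_least[OF assms(2), of z] D_eq0[OF assms(2), of z] unfolding y_def by (cases "z = x") auto
  qed
  then show ?thesis by (simp add: y_def)
qed

text \<open>\<open>next_cw\<close> minimises the angle from \<open>y\<close> to \<open>x\<close>
  over \<open>y\<close>, while \<open>corner_Arg2pi\<close> measures angles from \<open>y\<close>. A
  neighbour inside the sector from \<open>y\<close> to \<open>x\<close> would be closer to
  \<open>x\<close> than the minimiser.\<close>

lemma corner_cw:
  assumes "c \<in> nodes" "x \<in> nbrs c" "nbrs c \<noteq> {x}"
  shows "side c (next_cw (nbrs c) c x) = side x c"
proof -
  interpret cyclic_order "nbrs c" "\<lambda>x y. Arg2pi ((x - c) / (y - c))" "next_cw (nbrs c) c" "2 * pi"
    by (rule cyclic_cw)
  define y where "y = next_cw (nbrs c) c x"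
  have y: "y \<in> nbrs c" "y \<noteq> x" using nxt_in[OF assms(2,3)] by (auto simp: y_def)
  have "side c y = side x c"
  proof (rule corner_Arg2pi[OF assms(1) y(1) assms(2) y(2)])
    fix z assume z: "z \<in> nbrs c"
    show "Arg2pi ((z - c) / (y - c)) \<notin> {0<..<Arg2pi ((x - c) / (y - c))}"
    proof
      assume *: "Arg2pi ((z - c) / (y - c)) \<in> {0<..<Arg2pi ((x - c) / (y - c))}"
      have "z \<noteq> x" using * by auto
      have "Arg2pi ((x - c) / (z - c)) = Arg2pi ((x - c) / (y - c)) - Arg2pi ((z - c) / (y - c))"
      proof -
        have "z \<noteq> c" "y \<noteq> c" "x \<noteq> c" using y(1) z assms(2) not_nbrs_self by auto
        then show ?thesis using Arg2pi_divide[of "(z - c) / (y - c)" "(x - c) / (y - c)"] * by simp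
      qed
      then show False using nxt_least[OF assms(2), of z] z \<open>z \<noteq> x\<close> * unfolding y_def[symmetric] by auto
    qed
  qed
  then show ?thesis by (simp add: y_def)
qed


subsection \<open>The dual quiver\<close>

abbreviation Q :: "(torus_tile, torus_edge) pre_digraph" where
  "Q \<equiv> dual_quiver D"

lemma edge_adj: "e \<in> edges D \<Longrightarrow> adj (fst e) (snd e)" "e \<in> edges D \<Longrightarrow> adj (snd e) (fst e)"
  by (auto simp: adj_def)

lemma torus_proj_image_translate:
  "z \<in> int_lattice \<Longrightarrow> torus_proj ` (\<lambda>x. x + z) ` C = torus_proj ` C"
  by (simp add: image_image torus_proj_add_lattice)

text \<open>The definite description ranges over all lifts of the arrow. These are lattice
  translates of each other, and translated tiles have the same image in the torus.\<close>

lemma tail_edge: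
  assumes "e \<in> edges D"
  shows "tail Q (edge_proj e) = torus_proj ` side (fst e) (snd e)"
proof -
  have *: "torus_proj ` side (fst e') (snd e') = torus_proj ` side (fst e) (snd e)"
    if e': "e' \<in> edges D" "edge_proj e = edge_proj e'" for e'
  proof -
    obtain z where z: "z \<in> int_lattice" "e' = (fst e + z, snd e + z)"
      using edge_proj_eq_iff[OF assms e'(1)] e'(2) by blast
    show ?thesis unfolding z(2) fst_conv snd_conv side_translate[OF edge_adj(1)[OF assms] z(1)]
      by (rule torus_proj_image_translate[OF z(1)])
  qed
  have "tail Q (edge_proj e) = (THE i. \<exists>e'\<in>edges D. edge_proj e = edge_proj e' \<and> i = torus_proj ` left_tile D e')"
    by (simp add: dual_quiver_def)
  also have "\<dots> = torus_proj ` side (fst e) (snd e)"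
    unfolding left_tile_side by (rule the_equality) (use assms * in blast)+
  finally show ?thesis .
qed

lemma head_edge:
  assumes "e \<in> edges D"
  shows "head Q (edge_proj e) = torus_proj ` side (snd e) (fst e)"
proof -
  have *: "torus_proj ` side (snd e') (fst e') = torus_proj ` side (snd e) (fst e)"
    if e': "e' \<in> edges D" "edge_proj e = edge_proj e'" for e'
  proof -
    obtain z where z: "z \<in> int_lattice" "e' = (fst e + z, snd e + z)"
      using edge_proj_eq_iff[OF assms e'(1)] e'(2) by blast
    show ?thesis unfolding z(2) fst_conv snd_conv side_translate[OF edge_adj(2)[OF assms] z(1)]
      by (rule torus_proj_image_translate[OF z(1)])
  qed
  have "head Q (edge_proj e) = (THE i. \<exists>e'\<in>edges D. edge_proj e = edge_proj e' \<and> i = torus_proj ` right_tile D e')"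
    by (simp add: dual_quiver_def)
  also have "\<dots> = torus_proj ` side (snd e) (fst e)"
    unfolding right_tile_side by (rule the_equality) (use assms * in blast)+
  finally show ?thesis .
qed

lemma verts_Q: "verts Q = (\<lambda>C. torus_proj ` C) ` lifted_tiles D"
  and arcs_Q: "arcs Q = edge_proj ` edges D"
  by (simp_all add: dual_quiver_def)

lemma finite_arcs: "finite (arcs Q)"
  using finite_torus_edges by (simp add: arcs_Q)

lemma head_in_verts: "a \<in> arcs Q \<Longrightarrow> head Q a \<in> verts Q"
  and tail_in_verts: "a \<in> arcs Q \<Longrightarrow> tail Q a \<in> verts Q"
  unfolding arcs_Q verts_Q using head_edge tail_edge side_properties(1) edge_adj by auto

section \<open>Sides of tiles and finiteness of the quiver\<close>

lemma frontier_tile: "C \<in> lifted_tiles D \<Longrightarrow> frontier C \<subseteq> skeleton D"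
proof
  fix x assume C: "C \<in> lifted_tiles D" and x: "x \<in> frontier C"
  show "x \<in> skeleton D"
  proof (rule ccontr)
    assume s: "x \<notin> skeleton D"
    have "tile_of x \<inter> C \<noteq> {}"
      using x tile_of_mem[OF s] open_Int_closure_eq_empty[OF tile_open[OF tile_of_tile[OF s]], of C]
      unfolding frontier_def by blast
    then have "tile_of x = C" using tile_eq[OF C] tile_eq[OF tile_of_tile[OF s]] by blast
    then show False using x tile_of_mem[OF s] tile_open[OF C] by (auto simp: frontier_def interior_open)
  qed
qed

text \<open>A bounded set of nodes is finite and does not disconnect the plane, whereas the frontier
  of a bounded open set separates it from the points far away.\<close>

lemma frontier_tile_not_nodes:
  assumes "C \<in> lifted_tiles D"
  shows "\<not> frontier C \<subseteq> nodes"
proof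
  assume sub: "frontier C \<subseteq> nodes"
  have bd: "bounded (frontier C)"
    by (rule compact_imp_bounded[OF compact_frontier_bounded[OF tile_bounded[OF assms]]])
  then have fin: "finite (frontier C)" using finite_nodes_Int[OF bd] sub by (simp add: Int_absorb1)
  have "connected (- frontier C)"
    using fin connected_open_diff_countable[of UNIV "frontier C"]
    by (simp add: Compl_eq_Diff_UNIV countable_finite connected_UNIV)
  moreover have "- frontier C \<inter> C \<noteq> {}" using tile_open[OF assms] tile_nonempty[OF assms]
    by (auto simp: frontier_def interior_open)
  moreover have "- frontier C - C \<noteq> {}"
  proof
    assume "- frontier C - C = {}"
    then have "C \<union> frontier C = (UNIV :: complex set)" by auto
    moreover have "bounded (C \<union> frontier C)" using tile_bounded[OF assms] bd by simp
    ultimately show False using not_bounded_UNIV[where 'a = complex] by simp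
  qed
  ultimately have "- frontier C \<inter> frontier C \<noteq> {}" by (rule connected_Int_frontier)
  then show False by simp
qed

lemma Im_side_flip:
  fixes p q y :: complex
  assumes "p \<noteq> q" shows "Im ((y - q) / (p - q)) = - Im ((y - p) / (q - p))"
proof -
  have "(y - q) / (p - q) = 1 - (y - p) / (q - p)" using assms by (simp add: field_simps)
  then show ?thesis by simp
qed

text \<open>A frontier point that is no node is an inner point of an edge. Near it, the points off
  the line through the edge belong to the two sides of the edge, and \<open>C\<close> contains such
  a point.\<close>

lemma tile_is_side:
  assumes C: "C \<in> lifted_tiles D"
  shows "\<exists>p q. adj p q \<and> C = side p q"
proof -
  obtain x where x: "x \<in> frontier C" "x \<notin> nodes" using frontier_tile_not_nodes[OF C] by blast
  then obtain e where e: "e \<in> edges D" "x \<in> segment e" using frontier_tile[OF C] unfolding skeleton_eq by blast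
  define p q where "p = fst e" and "q = snd e"
  have adj: "adj p q" "adj q p" using edge_adj e(1) by (auto simp: p_def q_def)
  have xs: "x \<in> open_segment p q" "x \<in> open_segment q p"
    using e x(2) edge_ends[OF e(1)] unfolding segment_def open_segment_def p_def q_def
    by (auto simp: closed_segment_commute)
  have pq: "p \<noteq> q" using adj_neq[OF adj(1)] .
  obtain \<delta> where d: "\<delta> > 0" "\<And>y. dist y x < \<delta> \<and> Im ((y - p) / (q - p)) > 0 \<Longrightarrow> y \<in> side p q"
    using side_properties(2)[OF adj(1) xs(1)] by blast
  obtain \<delta>' where d': "\<delta>' > 0" "\<And>y. dist y x < \<delta>' \<and> Im ((y - q) / (p - q)) > 0 \<Longrightarrow> y \<in> side q p"
    using side_properties(2)[OF adj(2) xs(2)] by blast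
  define U where "U = C \<inter> ball x (min \<delta> \<delta>')"
  have "open U" using tile_open[OF C] by (auto simp: U_def)
  have "U \<noteq> {}"
  proof -
    have "x \<in> closure C" using x(1) by (simp add: frontier_def)
    then show ?thesis using d(1) d'(1) unfolding U_def closure_iff_nhds_not_empty
      by (metis Int_commute centre_in_ball min_less_iff_conj open_ball order_refl)
  qed
  \<comment> \<open>An open set is not contained in the line through \<open>p\<close> and
    \<open>q\<close>: a small perpendicular shift leaves the line.\<close>
  have "\<exists>y\<in>U. Im ((y - p) / (q - p)) \<noteq> 0"
  proof -
    obtain y where y: "y \<in> U" using \<open>U \<noteq> {}\<close> by blast
    obtain r where r: "r > 0" "ball y r \<subseteq> U" using \<open>open U\<close> y open_contains_ball by blast
    define \<epsilon> where "\<epsilon> = r / (2 * norm (q - p))"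
    define y' where "y' = y + of_real \<epsilon> * \<i> * (q - p)"
    have eps: "\<epsilon> > 0" using r(1) pq by (simp add: \<epsilon>_def)
    have "dist y y' = \<epsilon> * norm (q - p)" using eps by (simp add: y'_def dist_norm norm_mult)
    then have "y' \<in> U" using r pq by (auto simp: \<epsilon>_def)
    moreover have "(y' - p) / (q - p) = (y - p) / (q - p) + of_real \<epsilon> * \<i>"
      using pq by (simp add: y'_def field_simps)
    then have "Im ((y' - p) / (q - p)) = Im ((y - p) / (q - p)) + \<epsilon>" by simp
    then have "Im ((y' - p) / (q - p)) \<noteq> 0 \<or> Im ((y - p) / (q - p)) \<noteq> 0" using eps by auto
    ultimately show ?thesis using y by blast
  qed
  then obtain y where y: "y \<in> C" "dist y x < \<delta>" "dist y x < \<delta>'" "Im ((y - p) / (q - p)) \<noteq> 0"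
    by (auto simp: U_def dist_commute)
  then have "y \<in> side p q \<or> y \<in> side q p"
    using d(2)[of y] d'(2)[of y] Im_side_flip[OF pq, of y] by (cases "Im ((y - p) / (q - p)) > 0") auto
  then show ?thesis using tile_eq[OF C y(1)] tile_eq[OF side_properties(1)] adj by metis
qed

lemma verts_are_ends: "verts Q \<subseteq> head Q ` arcs Q \<union> tail Q ` arcs Q"
proof
  fix i assume "i \<in> verts Q"
  then obtain C where C: "C \<in> lifted_tiles D" "i = torus_proj ` C" by (auto simp: verts_Q)
  then obtain p q where pq: "adj p q" "C = side p q" using tile_is_side by blast
  then consider "(p, q) \<in> edges D" | "(q, p) \<in> edges D" unfolding adj_def by blast
  then show "i \<in> head Q ` arcs Q \<union> tail Q ` arcs Q"
  proof cases
    case 1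
    then have "i = tail Q (edge_proj (p, q))" using tail_edge[OF 1] C(2) pq(2) by simp
    then show ?thesis using 1 unfolding arcs_Q by blast
  next
    case 2
    then have "i = head Q (edge_proj (q, p))" using head_edge[OF 2] C(2) pq(2) by simp
    then show ?thesis using 2 unfolding arcs_Q by blast
  qed
qed

lemma finite_verts: "finite (verts Q)"
  using verts_are_ends finite_arcs finite_subset by (metis finite_UnI finite_imageI)

subsection \<open>Cycles around nodes\<close>

text \<open>The total weight of the cycle around \<open>n\<close>. In these terms the relation for
  an edge says that the sums at its two ends agree.\<close>

definition nsum :: "(torus_edge \<Rightarrow> 'b::comm_monoid_add) \<Rightarrow> complex \<Rightarrow> 'b" where
  "nsum f n = (\<Sum>e\<in>edges_at D n. f (edge_proj e))"

lemma edges_at_white: "w \<in> white D \<Longrightarrow> edges_at D w = Pair w ` nbrs w"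
  using edges_sub white_Int_black by (force simp: edges_at_def nbrs_def adj_def)

lemma edges_at_black: "b \<in> black D \<Longrightarrow> edges_at D b = (\<lambda>w. (w, b)) ` nbrs b"
  using edges_sub white_Int_black by (force simp: edges_at_def nbrs_def adj_def)

text \<open>No arrow is counted twice at a node: since \<open>n\<close> has one colour, two edges at
  \<open>n\<close> have the same kind of end there, so a translation between them fixes
  \<open>n\<close>.\<close>

lemma inj_on_edge_proj: "inj_on edge_proj (edges_at D n)"
proof (rule inj_onI)
  fix e e' assume ee: "e \<in> edges_at D n" "e' \<in> edges_at D n" "edge_proj e = edge_proj e'"
  then obtain z where z: "z \<in> int_lattice" "e' = (fst e + z, snd e + z)"
    using edge_proj_eq_iff unfolding edges_at_def by blast
  have "z = 0"
  proof -
    have "e \<in> edges D" "e' \<in> edges D" using ee(1,2) by (simp_all add: edges_at_def)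
    then have "fst e \<in> white D" "snd e \<in> black D" "fst e' \<in> white D" "snd e' \<in> black D"
      using edge_ends by blast+
    then have "\<not> (fst e = n \<and> snd e' = n)" "\<not> (snd e = n \<and> fst e' = n)"
      using white_Int_black by (metis disjoint_iff)+
    moreover have "fst e = n \<or> snd e = n" "fst e' = n \<or> snd e' = n" using ee(1,2) by (simp_all add: edges_at_def)
    moreover have "fst e' = fst e + z" "snd e' = snd e + z" using z by auto
    ultimately show ?thesis by (metis add_cancel_left_right)
  qed
  then show "e = e'" using z by simp
qed

lemma cw_white_iterate:
  assumes "w \<in> white D"
  shows "(cw_white D ^^ j) (w, b) = (w, (next_cw (nbrs w) w ^^ j) b)"
  by (induction j) (simp_all add: cw_white_def nbrs_white[OF assms])

lemma ccw_black_iterate: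
  assumes "b \<in> black D"
  shows "(ccw_black D ^^ j) (w, b) = ((next_ccw (nbrs b) b ^^ j) w, b)"
  by (induction j) (simp_all add: ccw_black_def nbrs_black[OF assms])

lemma sum_iterate:
  fixes f :: "'c \<Rightarrow> 'b::comm_monoid_add"
  assumes "bij_betw g {..<n} S" "n > 0"
  shows "f (g 0) + sum_list (map (\<lambda>j. f (g j)) [1..<n]) = sum f S"
proof -
  have "sum f S = (\<Sum>j<n. f (g j))" using sum.reindex_bij_betw[OF assms(1)] by metis
  also have "\<dots> = sum_list (map (\<lambda>j. f (g j)) [0..<n])" by (simp add: sum_list_distinct_conv_sum_set atLeast0LessThan)
  also have "[0..<n] = 0 # [1..<n]" using assms(2) upt_conv_Cons by simp
  finally show ?thesis by simp
qed

lemma card_edges_at_pos: "e \<in> edges D \<Longrightarrow> fst e = n \<or> snd e = n \<Longrightarrow> card (edges_at D n) > 0"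
proof -
  assume "e \<in> edges D" "fst e = n \<or> snd e = n"
  then have "e \<in> edges_at D n" by (simp add: edges_at_def)
  then show ?thesis using finite_edges_at card_gt_0_iff by blast
qed

text \<open>The iterates of \<open>cw_white\<close> run exactly once through the edges at the white
  end; the path starts at index \<open>1\<close> and so omits the arrow itself.\<close>

lemma plus_path_sum:
  fixes f :: "torus_edge \<Rightarrow> 'b::comm_monoid_add"
  assumes "e \<in> edges D"
  shows "f (edge_proj e) + sum_list (map f (plus_path D e)) = nsum f (fst e)"
proof -
  obtain w b where e: "e = (w, b)" by (cases e)
  have w: "w \<in> white D" "b \<in> nbrs w" using assms edges_sub by (auto simp: e nbrs_def adj_def)
  interpret cyclic_order "nbrs w" "\<lambda>x y. Arg2pi ((x - w) / (y - w))" "next_cw (nbrs w) w" "2 * pi"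
    by (rule cyclic_cw)
  have "bij_betw (Pair w) (nbrs w) (edges_at D w)"
    unfolding edges_at_white[OF w(1)] by (auto simp: bij_betw_def inj_on_def)
  from bij_betw_trans[OF iterate_bij[OF w(2)] this]
  have bij: "bij_betw (\<lambda>j. (cw_white D ^^ j) (w, b)) {..<card (edges_at D w)} (edges_at D w)"
    using edges_at_white[OF w(1)] by (simp add: cw_white_iterate[OF w(1)] o_def card_image inj_on_def)
  show ?thesis
    using sum_iterate[OF bij, of "\<lambda>e. f (edge_proj e)"] card_edges_at_pos[OF assms, of w]
    unfolding plus_path_def nsum_def e by (simp add: o_def)
qed

lemma minus_path_sum:
  fixes f :: "torus_edge \<Rightarrow> 'b::comm_monoid_add"
  assumes "e \<in> edges D"
  shows "f (edge_proj e) + sum_list (map f (minus_path D e)) = nsum f (snd e)"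
proof -
  obtain w b where e: "e = (w, b)" by (cases e)
  have b: "b \<in> black D" "w \<in> nbrs b" using assms edges_sub by (auto simp: e nbrs_def adj_def)
  interpret cyclic_order "nbrs b" "\<lambda>x y. Arg2pi ((y - b) / (x - b))" "next_ccw (nbrs b) b" "2 * pi"
    by (rule cyclic_ccw)
  have "bij_betw (\<lambda>w. (w, b)) (nbrs b) (edges_at D b)"
    unfolding edges_at_black[OF b(1)] by (auto simp: bij_betw_def inj_on_def)
  from bij_betw_trans[OF iterate_bij[OF b(2)] this]
  have bij: "bij_betw (\<lambda>j. (ccw_black D ^^ j) (w, b)) {..<card (edges_at D b)} (edges_at D b)"
    using edges_at_black[OF b(1)] by (simp add: ccw_black_iterate[OF b(1)] o_def card_image inj_on_def)
  show ?thesis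
    using sum_iterate[OF bij, of "\<lambda>e. f (edge_proj e)"] card_edges_at_pos[OF assms, of b]
    unfolding minus_path_def nsum_def e by (simp add: o_def)
qed

lemma cas_map_upt:
  assumes "\<And>j. i \<le> j \<Longrightarrow> j < n \<Longrightarrow> head Q (g j) = tail Q (g (Suc j))" "i \<le> n"
  shows "pre_digraph.cas Q (tail Q (g i)) (map g [i..<n]) (tail Q (g n))"
  using assms(2,1)
proof (induction i rule: inc_induct)
  case base
  show ?case by (simp add: pre_digraph.cas.simps)
next
  case (step i)
  have "[i..<n] = i # [Suc i..<n]" using step.hyps by (simp add: upt_conv_Cons)
  then show ?case using step by (simp add: pre_digraph.cas.simps)
qed

lemma plus_path_cas:
  assumes "e \<in> edges D"
  shows "pre_digraph.cas Q (head Q (edge_proj e)) (plus_path D e) (tail Q (edge_proj e))"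
proof -
  obtain w b where e: "e = (w, b)" by (cases e)
  have w: "w \<in> white D" "b \<in> nbrs w" "w \<in> nodes" using assms edges_sub by (auto simp: e nbrs_def adj_def nodes_def)
  interpret cyclic_order "nbrs w" "\<lambda>x y. Arg2pi ((x - w) / (y - w))" "next_cw (nbrs w) w" "2 * pi"
    by (rule cyclic_cw)
  define n where "n = card (edges_at D w)"
  have n: "n = card (nbrs w)" using edges_at_white[OF w(1)] by (simp add: n_def card_image inj_on_def)
  define g where "g j = edge_proj ((cw_white D ^^ j) e)" for j
  have pp: "plus_path D e = map g [1..<n]" by (simp add: plus_path_def g_def n_def e)
  show ?thesis
  proof (cases "nbrs w = {b}")
    \<comment> \<open>At a node with a single edge the path is empty, and the corner of a full turn
      shows that the arrow is a loop.\<close>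
    case True
    then have "side w b = side b w" using corner_single[OF w(3)] by simp
    then show ?thesis using True head_edge[OF assms] tail_edge[OF assms] unfolding pp n
      by (simp add: pre_digraph.cas.simps e)
  next
    case False
    define x where "x j = (next_cw (nbrs w) w ^^ j) b" for j
    have g: "g j = edge_proj (w, x j)" for j by (simp add: g_def e cw_white_iterate[OF w(1)] x_def)
    have "nbrs w \<noteq> {y}" for y using False w(2) by auto
    then have xin: "x j \<in> nbrs w" for j
      by (induction j) (use w(2) nxt_in in \<open>auto simp: x_def\<close>)
    have ed: "(w, x j) \<in> edges D" for j using xin[of j] nbrs_white[OF w(1)] by auto
    have next_: "head Q (g j) = tail Q (g (Suc j))" for j
      using corner_cw[OF w(3) xin[of j]] \<open>\<And>y. nbrs w \<noteq> {y}\<close> head_edge[OF ed[of j]] tail_edge[OF ed[of "Suc j"]]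
      by (simp add: g x_def)
    have "n > 0" using card_edges_at_pos[OF assms, of w] by (simp add: n_def e)
    moreover have "x n = b" using iterate_closes[OF w(2) False] by (simp add: x_def n)
    then have "g n = g 0" by (simp add: g x_def)
    ultimately have "pre_digraph.cas Q (tail Q (g (Suc 0))) (map g [1..<n]) (tail Q (g 0))"
      using cas_map_upt[of 1 n g] next_ by simp
    then show ?thesis unfolding pp using next_[of 0] by (simp add: g_def)
  qed
qed

lemma minus_path_cas:
  assumes "e \<in> edges D"
  shows "pre_digraph.cas Q (head Q (edge_proj e)) (minus_path D e) (tail Q (edge_proj e))"
proof -
  obtain w b where e: "e = (w, b)" by (cases e)
  have b: "b \<in> black D" "w \<in> nbrs b" "b \<in> nodes" using assms edges_sub by (auto simp: e nbrs_def adj_def nodes_def)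
  interpret cyclic_order "nbrs b" "\<lambda>x y. Arg2pi ((y - b) / (x - b))" "next_ccw (nbrs b) b" "2 * pi"
    by (rule cyclic_ccw)
  define n where "n = card (edges_at D b)"
  have n: "n = card (nbrs b)" using edges_at_black[OF b(1)] by (simp add: n_def card_image inj_on_def)
  define g where "g j = edge_proj ((ccw_black D ^^ j) e)" for j
  have pp: "minus_path D e = map g [1..<n]" by (simp add: minus_path_def g_def n_def e)
  show ?thesis
  proof (cases "nbrs b = {w}")
    case True
    then have "side b w = side w b" using corner_single[OF b(3)] by simp
    then show ?thesis using True head_edge[OF assms] tail_edge[OF assms] unfolding pp n
      by (simp add: pre_digraph.cas.simps e)
  next
    case False
    define x where "x j = (next_ccw (nbrs b) b ^^ j) w" for j
    have g: "g j = edge_proj (x j, b)" for j by (simp add: g_def e ccw_black_iterate[OF b(1)] x_def)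
    have "nbrs b \<noteq> {y}" for y using False b(2) by auto
    then have xin: "x j \<in> nbrs b" for j
      by (induction j) (use b(2) nxt_in in \<open>auto simp: x_def\<close>)
    have ed: "(x j, b) \<in> edges D" for j using xin[of j] nbrs_black[OF b(1)] by auto
    have next_: "head Q (g j) = tail Q (g (Suc j))" for j
      using corner_ccw[OF b(3) xin[of j]] \<open>\<And>y. nbrs b \<noteq> {y}\<close> head_edge[OF ed[of j]] tail_edge[OF ed[of "Suc j"]]
      by (simp add: g x_def)
    have "n > 0" using card_edges_at_pos[OF assms, of b] by (simp add: n_def e)
    moreover have "x n = w" using iterate_closes[OF b(2) False] by (simp add: x_def n)
    then have "g n = g 0" by (simp add: g x_def)
    ultimately have "pre_digraph.cas Q (tail Q (g (Suc 0))) (map g [1..<n]) (tail Q (g 0))"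
      using cas_map_upt[of 1 n g] next_ by simp
    then show ?thesis unfolding pp using next_[of 0] by (simp add: g_def)
  qed
qed

text \<open>The sum formulas, applied to the indicator of the non-arrows with values in the
  naturals, force this indicator to vanish along both paths.\<close>

lemma plus_path_arcs: "e \<in> edges D \<Longrightarrow> set (plus_path D e) \<subseteq> arcs Q"
  and minus_path_arcs: "e \<in> edges D \<Longrightarrow> set (minus_path D e) \<subseteq> arcs Q"
proof -
  assume e: "e \<in> edges D"
  let ?f = "\<lambda>a. if a \<in> arcs Q then 0 else 1 :: nat"
  have ns: "nsum ?f n = 0" for n
    unfolding nsum_def arcs_Q by (intro sum.neutral) (auto simp: edges_at_def)
  have *: "set p \<subseteq> arcs Q" if "sum_list (map ?f p) = 0" for p
    using that by (auto simp: sum_list_eq_0_iff split: if_splits)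
  show "set (plus_path D e) \<subseteq> arcs Q" "set (minus_path D e) \<subseteq> arcs Q"
    using plus_path_sum[OF e, of ?f] minus_path_sum[OF e, of ?f] unfolding ns add_eq_0_iff_both_eq_0
    by (metis *)+
qed

end

subsection \<open>Connectedness of the skeleton\<close>

text \<open>A separation of \<open>S\<close> would extend to a separation of the plane, since the boundary of a bounded
  convex open set is connected and therefore lies on one side.\<close>

lemma connected_of_convex_complement:
  fixes S :: "complex set"
  assumes S: "closed S" and conv: "\<And>C. C \<in> components (- S) \<Longrightarrow> bounded C \<and> convex C"
    and AB: "closed A" "closed B" "A \<union> B = S" "A \<inter> B = {}"
  shows "A = {} \<or> B = {}"
proof -
  define F where "F A = A \<union> \<Union>{C \<in> components (- S). frontier C \<subseteq> A}" for A
  have op: "open C" if "C \<in> components (- S)" for C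
    using that S open_components open_Compl by blast
  have fr_sub: "frontier C \<subseteq> S" if C: "C \<in> components (- S)" for C
  proof
    fix x assume x: "x \<in> frontier C"
    show "x \<in> S"
    proof (rule ccontr)
      assume "x \<notin> S"
      then obtain C' where C': "C' \<in> components (- S)" "x \<in> C'" by (metis ComplI UnionE Union_components)
      then have "C' \<inter> C \<noteq> {}"
        using x open_Int_closure_eq_empty[OF op[OF C'(1)], of C] unfolding frontier_def by blast
      then have "C' = C" using components_eq C'(1) C by metis
      then show False using x C'(2) op[OF C] by (simp add: frontier_def interior_open)
    qed
  qed
  have fr_conn: "connected (frontier C)" and fr_ne: "frontier C \<noteq> {}" if C: "C \<in> components (- S)" for C
  proof -
    have ne: "C \<noteq> {}" using C in_components_nonempty by blast
    have "rel_frontier C = frontier C"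
      by (rule rel_frontier_frontier[OF affine_hull_open[OF op[OF C] ne]])
    moreover have "aff_dim C = 2" using aff_dim_open[OF op[OF C] ne] by simp
    ultimately show "connected (frontier C)" using connected_sphere_gen[of C] conv[OF C] by simp
    have "C \<noteq> UNIV" using conv[OF C] not_bounded_UNIV by auto
    then show "frontier C \<noteq> {}" using frontier_not_empty[OF ne] by simp
  qed
  have cover: "x \<in> F A \<or> x \<in> F B" for x
  proof (cases "x \<in> S")
    case False
    then obtain C where C: "C \<in> components (- S)" "x \<in> C" by (metis ComplI UnionE Union_components)
    have "frontier C \<subseteq> A \<or> frontier C \<subseteq> B"
      using connected_closedD[OF fr_conn[OF C(1)], of A B] AB fr_sub[OF C(1)] by blast
    then show ?thesis using C unfolding F_def by blast
  qed (use AB in \<open>auto simp: F_def\<close>)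
  have disj: "F A \<inter> F B = {}"
  proof -
    have "x \<notin> F B" if xA: "x \<in> F A" for x
    proof (cases "x \<in> S")
      case True
      then have "x \<notin> C" if "C \<in> components (- S)" for C using in_components_subset[OF that] by blast
      then show ?thesis using AB \<open>x \<in> F A\<close> unfolding F_def by blast
    next
      case False
      then obtain C where C: "C \<in> components (- S)" "x \<in> C" "frontier C \<subseteq> A"
        using xA AB unfolding F_def by blast
      show ?thesis
      proof
        assume "x \<in> F B"
        then obtain C' where C': "C' \<in> components (- S)" "x \<in> C'" "frontier C' \<subseteq> B"
          using False AB unfolding F_def by blast
        then have "C' = C" using components_eq C by blast
        then show False using C' C AB fr_ne[OF C(1)] by blast
      qed
    qed
    then show ?thesis by blast
  qed
  have cl: "closed (F A)" if AB: "closed A" "A \<subseteq> S" and cover: "\<And>x. x \<in> F A \<or> x \<in> F B"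
    and disj: "F A \<inter> F B = {}" and "B \<subseteq> S" for A B
  proof (rule closed_sequential_limits[THEN iffD2, rule_format], elim conjE)
    fix X l assume X: "\<forall>n. X n \<in> F A" "X \<longlonglongrightarrow> l"
    show "l \<in> F A"
    proof (rule ccontr)
      assume "l \<notin> F A"
      then have l: "l \<in> F B" using cover by blast
      show False
      proof (cases "l \<in> S")
        case False
        then obtain C where C: "C \<in> components (- S)" "l \<in> C" "frontier C \<subseteq> B"
          using l \<open>B \<subseteq> S\<close> unfolding F_def by blast
        then have "eventually (\<lambda>n. X n \<in> C) sequentially" using X(2) op topological_tendstoD by blast
        then obtain n where "X n \<in> C" by (auto simp: eventually_sequentially)
        then have "X n \<in> F B" using C unfolding F_def by blast
        then show False using X(1) disj by blast
      next
        case True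
        have "\<exists>y\<in>A. dist y l \<le> dist (X n) l" for n
        proof (cases "X n \<in> A")
          case False
          then obtain C where C: "C \<in> components (- S)" "X n \<in> C" "frontier C \<subseteq> A"
            using X(1) unfolding F_def by blast
          have "l \<notin> C" using True in_components_subset[OF C(1)] by blast
          then have "closed_segment (X n) l \<inter> frontier C \<noteq> {}"
            using C(2) by (intro connected_Int_frontier) auto
          then obtain y where "y \<in> closed_segment (X n) l" "y \<in> A" using C(3) by blast
          then show ?thesis using dist_in_closed_segment[of y "X n" l] by (auto simp: dist_commute)
        qed auto
        then have "\<exists>y. \<forall>n. y n \<in> A \<and> dist (y n) l \<le> dist (X n) l" by metis
        then obtain y where y: "\<And>n. y n \<in> A" "\<And>n. dist (y n) l \<le> dist (X n) l" by blast
        have dX: "(\<lambda>n. dist (X n) l) \<longlonglongrightarrow> 0" by (rule tendsto_dist_iff[THEN iffD1, OF X(2)])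
        have "(\<lambda>n. dist (y n) l) \<longlonglongrightarrow> 0"
          by (rule tendsto_sandwich[OF _ _ tendsto_const dX]) (use y(2) in auto)
        then have "y \<longlonglongrightarrow> l" by (rule tendsto_dist_iff[THEN iffD2])
        then have "l \<in> A" using AB(1) y(1) closed_sequential_limits by blast
        then show False using \<open>l \<notin> F A\<close> by (simp add: F_def)
      qed
    qed
  qed
  have "closed (F A)" "closed (F B)"
    using cl[of A B] cl[of B A] AB cover disj by blast+
  then have "F A = {} \<or> F B = {}"
    using connected_closedD[of UNIV "F A" "F B"] cover disj by blast
  then show ?thesis by (auto simp: F_def)
qed

context dimer_geometry begin

text \<open>If two values of \<open>h\<close> occurred, the nodes and edges carrying one of them and
  those carrying the other values would split the skeleton into two disjoint nonempty closed
  sets.\<close>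

lemma nodes_connected:
  fixes h :: "complex \<Rightarrow> 'b"
  assumes h: "\<And>e. e \<in> edges D \<Longrightarrow> h (fst e) = h (snd e)" and n: "n \<in> nodes" "n' \<in> nodes"
  shows "h n = h n'"
proof -
  define A where "A P = {x \<in> nodes. P (h x)} \<union> (\<Union>e\<in>{e \<in> edges D. P (h (fst e))}. segment e)" for P
  have cl: "closed (A P)" for P
    unfolding A_def by (intro closed_Un closed_subset_nodes closed_Union_segments) auto
  have un: "A (\<lambda>r. r = h n) \<union> A (\<lambda>r. r \<noteq> h n) = skeleton D"
    unfolding A_def skeleton_eq by blast
  have dis: "A (\<lambda>r. r = h n) \<inter> A (\<lambda>r. r \<noteq> h n) = {}"
  proof -
    have node: "h x = h (fst e)" if "x \<in> nodes" "e \<in> edges D" "x \<in> segment e" for x e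
    proof -
      have "x \<in> {fst e, snd e}" using segment_nodes[OF that(2)] that by blast
      then show ?thesis using h[OF that(2)] by auto
    qed
    have "P (h (fst e))" if x: "x \<in> A P" "e \<in> edges D" "x \<in> segment e" for x e P
    proof (cases "x \<in> nodes")
      case True
      then have "h x = h (fst e)" using node x by blast
      moreover have "P (h x)" using x(1) True node unfolding A_def by fastforce
      ultimately show ?thesis by simp
    next
      case False
      then obtain e' where e': "e' \<in> edges D" "P (h (fst e'))" "x \<in> segment e'" using x(1) unfolding A_def by blast
      have "x \<in> open_segment (fst e) (snd e)"
        using x(2,3) False edge_ends[OF x(2)] unfolding segment_def open_segment_def by auto
      then show ?thesis using edge_eq_of_common_point[OF x(2) e'(1) _ e'(3)] e'(2) by simp
    qed
    moreover have "P (h x)" if x: "x \<in> A P" "x \<in> nodes" for x P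
      using x node unfolding A_def by fastforce
    ultimately have "P r \<Longrightarrow> True" and *: "\<And>x P P'. x \<in> A P \<Longrightarrow> x \<in> A P' \<Longrightarrow> \<exists>r. P r \<and> P' r" for P :: "'b \<Rightarrow> bool" and r
      unfolding A_def by blast+
    show ?thesis using *[of _ "\<lambda>r. r = h n" "\<lambda>r. r \<noteq> h n"] by blast
  qed
  have "A (\<lambda>r. r = h n) = {} \<or> A (\<lambda>r. r \<noteq> h n) = {}"
    by (rule connected_of_convex_complement[OF closed_skeleton _ cl cl un dis])
      (simp add: tile_bounded tile_convex lifted_tiles_def[symmetric])
  moreover have "n \<in> A (\<lambda>r. r = h n)" using n(1) by (simp add: A_def)
  ultimately have "A (\<lambda>r. r \<noteq> h n) = {}" by (metis empty_iff)
  moreover have "n' \<in> A (\<lambda>r. r \<noteq> h n)" if "h n' \<noteq> h n" using n(2) that by (simp add: A_def)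
  ultimately show ?thesis by (metis empty_iff)
qed

subsection \<open>Potentials of flows without sources\<close>

text \<open>The intersection number of the path from \<open>x\<close> to \<open>y\<close> with the
  periodic 1-chain that has coefficient \<open>g (edge_proj e)\<close> on each lifted edge
  \<open>e\<close>. Restricting to the edges met by the path keeps the sum finite.\<close>

definition flux :: "(torus_edge \<Rightarrow> int) \<Rightarrow> complex \<Rightarrow> complex \<Rightarrow> real" where
  "flux g x y = (\<Sum>e\<in>{e \<in> edges D. segment e \<inter> closed_segment x y \<noteq> {}}. of_int (g (edge_proj e)) * crossing x y e)"

lemma flux_superset:
  assumes "finite F" "F \<subseteq> edges D" "\<And>e. e \<in> edges D \<Longrightarrow> segment e \<inter> closed_segment x y \<noteq> {} \<Longrightarrow> e \<in> F"
  shows "flux g x y = (\<Sum>e\<in>F. of_int (g (edge_proj e)) * crossing x y e)"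
  unfolding flux_def
  by (rule sum.mono_neutral_left) (use assms crossing_disjoint in \<open>auto simp: Int_commute\<close>)

text \<open>Crossings around the triangle become windings about the ends of the edges. Grouped by
  white and by black ends, the winding about a node is multiplied by \<open>nsum g\<close> at this
  node, which is zero. Nodes outside the convex hull contribute no winding, so finitely many edges
  suffice.\<close>

lemma flux_triangle:
  assumes "\<And>n. n \<in> nodes \<Longrightarrow> nsum g n = 0"
  shows "flux g x y + flux g y z + flux g z x = 0"
proof -
  define H where "H = convex hull {x, y, z}"
  define F where "F = {e \<in> edges D. segment e \<inter> H \<noteq> {}}"
  have bH: "bounded H" unfolding H_def by (simp add: bounded_convex_hull)
  then have fF: "finite F" unfolding F_def by (rule finite_edges_meeting)
  have xyz: "x \<in> H" "y \<in> H" "z \<in> H" unfolding H_def by (simp_all add: hull_inc)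
  have "closed_segment u v \<subseteq> H" if "u \<in> H" "v \<in> H" for u v
    using that closed_segment_subset[of u H v] by (simp add: H_def)
  then have fl: "flux g u v = (\<Sum>e\<in>F. of_int (g (edge_proj e)) * crossing u v e)" if "u \<in> H" "v \<in> H" for u v
    using that by (intro flux_superset[OF fF]) (auto simp: F_def)
  have "flux g x y + flux g y z + flux g z x =
      (\<Sum>e\<in>F. of_int (g (edge_proj e)) * ((winding (fst e) x y z - winding (snd e) x y z) / (2 * pi)))"
    using xyz by (simp add: fl flip: sum.distrib distrib_left crossing_triangle)
  also have "\<dots> = ((\<Sum>e\<in>F. of_int (g (edge_proj e)) * winding (fst e) x y z)
      - (\<Sum>e\<in>F. of_int (g (edge_proj e)) * winding (snd e) x y z)) / (2 * pi)"
    by (simp add: sum_subtractf sum_divide_distrib right_diff_distrib diff_divide_distrib)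
  also have "\<dots> = 0"
  proof -
    \<comment> \<open>One computation for both colours: \<open>p\<close> selects an end of an edge
      and \<open>N\<close> is the set of nodes of that colour.\<close>
    have zero: "(\<Sum>e\<in>F. of_int (g (edge_proj e)) * winding (p e) x y z) = 0"
      if p: "\<And>e. e \<in> edges D \<Longrightarrow> p e \<in> N" "N \<subseteq> nodes"
        "\<And>n. n \<in> N \<Longrightarrow> {e \<in> edges D. p e = n} = edges_at D n"
        "\<And>e. e \<in> edges D \<Longrightarrow> p e \<in> segment e" for p N
    proof -
      define W where "W = N \<inter> H"
      have fW: "finite W" unfolding W_def
        by (rule finite_subset[OF Int_mono[OF p(2) order_refl] finite_nodes_Int[OF bH]])
      have "(\<Sum>e\<in>F. of_int (g (edge_proj e)) * winding (p e) x y z) =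
          (\<Sum>e\<in>{e \<in> F. p e \<in> W}. of_int (g (edge_proj e)) * winding (p e) x y z)"
      proof (rule sum.mono_neutral_right)
        show "\<forall>e\<in>F - {e \<in> F. p e \<in> W}. of_int (g (edge_proj e)) * winding (p e) x y z = 0"
        proof
          fix e assume e: "e \<in> F - {e \<in> F. p e \<in> W}"
          then have "p e \<notin> H" using p(1)[of e] by (auto simp: W_def F_def)
          then show "of_int (g (edge_proj e)) * winding (p e) x y z = 0"
            using winding_outside unfolding H_def by simp
        qed
      qed (use fF in auto)
      also have "\<dots> = (\<Sum>n\<in>W. \<Sum>e\<in>{e \<in> {e \<in> F. p e \<in> W}. p e = n}. of_int (g (edge_proj e)) * winding (p e) x y z)"
        using fF fW by (intro sum.group[symmetric]) auto
      also have "\<dots> = (\<Sum>n\<in>W. of_int (nsum g n) * winding n x y z)"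
      proof (rule sum.cong[OF refl])
        fix n assume n: "n \<in> W"
        have "{e \<in> {e \<in> F. p e \<in> W}. p e = n} = edges_at D n"
        proof (intro equalityI subsetI)
          fix e assume "e \<in> edges_at D n"
          then have e: "e \<in> edges D" "p e = n" using p(3)[of n] n unfolding W_def by blast+
          moreover have "segment e \<inter> H \<noteq> {}" using p(4)[OF e(1)] e(2) n unfolding W_def by blast
          ultimately show "e \<in> {e \<in> {e \<in> F. p e \<in> W}. p e = n}" using n by (simp add: F_def)
        next
          fix e assume "e \<in> {e \<in> {e \<in> F. p e \<in> W}. p e = n}"
          then show "e \<in> edges_at D n" using p(3)[of n] n unfolding W_def F_def by blast
        qed
        moreover have "p e = n" if "e \<in> edges_at D n" for e using p(3)[of n] n that unfolding W_def by blast
        ultimately show "(\<Sum>e\<in>{e \<in> {e \<in> F. p e \<in> W}. p e = n}. of_int (g (edge_proj e)) * winding (p e) x y z)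
            = of_int (nsum g n) * winding n x y z"
          by (simp add: nsum_def sum_distrib_right)
      qed
      also have "\<dots> = 0" using assms p(2) by (intro sum.neutral) (auto simp: W_def)
      finally show ?thesis .
    qed
    have "(\<Sum>e\<in>F. of_int (g (edge_proj e)) * winding (fst e) x y z) = 0"
    proof (rule zero[of fst "white D"])
      show "{e \<in> edges D. fst e = n} = edges_at D n" if "n \<in> white D" for n
        using that edge_ends white_Int_black unfolding edges_at_def by blast
    qed (use edge_ends in \<open>auto simp: nodes_def segment_def\<close>)
    moreover have "(\<Sum>e\<in>F. of_int (g (edge_proj e)) * winding (snd e) x y z) = 0"
    proof (rule zero[of snd "black D"])
      show "{e \<in> edges D. snd e = n} = edges_at D n" if "n \<in> black D" for n
        using that edge_ends white_Int_black unfolding edges_at_def by blast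
    qed (use edge_ends in \<open>auto simp: nodes_def segment_def\<close>)
    ultimately show ?thesis by simp
  qed
  finally show ?thesis .
qed

text \<open>The degenerate triangles \<open>x x x\<close> and \<open>x z x\<close> give
  \<open>flux g x x = 0\<close> and antisymmetry.\<close>

lemma flux_chain:
  assumes "\<And>n. n \<in> nodes \<Longrightarrow> nsum g n = 0"
  shows "flux g x z = flux g x y + flux g y z"
  using flux_triangle[OF assms, of x y z] flux_triangle[OF assms, of x z x] flux_triangle[OF assms, of x x x] by simp

lemma flux_same_tile:
  assumes "C \<in> lifted_tiles D" "x \<in> C" "y \<in> C"
  shows "flux g x y = 0"
proof -
  have "closed_segment x y \<subseteq> C" using assms tile_convex by (simp add: closed_segment_subset)
  then have "{e \<in> edges D. segment e \<inter> closed_segment x y \<noteq> {}} = {}"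
    using tile_disjoint_skeleton[OF assms(1)] unfolding skeleton_eq by blast
  then show ?thesis unfolding flux_def by (simp only: sum.empty)
qed

lemma flux_translate:
  assumes z: "z \<in> int_lattice"
  shows "flux g (x + z) (y + z) = flux g x y"
proof -
  let ?tr = "\<lambda>e. (fst e + z, snd e + z) :: lifted_edge"
  let ?E = "\<lambda>x y. {e \<in> edges D. segment e \<inter> closed_segment x y \<noteq> {}}"
  have seg: "closed_segment (x + z) (y + z) = (\<lambda>u. u + z) ` closed_segment x y"
    using closed_segment_translation[of z x y] by (simp add: add.commute)
  have meet: "segment (?tr e) \<inter> closed_segment (x + z) (y + z) \<noteq> {} \<longleftrightarrow> segment e \<inter> closed_segment x y \<noteq> {}" for e
  proof -
    have "(\<lambda>u. u + z) ` A \<inter> (\<lambda>u. u + z) ` B = (\<lambda>u. u + z) ` (A \<inter> B)" for A B by auto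
    then show ?thesis unfolding segment_translate seg by simp
  qed
  have "bij_betw ?tr (?E x y) (?E (x + z) (y + z))"
    unfolding bij_betw_def
  proof (intro conjI equalityI subsetI)
    show "inj_on ?tr (?E x y)" by (auto simp: inj_on_def prod_eq_iff)
    fix e assume "e \<in> ?tr ` ?E x y"
    then show "e \<in> ?E (x + z) (y + z)" using meet edge_translate z by auto
  next
    fix e assume e: "e \<in> ?E (x + z) (y + z)"
    define e' where "e' = (fst e - z, snd e - z)"
    have "e' \<in> edges D" using edge_translate[of e "- z"] e int_lattice_uminus[OF z] by (simp add: e'_def)
    moreover have "e = ?tr e'" by (simp add: e'_def)
    ultimately show "e \<in> ?tr ` ?E x y" using meet[of e'] e by auto
  qed
  then have "flux g (x + z) (y + z) = (\<Sum>e\<in>?E x y. of_int (g (edge_proj (?tr e))) * crossing (x + z) (y + z) (?tr e))"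
    unfolding flux_def by (rule sum.reindex_bij_betw[symmetric])
  also have "\<dots> = flux g x y"
    unfolding flux_def
  proof (rule sum.cong[OF refl])
    fix e assume "e \<in> ?E x y"
    then have "edge_proj (?tr e) = edge_proj e" using edge_proj_eq_iff[of e "?tr e"] edge_translate z by auto
    then show "of_int (g (edge_proj (?tr e))) * crossing (x + z) (y + z) (?tr e) = of_int (g (edge_proj e)) * crossing x y e"
      by simp
  qed
  finally show ?thesis .
qed

lemma flux_integer:
  assumes "x \<notin> skeleton D" "y \<notin> skeleton D"
  shows "flux g x y \<in> \<int>"
  unfolding flux_def
proof (intro Ints_sum Ints_mult crossing_integer)
  fix e assume "e \<in> {e \<in> edges D. segment e \<inter> closed_segment x y \<noteq> {}}"
  then have "fst e \<in> skeleton D" "snd e \<in> skeleton D" using edge_ends by (auto simp: skeleton_eq)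
  then show "x \<noteq> fst e" "x \<noteq> snd e" "y \<noteq> fst e" "y \<noteq> snd e" using assms by auto
qed auto

text \<open>The flux does not change within a tile, so \<open>x\<close> and \<open>y\<close> can be
  replaced by points on either side of the midpoint, so close that the segment joining them meets no
  other edge.\<close>

lemma flux_across_edge:
  assumes e: "e \<in> edges D" and x: "x \<in> side (fst e) (snd e)" and y: "y \<in> side (snd e) (fst e)"
    and g: "\<And>n. n \<in> nodes \<Longrightarrow> nsum g n = 0"
  shows "flux g x y = - of_int (g (edge_proj e))"
proof -
  define w b where "w = fst e" and "b = snd e"
  have adj: "adj w b" "adj b w" using edge_adj[OF e] by (auto simp: w_def b_def)
  have wb: "w \<noteq> b" using adj_neq[OF adj(1)] .
  define m where "m = midpoint w b"
  have m: "m \<in> open_segment w b" "m \<in> open_segment b w" using wb by (simp_all add: m_def open_segment_commute[of b w])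
  obtain \<delta> where d: "\<delta> > 0" "\<And>v. dist v m < \<delta> \<and> Im ((v - w) / (b - w)) > 0 \<Longrightarrow> v \<in> side w b"
    using side_properties(2)[OF adj(1) m(1)] by blast
  obtain \<delta>' where d': "\<delta>' > 0" "\<And>v. dist v m < \<delta>' \<and> Im ((v - b) / (w - b)) > 0 \<Longrightarrow> v \<in> side b w"
    using side_properties(2)[OF adj(2) m(2)] by blast
  obtain \<delta>'' where d'': "\<delta>'' > 0" "\<And>v. dist v m < \<delta>'' \<Longrightarrow> v \<in> skeleton D \<Longrightarrow> v \<in> closed_segment w b"
    using strip[OF adj(1) m(1) m(1)] by auto
  define L where "L = norm (b - w)"
  have L: "L > 0" using wb by (simp add: L_def)
  \<comment> \<open>The first two bounds put \<open>p\<close> and \<open>q\<close> into the two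
    sides, the third keeps the segment between them off all other edges, and \<open>1/2\<close>
    keeps it away from \<open>w\<close> and \<open>b\<close>, whose distance from \<open>m\<close>
    is \<open>L / 2\<close>.\<close>
  define \<epsilon> where "\<epsilon> = Min {\<delta> / L, \<delta>' / L, \<delta>'' / L, 1/2} / 2"
  have eps: "\<epsilon> > 0" "\<epsilon> * L < \<delta>" "\<epsilon> * L < \<delta>'" "\<epsilon> * L < \<delta>''" "\<epsilon> < 1/2"
  proof -
    define M where "M = Min {\<delta> / L, \<delta>' / L, \<delta>'' / L, 1/2}"
    have "M > 0" using d(1) d'(1) d''(1) L by (simp add: M_def)
    moreover have M: "M \<le> \<delta> / L" "M \<le> \<delta>' / L" "M \<le> \<delta>'' / L" "M \<le> 1/2"
      unfolding M_def by (rule Min_le; simp)+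
    ultimately have "M * L \<le> \<delta>" "M * L \<le> \<delta>'" "M * L \<le> \<delta>''" using L by (simp_all add: field_simps)
    moreover have "M * L > 0" using \<open>M > 0\<close> L by simp
    ultimately show "\<epsilon> > 0" "\<epsilon> * L < \<delta>" "\<epsilon> * L < \<delta>'" "\<epsilon> * L < \<delta>''" "\<epsilon> < 1/2"
      using \<open>M > 0\<close> \<open>M \<le> 1/2\<close> unfolding \<epsilon>_def M_def[symmetric] by auto
  qed
  define p where "p = m + of_real \<epsilon> * \<i> * (b - w)"
  define q where "q = m - of_real \<epsilon> * \<i> * (b - w)"
  have dpq: "dist p m = \<epsilon> * L" "dist q m = \<epsilon> * L"
    using eps(1) by (simp_all add: p_def q_def dist_norm norm_mult L_def)
  have "p - w = (b - w) * Complex (1/2) \<epsilon>" "q - b = (w - b) * Complex (1/2) \<epsilon>"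
    by (auto simp: p_def q_def m_def midpoint_def complex_eq_iff field_simps)
  then have "Im ((p - w) / (b - w)) > 0" "Im ((q - b) / (w - b)) > 0" using wb eps(1) by simp_all
  then have pq: "p \<in> side w b" "q \<in> side b w" using d(2) d'(2) dpq eps by auto
  have only: "e' = e" if e': "e' \<in> edges D" "segment e' \<inter> closed_segment p q \<noteq> {}" for e'
  proof -
    obtain u where u: "u \<in> segment e'" "u \<in> closed_segment p q" using e'(2) by blast
    have "closed_segment p q \<subseteq> cball m (\<epsilon> * L)"
      using dpq by (intro closed_segment_subset) (auto simp: dist_commute)
    then have du: "dist u m \<le> \<epsilon> * L" using u(2) by (auto simp: dist_commute)
    then have "u \<in> closed_segment w b" using d''(2)[of u] eps u(1) e'(1) unfolding skeleton_eq by force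
    moreover have "dist w m = L / 2" "dist b m = L / 2"
      unfolding m_def L_def dist_midpoint by (simp_all add: dist_norm norm_minus_commute)
    then have "u \<noteq> w" "u \<noteq> b" using du eps(5) L by auto
    ultimately have "u \<in> open_segment (fst e) (snd e)" by (simp add: open_segment_def w_def b_def)
    then show ?thesis using edge_eq_of_common_point[OF e e'(1) _ u(1)] by simp
  qed
  have "flux g p q = (\<Sum>e\<in>{e}. of_int (g (edge_proj e)) * crossing p q e)"
    by (rule flux_superset) (use e only in auto)
  also have "\<dots> = - of_int (g (edge_proj e))"
    using crossing_midpoint[OF wb eps(1)] by (simp add: p_def q_def m_def w_def b_def)
  finally have "flux g p q = - of_int (g (edge_proj e))" .
  moreover have "flux g x p = 0" "flux g q y = 0"
    using flux_same_tile side_properties(1)[OF adj(1)] side_properties(1)[OF adj(2)] pq x y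
    unfolding w_def b_def by blast+
  ultimately show ?thesis using flux_chain[OF g, of x y p] flux_chain[OF g, of p y q] by simp
qed

section \<open>Periods of a flow and its potential\<close>

lemma flux_period_multiple:
  assumes g: "\<And>n. n \<in> nodes \<Longrightarrow> nsum g n = 0" and u: "u \<in> int_lattice"
  shows "flux g x (x + of_int k * u) = of_int k * flux g x (x + u)"
proof -
  have add: "flux g x (x + (z + z')) = flux g x (x + z) + flux g x (x + z')" if "z \<in> int_lattice" for z z'
    using flux_chain[OF g, of x "x + (z + z')" "x + z"] flux_translate[OF that, of g x "x + z'"]
    by (simp add: add_ac)
  show ?thesis
  proof (induction k rule: int_induct[where k = 0])
    case base
    show ?case using flux_triangle[OF g, of x x x] by simp
  next
    case (step1 i)
    then show ?case using add[OF u, of "of_int i * u"] by (simp add: algebra_simps)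
  next
    case (step2 i)
    then show ?case using add[OF u, of "of_int (i - 1) * u"] by (simp add: algebra_simps)
  qed
qed

text \<open>Integration from a base point: when both generating periods vanish, the flux from
  \<open>x0\<close> to a tile does not depend on the lift of the tile and descends to the vertices
  of the quiver.\<close>

lemma potential_of_zero_periods:
  assumes g: "\<And>n. n \<in> nodes \<Longrightarrow> nsum g n = 0" and x0: "x0 \<notin> skeleton D"
    and per: "flux g x0 (x0 + 1) = 0" "flux g x0 (x0 + \<i>) = 0"
  shows "\<exists>m :: torus_tile \<Rightarrow> int. \<forall>a\<in>arcs Q. g a = m (head Q a) - m (tail Q a)"
proof -
  have lat: "1 \<in> int_lattice" "\<i> \<in> int_lattice" by (auto simp: int_lattice_def)
  have period: "flux g x0 (x0 + z) = 0" if "z \<in> int_lattice" for z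
  proof -
    obtain m n :: int where "z = Complex (of_int m) (of_int n)" using \<open>z \<in> int_lattice\<close> unfolding int_lattice_range by auto
    then have z: "z = of_int m * 1 + of_int n * \<i>" by (simp add: complex_eq_iff)
    have ml: "of_int m * 1 \<in> int_lattice" by (simp add: int_lattice_def)
    have "flux g x0 (x0 + z) = flux g x0 (x0 + of_int m * 1) + flux g (x0 + of_int m * 1) (x0 + of_int n * \<i> + of_int m * 1)"
      unfolding z using flux_chain[OF g] by (simp add: add_ac)
    also have "\<dots> = flux g x0 (x0 + of_int m * 1) + flux g x0 (x0 + of_int n * \<i>)"
      unfolding flux_translate[OF ml] ..
    also have "\<dots> = 0"
      using flux_period_multiple[OF g lat(1), of x0 m] flux_period_multiple[OF g lat(2), of x0 n] per by simp
    finally show ?thesis .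
  qed
  \<comment> \<open>The minus sign offsets the one in \<open>flux_across_edge\<close>. The floor
    only passes from real to integer type, as the flux between points off the skeleton is an
    integer.\<close>
  define M where "M i = - \<lfloor>flux g x0 (SOME x. x \<notin> skeleton D \<and> torus_proj ` tile_of x = i)\<rfloor>" for i
  have M: "of_int (M (torus_proj ` tile_of x)) = - flux g x0 x" if x: "x \<notin> skeleton D" for x
  proof -
    define y where "y = (SOME y. y \<notin> skeleton D \<and> torus_proj ` tile_of y = torus_proj ` tile_of x)"
    have y: "y \<notin> skeleton D" "torus_proj ` tile_of y = torus_proj ` tile_of x"
      using someI[of "\<lambda>y. y \<notin> skeleton D \<and> torus_proj ` tile_of y = torus_proj ` tile_of x" x] x
      unfolding y_def by auto
    have "torus_proj y \<in> torus_proj ` tile_of x" using y tile_of_mem by blast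
    then obtain v where v: "v \<in> tile_of x" "torus_proj v = torus_proj y" by auto
    define z where "z = y - v"
    have z: "z \<in> int_lattice" "y = v + z" using v(2) torus_proj_eq_iff by (auto simp: z_def)
    have "flux g x0 y = flux g x0 (x0 + z) + flux g (x0 + z) (v + z)"
      unfolding z(2) by (rule flux_chain[OF g])
    also have "\<dots> = flux g x0 v" using period[OF z(1)] flux_translate[OF z(1)] by simp
    also have "\<dots> = flux g x0 x + flux g x v" by (rule flux_chain[OF g])
    also have "flux g x v = 0"
      using flux_same_tile[OF tile_of_tile[OF x] tile_of_mem[OF x] v(1)] .
    finally have "flux g x0 y = flux g x0 x" by simp
    then show ?thesis using flux_integer[OF x0 x, of g] unfolding M_def y_def[symmetric]
      by (auto elim!: Ints_cases)
  qed
  have "g a = M (head Q a) - M (tail Q a)" if a: "a \<in> arcs Q" for a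
  proof -
    obtain e where e: "e \<in> edges D" "a = edge_proj e" using a unfolding arcs_Q by blast
    have S: "side (fst e) (snd e) \<in> lifted_tiles D" "side (snd e) (fst e) \<in> lifted_tiles D"
      using side_properties(1) edge_adj[OF e(1)] by auto
    obtain x y where xy: "x \<in> side (fst e) (snd e)" "y \<in> side (snd e) (fst e)"
      using tile_nonempty S by blast
    have ns: "x \<notin> skeleton D" "y \<notin> skeleton D" using tile_disjoint_skeleton S xy by blast+
    have "side (fst e) (snd e) = tile_of x" "side (snd e) (fst e) = tile_of y" using tile_eq S xy by auto
    then have "head Q a = torus_proj ` tile_of y" "tail Q a = torus_proj ` tile_of x"
      using head_edge[OF e(1)] tail_edge[OF e(1)] e(2) by simp_all
    then have "of_int (M (head Q a) - M (tail Q a)) = flux g x0 x - flux g x0 y"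
      using M[OF ns(1)] M[OF ns(2)] by simp
    also have "\<dots> = - flux g x y" using flux_chain[OF g, of x0 y x] by simp
    also have "\<dots> = real_of_int (g a)" using flux_across_edge[OF e(1) xy g] e(2) by simp
    finally show ?thesis by (simp only: of_int_eq_iff)
  qed
  then show ?thesis by blast
qed

text \<open>The three minors always give a relation by Cramer's rule. If all of them vanish,
  \<open>u\<close> is zero or \<open>v\<close> is parallel to it, and a relation between
  \<open>u\<close> and \<open>v\<close> alone remains.\<close>

lemma integer_relation:
  fixes u v w :: "int \<times> int"
  shows "\<exists>a b c. (a \<noteq> 0 \<or> b \<noteq> 0 \<or> c \<noteq> 0) \<and> a * fst u + b * fst v + c * fst w = 0 \<and> a * snd u + b * snd v + c * snd w = 0"
proof -
  define det where "det u v = fst u * snd v - snd u * fst v" for u v :: "int \<times> int"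
  consider "det v w \<noteq> 0 \<or> det w u \<noteq> 0 \<or> det u v \<noteq> 0" | "u = (0, 0)"
    | "det u v = 0" "fst u \<noteq> 0" | "det u v = 0" "snd u \<noteq> 0"
    by (cases u) auto
  then show ?thesis
  proof cases
    case 1
    then show ?thesis
      by (intro exI[of _ "det v w"] exI[of _ "det w u"] exI[of _ "det u v"]) (auto simp: det_def algebra_simps)
  next
    case 2
    then show ?thesis by (intro exI[of _ 1] exI[of _ 0]) auto
  next
    case 3
    then show ?thesis
      by (intro exI[of _ "- fst v"] exI[of _ "fst u"] exI[of _ 0]) (auto simp: det_def algebra_simps)
  next
    case 4
    then show ?thesis
      by (intro exI[of _ "- snd v"] exI[of _ "snd u"] exI[of _ 0]) (auto simp: det_def algebra_simps)
  qed
qed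

text \<open>The periods of a flow without sources form a vector in \<open>\<int>\<^sup>2\<close>, so any three flows have a
  nontrivial combination with zero periods.\<close>

lemma zero_sum_relation:
  fixes g1 g2 g3 :: "torus_edge \<Rightarrow> int"
  assumes "\<And>n. n \<in> nodes \<Longrightarrow> nsum g1 n = 0" "\<And>n. n \<in> nodes \<Longrightarrow> nsum g2 n = 0" "\<And>n. n \<in> nodes \<Longrightarrow> nsum g3 n = 0"
  shows "\<exists>a b c (m :: torus_tile \<Rightarrow> int). (a \<noteq> 0 \<or> b \<noteq> 0 \<or> c \<noteq> 0) \<and>
    (\<forall>r\<in>arcs Q. a * g1 r + b * g2 r + c * g3 r = m (head Q r) - m (tail Q r))"
proof -
  obtain x0 where x0: "x0 \<notin> skeleton D" using nonskeleton_point[of UNIV] by auto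
  have lat: "1 \<in> int_lattice" "\<i> \<in> int_lattice" by (auto simp: int_lattice_def)
  have x1: "x0 + 1 \<notin> skeleton D" "x0 + \<i> \<notin> skeleton D" using x0 skeleton_translate lat by auto
  have "\<exists>p. flux g x0 (x0 + 1) = of_int (fst p) \<and> flux g x0 (x0 + \<i>) = of_int (snd p)" for g
    using flux_integer[OF x0 x1(1), of g] flux_integer[OF x0 x1(2), of g] by (metis Ints_cases fst_conv snd_conv)
  then obtain P where P: "\<And>g. flux g x0 (x0 + 1) = of_int (fst (P g))" "\<And>g. flux g x0 (x0 + \<i>) = of_int (snd (P g))"
    by metis
  obtain a b c where abc: "a \<noteq> 0 \<or> b \<noteq> 0 \<or> c \<noteq> 0"
    "a * fst (P g1) + b * fst (P g2) + c * fst (P g3) = 0"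
    "a * snd (P g1) + b * snd (P g2) + c * snd (P g3) = 0"
    using integer_relation[of "P g1" "P g2" "P g3"] by metis
  define g where "g r = a * g1 r + b * g2 r + c * g3 r" for r
  have ns: "nsum g n = 0" if "n \<in> nodes" for n
  proof -
    have "nsum g n = a * nsum g1 n + b * nsum g2 n + c * nsum g3 n"
      by (simp add: nsum_def g_def sum.distrib sum_distrib_left)
    then show ?thesis using assms[OF that] by simp
  qed
  have fl: "flux g x y = of_int a * flux g1 x y + of_int b * flux g2 x y + of_int c * flux g3 x y" for x y
    by (simp add: flux_def g_def sum.distrib sum_distrib_left algebra_simps)
  have "flux g x0 (x0 + 1) = of_int (a * fst (P g1) + b * fst (P g2) + c * fst (P g3))"
    "flux g x0 (x0 + \<i>) = of_int (a * snd (P g1) + b * snd (P g2) + c * snd (P g3))"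
    using P fl by (metis (no_types, lifting) of_int_add of_int_mult)+
  then have "flux g x0 (x0 + 1) = 0" "flux g x0 (x0 + \<i>) = 0" unfolding abc by simp_all
  then show ?thesis using potential_of_zero_periods[OF ns x0] abc(1) unfolding g_def by blast
qed

end

context dimer_geometry begin

subsection \<open>Jigsaw pieces\<close>

lemma torus_proj_skeleton: "torus_proj x \<in> torus_proj ` skeleton D \<longleftrightarrow> x \<in> skeleton D"
proof
  assume "torus_proj x \<in> torus_proj ` skeleton D"
  then obtain y where y: "y \<in> skeleton D" "torus_proj x = torus_proj y" by auto
  then have "y - x \<in> int_lattice" using torus_proj_eq_iff by simp
  then show "x \<in> skeleton D" using y(1) skeleton_translate[of "y - x" x] by simp
qed auto

lemma torus_proj_edge:
  assumes "e \<in> edges D" "torus_proj x \<in> edge_proj e"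
  shows "\<exists>e'\<in>edges D. edge_proj e' = edge_proj e \<and> x \<in> segment e'"
proof -
  obtain y where y: "y \<in> segment e" "torus_proj x = torus_proj y" using assms(2) by (auto simp: edge_proj_def)
  define z where "z = x - y"
  have z: "z \<in> int_lattice" using torus_proj_eq_iff[of y x] y(2) by (simp add: z_def)
  have "x = y + z" by (simp add: z_def)
  then have "x \<in> segment (fst e + z, snd e + z)" using y(1) by (simp add: segment_translate)
  moreover have "edge_proj (fst e + z, snd e + z) = edge_proj e"
    using edge_proj_eq_iff[OF assms(1) edge_translate[OF assms(1) z]] z by auto
  ultimately show ?thesis using edge_translate[OF assms(1) z] by blast
qed

lemma Im_eq_0_near_segment:
  fixes p q x y :: complex
  assumes "x \<in> open_segment p q"
  shows "\<exists>\<delta>>0. \<forall>y. dist y x < \<delta> \<longrightarrow> Im ((y - p) / (q - p)) = 0 \<longrightarrow> y \<in> closed_segment p q"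
proof -
  obtain s where s: "p \<noteq> q" "0 < s" "s < 1" "x = (1 - s) *\<^sub>R p + s *\<^sub>R q" using assms by (auto simp: in_segment)
  define L where "L = norm (q - p)"
  have L: "L > 0" using s(1) by (simp add: L_def)
  show ?thesis
  proof (intro exI[of _ "min s (1 - s) * L"] conjI allI impI)
    fix y assume y: "dist y x < min s (1 - s) * L" "Im ((y - p) / (q - p)) = 0"
    define t where "t = Re ((y - p) / (q - p))"
    have "(y - p) / (q - p) = of_real t" using y(2) by (simp add: t_def complex_eq_iff)
    then have yt: "y = p + of_real t * (q - p)" using s(1) by (simp add: field_simps)
    have "y - x = of_real (t - s) * (q - p)" using s(4) by (simp add: yt scaleR_conv_of_real algebra_simps)
    then have "dist y x = \<bar>t - s\<bar> * L" by (simp add: dist_norm norm_mult L_def del: of_real_diff)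
    then have "\<bar>t - s\<bar> < min s (1 - s)" using y(1) L by simp
    then have "0 \<le> t" "t \<le> 1" by auto
    then show "y \<in> closed_segment p q" unfolding yt by (rule point_in_closed_segment)
  qed (use s L in auto)
qed

text \<open>In the application \<open>P\<close> is the union of the zero sets of the two adjacent
  cones. By \<open>cover\<close> all nodes are removed with \<open>P\<close>, so a piece passes from
  tile to tile only through inner points of edges outside \<open>P\<close>.\<close>

context
  fixes P :: "torus_edge set"
  assumes P: "P \<subseteq> arcs Q" and cover: "\<And>n. n \<in> nodes \<Longrightarrow> \<exists>e\<in>edges_at D n. edge_proj e \<in> P"
begin

lemma Union_P_skeleton: "\<Union>P \<subseteq> torus_proj ` skeleton D"
  using P unfolding arcs_Q edge_proj_def skeleton_eq by blast

lemma tile_image: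
  assumes "i \<in> verts Q"
  shows "openin (top_of_set torus) i" "connected i" "i \<noteq> {}" "i \<subseteq> torus - \<Union>P"
proof -
  obtain C where C: "C \<in> lifted_tiles D" "i = torus_proj ` C" using assms unfolding verts_Q by blast
  show "openin (top_of_set torus) i" unfolding C(2) by (rule openin_torus_proj_image[OF tile_open[OF C(1)]])
  show "connected i" unfolding C(2)
    by (rule connected_continuous_image[OF continuous_on_torus_proj tile_connected[OF C(1)]])
  show "i \<noteq> {}" using tile_nonempty[OF C(1)] C(2) by blast
  show "i \<subseteq> torus - \<Union>P"
    using Union_P_skeleton torus_proj_skeleton tile_disjoint_skeleton[OF C(1)] torus_proj_in_torus
    unfolding C(2) by blast
qed

text \<open>Jigsaw pieces are closures, while connectedness is used for the components themselves.
  The image of a tile is open in the torus, so lying in the closure forces it to meet the component,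
  and being connected it lies inside.\<close>

lemma tile_in_closure_piece:
  assumes "i \<in> verts Q" "K \<in> components (torus - \<Union>P)" "i \<subseteq> closure K"
  shows "i \<subseteq> K"
proof -
  obtain U where U: "open U" "i = torus \<inter> U" using tile_image(1)[OF assms(1)] by (auto simp: openin_open)
  have "U \<inter> closure K \<noteq> {}" using tile_image(3)[OF assms(1)] U(2) assms(3) by blast
  then have "U \<inter> K \<noteq> {}" using open_Int_closure_eq_empty[OF U(1)] by blast
  moreover have "K \<subseteq> torus" using in_components_subset[OF assms(2)] by blast
  ultimately have "K \<inter> i \<noteq> {}" using U(2) by blast
  then show ?thesis using components_maximal[OF assms(2) tile_image(2)[OF assms(1)] tile_image(4)[OF assms(1)]] by blast
qed

context
  fixes i0 :: torus_tile and J :: "(complex \<times> complex) set"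
  assumes i0: "i0 \<in> verts Q"
    and J_def: "J = (THE J. J \<in> closure ` components (torus - \<Union>P) \<and> i0 \<subseteq> J)"
begin

lemma piece_exists: "\<exists>K. K \<in> components (torus - \<Union>P) \<and> (\<forall>i\<in>verts Q. i \<subseteq> J \<longleftrightarrow> i \<subseteq> K) \<and> i0 \<subseteq> K"
proof -
  obtain K where K: "K \<in> components (torus - \<Union>P)" "i0 \<subseteq> K"
    using exists_component_superset[OF tile_image(4)[OF i0] _ tile_image(2)[OF i0]] tile_image(3,4)[OF i0] by blast
  have "J = closure K"
    unfolding J_def
  proof (rule the_equality)
    show "closure K \<in> closure ` components (torus - \<Union>P) \<and> i0 \<subseteq> closure K"
      using K closure_subset by blast
    fix J' assume "J' \<in> closure ` components (torus - \<Union>P) \<and> i0 \<subseteq> J'"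
    then obtain K' where K': "K' \<in> components (torus - \<Union>P)" "J' = closure K'" "i0 \<subseteq> closure K'" by blast
    then have "i0 \<subseteq> K'" using tile_in_closure_piece[OF i0] by blast
    then have "K' = K" using components_eq[OF K'(1) K(1)] K(2) tile_image(3)[OF i0] by blast
    then show "J' = closure K" using K'(2) by simp
  qed
  then show ?thesis using K tile_in_closure_piece closure_subset by blast
qed

lemma zero_tile_in_piece: "i0 \<subseteq> J"
  using piece_exists i0 by blast

text \<open>The two tiles beside the edge, joined by its midpoint, form a connected set
  \<open>W\<close> whose image avoids \<open>P\<close>.\<close>

lemma arc_in_piece:
  assumes "a \<in> arcs Q - P"
  shows "head Q a \<subseteq> J \<longleftrightarrow> tail Q a \<subseteq> J"
proof -
  obtain K where K: "K \<in> components (torus - \<Union>P)" "\<And>i. i \<in> verts Q \<Longrightarrow> i \<subseteq> J \<longleftrightarrow> i \<subseteq> K"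
    using piece_exists by metis
  obtain e where e: "e \<in> edges D" "a = edge_proj e" using assms unfolding arcs_Q by blast
  define p q where "p = fst e" and "q = snd e"
  have adj: "adj p q" "adj q p" using edge_adj[OF e(1)] by (auto simp: p_def q_def)
  define m where "m = midpoint p q"
  have m: "m \<in> open_segment p q" "m \<in> open_segment q p"
    using adj_neq[OF adj(1)] by (simp_all add: m_def open_segment_commute[of q p])
  have cl: "m \<in> closure (side p' q')" if pq: "adj p' q'" "m \<in> open_segment p' q'" for p' q'
  proof -
    obtain \<delta> where d: "\<delta> > 0" "\<And>y. dist y m < \<delta> \<and> Im ((y - p') / (q' - p')) > 0 \<Longrightarrow> y \<in> side p' q'"
      using side_properties(2)[OF pq] by blast
    have nz: "q' - p' \<noteq> 0" using adj_neq[OF pq(1)] by simp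
    have m0: "Im ((m - p') / (q' - p')) = 0" using Im_segment_eq_0 pq(2) open_closed_segment by metis
    show ?thesis unfolding closure_approachable
    proof (intro allI impI)
      fix \<epsilon> :: real assume "\<epsilon> > 0"
      define t where "t = min \<delta> \<epsilon> / (2 * norm (q' - p'))"
      define y where "y = m + of_real t * \<i> * (q' - p')"
      have t: "t > 0" "t * norm (q' - p') < \<delta>" "t * norm (q' - p') < \<epsilon>"
        using nz d(1) \<open>\<epsilon> > 0\<close> by (auto simp: t_def min_def)
      have "dist y m = t * norm (q' - p')" using t(1) by (simp add: y_def dist_norm norm_mult)
      moreover have "(y - p') / (q' - p') = (m - p') / (q' - p') + of_real t * \<i>"
        using nz by (simp add: y_def field_simps)
      then have "Im ((y - p') / (q' - p')) > 0" using m0 t(1) by simp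
      ultimately show "\<exists>y\<in>side p' q'. dist y m < \<epsilon>" using d(2)[of y] t by (intro bexI[of _ y]) auto
    qed
  qed
  define W where "W = insert m (side p q) \<union> insert m (side q p)"
  have ins: "connected (insert m C)" if "connected C" "m \<in> closure C" for C
    by (rule connected_intermediate_closure[OF that(1)]) (use that(2) closure_subset[of C] in auto)
  have "connected W"
    unfolding W_def using cl adj m tile_connected side_properties(1)
    by (intro connected_Un ins) auto
  then have "connected (torus_proj ` W)" by (rule connected_continuous_image[OF continuous_on_torus_proj])
  have mP: "torus_proj m \<notin> \<Union>P"
  proof
    assume "torus_proj m \<in> \<Union>P"
    then obtain e' where e': "e' \<in> edges D" "edge_proj e' \<in> P" "torus_proj m \<in> edge_proj e'"
      using P unfolding arcs_Q by blast
    then obtain e'' where e'': "e'' \<in> edges D" "edge_proj e'' = edge_proj e'" "m \<in> segment e''"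
      using torus_proj_edge by blast
    then have "e = e''" using edge_eq_of_common_point[OF e(1) e''(1)] m(1) by (simp add: p_def q_def)
    then show False using e'' e' assms e(2) by simp
  qed
  have ends: "head Q a = torus_proj ` side q p" "tail Q a = torus_proj ` side p q"
    using head_edge[OF e(1)] tail_edge[OF e(1)] e(2) by (simp_all add: p_def q_def)
  have V: "head Q a \<in> verts Q" "tail Q a \<in> verts Q" using assms head_in_verts tail_in_verts by auto
  have "torus_proj ` W = insert (torus_proj m) (head Q a \<union> tail Q a)"
    unfolding W_def ends by blast
  then have "torus_proj ` W \<subseteq> torus - \<Union>P"
    using mP torus_proj_in_torus[of m] tile_image(4)[OF V(1)] tile_image(4)[OF V(2)] by simp
  then have "K \<inter> torus_proj ` W \<noteq> {} \<Longrightarrow> torus_proj ` W \<subseteq> K"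
    using components_maximal[OF K(1) \<open>connected (torus_proj ` W)\<close>] by blast
  moreover have "head Q a \<subseteq> torus_proj ` W" "tail Q a \<subseteq> torus_proj ` W" unfolding W_def ends by blast+
  ultimately have "head Q a \<subseteq> K \<longleftrightarrow> tail Q a \<subseteq> K"
    using tile_image(3)[OF V(1)] tile_image(3)[OF V(2)] by blast
  then show ?thesis using K(2) V by blast
qed

text \<open>Off \<open>P\<close> the function extends to a locally constant one: \<open>U r\<close>
  consists of the points around which all tiles carry the value \<open>r\<close>. The images
  \<open>V r\<close> are open, pairwise disjoint and cover the component \<open>K\<close>, so
  connectedness of \<open>K\<close> leaves one value.\<close>

lemma constant_on_piece:
  fixes f :: "torus_tile \<Rightarrow> 'b"
  assumes f: "\<And>a. a \<in> arcs Q - P \<Longrightarrow> f (head Q a) = f (tail Q a)"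
    and i: "i \<in> verts Q" "i \<subseteq> J"
  shows "f i = f i0"
proof -
  obtain K where K: "K \<in> components (torus - \<Union>P)" "i0 \<subseteq> K" "i \<subseteq> K"
    using piece_exists i by metis
  define M where "M x = f (torus_proj ` tile_of x)" for x
  define U where "U r = {x. \<exists>\<epsilon>>0. \<forall>y\<in>ball x \<epsilon> - skeleton D. M y = r}" for r
  define V where "V r = torus_proj ` U r" for r
  have "open (U r)" for r
    unfolding open_contains_ball
  proof
    fix x assume "x \<in> U r"
    then obtain \<epsilon> where e: "\<epsilon> > 0" "\<And>y. y \<in> ball x \<epsilon> - skeleton D \<Longrightarrow> M y = r" unfolding U_def by blast
    have "ball x (\<epsilon> / 2) \<subseteq> U r"
    proof
      fix x' assume "x' \<in> ball x (\<epsilon> / 2)"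
      then have "ball x' (\<epsilon> / 2) \<subseteq> ball x \<epsilon>" by (simp add: ball_subset_ball_iff dist_commute)
      then show "x' \<in> U r" using e unfolding U_def by (auto intro!: exI[of _ "\<epsilon> / 2"])
    qed
    then show "\<exists>e>0. ball x e \<subseteq> U r" using e(1) half_gt_zero by blast
  qed
  then have V: "openin (top_of_set torus) (V r)" for r unfolding V_def by (rule openin_torus_proj_image)
  have Mtile: "x \<in> U (f (torus_proj ` C))" if C: "C \<in> lifted_tiles D" "x \<in> C" for x C
  proof -
    obtain \<epsilon> where "\<epsilon> > 0" "ball x \<epsilon> \<subseteq> C" using tile_open[OF C(1)] C(2) open_contains_ball by blast
    then show ?thesis using tile_eq[OF C(1)] unfolding U_def M_def by blast
  qed
  \<comment> \<open>The point is no node by \<open>cover\<close>. If it is an inner point of an edge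
    outside \<open>P\<close>, then by \<open>f\<close> both sides of this edge carry the same value,
    and near the point there are no other tiles.\<close>
  have cov: "\<exists>r. x \<in> U r" if x: "torus_proj x \<notin> \<Union>P" for x
  proof (cases "x \<in> skeleton D")
    case False
    then show ?thesis using Mtile tile_of_tile tile_of_mem by blast
  next
    case True
    have "x \<notin> nodes"
    proof
      assume n: "x \<in> nodes"
      then obtain e where e: "e \<in> edges_at D x" "edge_proj e \<in> P" using cover by blast
      then have "x \<in> segment e" by (auto simp: edges_at_def segment_def)
      then show False using e(2) x unfolding edge_proj_def by blast
    qed
    then obtain e where e: "e \<in> edges D" "x \<in> segment e" using True unfolding skeleton_eq by blast
    define p q where "p = fst e" and "q = snd e"
    have adj: "adj p q" "adj q p" using edge_adj[OF e(1)] by (auto simp: p_def q_def)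
    have xs: "x \<in> open_segment p q" "x \<in> open_segment q p"
      using e \<open>x \<notin> nodes\<close> edge_ends[OF e(1)] unfolding segment_def open_segment_def p_def q_def
      by (auto simp: closed_segment_commute)
    have "torus_proj x \<in> edge_proj e" using e(2) by (simp add: edge_proj_def)
    then have "edge_proj e \<in> arcs Q - P" using x e(1) by (auto simp: arcs_Q)
    then have feq: "f (torus_proj ` side q p) = f (torus_proj ` side p q)"
      using f head_edge[OF e(1)] tail_edge[OF e(1)] by (metis p_def q_def)
    obtain \<delta> where d: "\<delta> > 0" "\<And>y. dist y x < \<delta> \<and> Im ((y - p) / (q - p)) > 0 \<Longrightarrow> y \<in> side p q"
      using side_properties(2)[OF adj(1) xs(1)] by blast
    obtain \<delta>' where d': "\<delta>' > 0" "\<And>y. dist y x < \<delta>' \<and> Im ((y - q) / (p - q)) > 0 \<Longrightarrow> y \<in> side q p"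
      using side_properties(2)[OF adj(2) xs(2)] by blast
    obtain \<delta>'' where d'': "\<delta>'' > 0" "\<And>y. dist y x < \<delta>'' \<Longrightarrow> Im ((y - p) / (q - p)) = 0 \<Longrightarrow> y \<in> closed_segment p q"
      using Im_eq_0_near_segment[OF xs(1)] by blast
    have "M y = f (torus_proj ` side p q)" if y: "y \<in> ball x (min \<delta> (min \<delta>' \<delta>'')) - skeleton D" for y
    proof -
      have dy: "dist y x < \<delta>" "dist y x < \<delta>'" "dist y x < \<delta>''" using y by (auto simp: dist_commute)
      have "closed_segment p q \<subseteq> skeleton D" using e(1) unfolding skeleton_eq segment_def p_def q_def by blast
      then have "Im ((y - p) / (q - p)) \<noteq> 0" using d''(2)[OF dy(3)] y by blast
      then have "y \<in> side p q \<or> y \<in> side q p"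
        using d(2)[of y] d'(2)[of y] dy Im_side_flip[OF adj_neq[OF adj(1)], of y]
        by (cases "Im ((y - p) / (q - p)) > 0") auto
      then have "tile_of y = side p q \<or> tile_of y = side q p"
        using tile_eq side_properties(1) adj by metis
      then show ?thesis using feq unfolding M_def by metis
    qed
    then show ?thesis using d(1) d'(1) d''(1) unfolding U_def
      by (intro exI[of _ "f (torus_proj ` side p q)"] CollectI exI[of _ "min \<delta> (min \<delta>' \<delta>'')"]) simp
  qed
  \<comment> \<open>Two lifts of \<open>t\<close> differ by a lattice vector; a common nearby point
    off the skeleton compares the two values.\<close>
  have disj: "r = r'" if V: "t \<in> V r" "t \<in> V r'" for t r r'
  proof -
    obtain x x' where x: "x \<in> U r" "x' \<in> U r'" "t = torus_proj x" "t = torus_proj x'" using V unfolding V_def by blast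
    define z where "z = x' - x"
    have z: "z \<in> int_lattice" "x' = x + z" using x(3,4) torus_proj_eq_iff[of x x'] by (auto simp: z_def)
    obtain \<epsilon> where e: "\<epsilon> > 0" "\<And>y. y \<in> ball x \<epsilon> - skeleton D \<Longrightarrow> M y = r" using x(1) unfolding U_def by blast
    obtain \<epsilon>' where e': "\<epsilon>' > 0" "\<And>y. y \<in> ball x' \<epsilon>' - skeleton D \<Longrightarrow> M y = r'" using x(2) unfolding U_def by blast
    obtain y where y: "y \<in> ball x (min \<epsilon> \<epsilon>')" "y \<notin> skeleton D"
      using nonskeleton_point[of "ball x (min \<epsilon> \<epsilon>')"] e(1) e'(1) by (metis ball_eq_empty min_less_iff_conj not_le open_ball)
    have "M y = r" using e(2)[of y] y by simp
    moreover have "M (y + z) = r'"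
      using e'(2)[of "y + z"] y skeleton_translate[OF z(1), of y] by (simp add: z(2))
    moreover have "M (y + z) = M y"
      unfolding M_def tile_of_translate[OF y(2) z(1)] torus_proj_image_translate[OF z(1)] ..
    ultimately show ?thesis by simp
  qed
  have tileV: "\<exists>t\<in>K. t \<in> V (f j)" if j: "j \<in> verts Q" "j \<subseteq> K" for j
  proof -
    obtain C where C: "C \<in> lifted_tiles D" "j = torus_proj ` C" using j(1) unfolding verts_Q by blast
    obtain x where x: "x \<in> C" using tile_nonempty[OF C(1)] by blast
    have "torus_proj x \<in> V (f j)" using Mtile[OF C(1) x] unfolding V_def C(2) by blast
    moreover have "torus_proj x \<in> K" using j(2) C(2) x by blast
    ultimately show ?thesis by blast
  qed
  have Ksub: "K \<subseteq> torus" "K \<inter> \<Union>P = {}" using in_components_subset[OF K(1)] by auto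
  have KV: "\<exists>r. t \<in> V r" if t: "t \<in> K" for t
  proof -
    obtain x where "t = torus_proj x" using torus_proj_surj t Ksub(1) by blast
    then show ?thesis using cov[of x] t Ksub(2) unfolding V_def by blast
  qed
  define V' where "V' = (\<Union>r\<in>{r. r \<noteq> f i0}. V r)"
  have "openin (top_of_set torus) V'" unfolding V'_def using V by blast
  have opK: "openin (top_of_set K) (K \<inter> B)" if B: "openin (top_of_set torus) B" for B
  proof -
    obtain T where "open T" "B = torus \<inter> T" using B by (auto simp: openin_open)
    then have "K \<inter> B = K \<inter> T" "open T" using Ksub(1) by auto
    then show ?thesis by (simp add: openin_open_Int)
  qed
  have "K \<inter> V' = {}"
  proof (rule ccontr)
    assume "K \<inter> V' \<noteq> {}"
    moreover have "K \<inter> V (f i0) \<noteq> {}" using tileV[OF i0 K(2)] by blast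
    moreover have "K \<subseteq> (K \<inter> V (f i0)) \<union> (K \<inter> V')"
    proof
      fix t assume t: "t \<in> K"
      then obtain r where "t \<in> V r" using KV by blast
      then show "t \<in> (K \<inter> V (f i0)) \<union> (K \<inter> V')" using t unfolding V'_def by (cases "r = f i0") auto
    qed
    moreover have "(K \<inter> V (f i0)) \<inter> (K \<inter> V') = {}" using disj unfolding V'_def by blast
    ultimately have "\<not> connected K"
      unfolding connected_openin using opK[OF V[of "f i0"]] opK[OF \<open>openin (top_of_set torus) V'\<close>] by blast
    then show False using in_components_connected[OF K(1)] by blast
  qed
  then show ?thesis using tileV[OF i(1) K(3)] unfolding V'_def by blast
qed

end

end

end

subsection \<open>Matchings in regular weighted bipartite graphs\<close>

text \<open>Induction on the size of \<open>I\<close>. If some nonempty proper subset is tight, it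
  and its complement, with the neighbours of the subset removed, are matched separately. Otherwise
  every proper subset has a neighbour to spare, so one element can be matched arbitrarily.\<close>

lemma hall:
  fixes N :: "'a \<Rightarrow> 'b set"
  assumes "finite I" "\<And>i. i \<in> I \<Longrightarrow> finite (N i)" "\<And>J. J \<subseteq> I \<Longrightarrow> card J \<le> card (\<Union>(N ` J))"
  shows "\<exists>f. inj_on f I \<and> (\<forall>i\<in>I. f i \<in> N i)"
  using assms
proof (induction "card I" arbitrary: I N rule: less_induct)
  case less
  note fin = \<open>finite I\<close> and finN = less.prems(2) and hall = less.prems(3)
  show ?case
  proof (cases "I = {}")
    case False
    then obtain i where i: "i \<in> I" by blast
    show ?thesis
    proof (cases "\<exists>J. J \<noteq> {} \<and> J \<subset> I \<and> card J = card (\<Union>(N ` J))")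
      case True
      then obtain J where J: "J \<noteq> {}" "J \<subset> I" "card J = card (\<Union>(N ` J))" by blast
      have finJ: "finite J" using J fin finite_subset by auto
      have cJ: "card J < card I" using J(2) fin psubset_card_mono by blast
      have cIJ: "card (I - J) < card I" using J fin by (intro psubset_card_mono) auto
      define X where "X = \<Union>(N ` J)"
      have finX: "finite X" unfolding X_def using finJ finN J(2) by blast
      obtain f where f: "inj_on f J" "\<forall>i\<in>J. f i \<in> N i"
        using less.hyps[OF cJ finJ, of N] finN hall J(2) by (metis psubset_imp_subset subset_iff subset_trans)
      have "\<exists>g. inj_on g (I - J) \<and> (\<forall>i\<in>I - J. g i \<in> N i - X)"
      proof (rule less.hyps[OF cIJ])
        fix J' assume J': "J' \<subseteq> I - J"
        have finJ': "finite J'" using J' fin finite_subset by blast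
        have "card (J \<union> J') \<le> card (\<Union>(N ` (J \<union> J')))" using hall[of "J \<union> J'"] J J' by blast
        also have "\<Union>(N ` (J \<union> J')) = X \<union> \<Union>((\<lambda>i. N i - X) ` J')" unfolding X_def by auto
        also have "card \<dots> \<le> card X + card (\<Union>((\<lambda>i. N i - X) ` J'))" by (rule card_Un_le)
        finally have "card (J \<union> J') \<le> card X + card (\<Union>((\<lambda>i. N i - X) ` J'))" .
        moreover have "card (J \<union> J') = card J + card J'" using finJ finJ' J' by (intro card_Un_disjoint) auto
        ultimately show "card J' \<le> card (\<Union>((\<lambda>i. N i - X) ` J'))" using J(3) X_def by simp
      qed (use fin finN in auto)
      then obtain g where g: "inj_on g (I - J)" "\<forall>i\<in>I - J. g i \<in> N i - X" by blast
      define h where "h i = (if i \<in> J then f i else g i)" for i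
      have "f i \<in> X" if "i \<in> J" for i using f(2) that unfolding X_def by blast
      then have "inj_on h I" using f(1) g unfolding h_def inj_on_def by (metis Diff_iff)
      moreover have "\<forall>i\<in>I. h i \<in> N i" using f(2) g(2) by (auto simp: h_def)
      ultimately show ?thesis by blast
    next
      case noTight: False
      have "card {i} \<le> card (N i)" using hall[of "{i}"] i by simp
      then obtain x where x: "x \<in> N i" by fastforce
      have c: "card (I - {i}) < card I" using i fin by (intro psubset_card_mono) auto
      have "\<exists>g. inj_on g (I - {i}) \<and> (\<forall>j\<in>I - {i}. g j \<in> N j - {x})"
      proof (rule less.hyps[OF c])
        fix J assume J: "J \<subseteq> I - {i}"
        show "card J \<le> card (\<Union>((\<lambda>j. N j - {x}) ` J))"
        proof (cases "J = {}")
          case False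
          have "J \<subset> I" using J i by blast
          then have "card J < card (\<Union>(N ` J))" using noTight hall[of J] False by (meson le_neq_implies_less psubsetE)
          moreover have "(\<Union>((\<lambda>j. N j - {x}) ` J)) = (\<Union>(N ` J)) - {x}" by auto
          moreover have "card (\<Union>(N ` J)) - 1 \<le> card ((\<Union>(N ` J)) - {x})" by (simp add: card_Diff_singleton_if)
          ultimately show ?thesis by simp
        qed simp
      qed (use fin finN in auto)
      then obtain g where g: "inj_on g (I - {i})" "\<forall>j\<in>I - {i}. g j \<in> N j - {x}" by blast
      have "inj_on (g(i := x)) I" using g unfolding inj_on_def by auto
      moreover have "\<forall>j\<in>I. (g(i := x)) j \<in> N j" using g(2) x by auto
      ultimately show ?thesis by blast
    qed
  qed auto
qed

text \<open>\<open>A\<close> is the edge set of a bipartite graph and \<open>p\<close> maps an edge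
  to its end of one colour; the vertices of that colour are the image of \<open>p\<close>.\<close>

definition matching_on :: "'a set \<Rightarrow> ('a \<Rightarrow> 'c) \<Rightarrow> 'a set \<Rightarrow> bool" where
  "matching_on A p M \<longleftrightarrow> M \<subseteq> A \<and> (\<forall>x\<in>p ` A. \<exists>!a. a \<in> M \<and> p a = x)"

text \<open>Hall's condition by double counting: the edges at \<open>J\<close> have weight
  \<open>card J * h\<close>, and those of positive weight end in the neighbours of \<open>J\<close>,
  which offer \<open>h\<close> each. Counting the whole weight from both sides shows that the colour
  classes have equal size, so the matching covers both.\<close>

lemma regular_matching:
  fixes wt :: "'a \<Rightarrow> 'c" and bt :: "'a \<Rightarrow> 'd" and k :: "'a \<Rightarrow> nat"
  assumes fin: "finite A" and h: "h > 0"
    and W: "\<And>x. x \<in> wt ` A \<Longrightarrow> (\<Sum>a\<in>{a \<in> A. wt a = x}. k a) = h"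
    and B: "\<And>x. x \<in> bt ` A \<Longrightarrow> (\<Sum>a\<in>{a \<in> A. bt a = x}. k a) = h"
  shows "\<exists>M. M \<subseteq> {a \<in> A. k a > 0} \<and> matching_on A wt M \<and> matching_on A bt M"
proof -
  define N where "N x = bt ` {a \<in> A. k a > 0 \<and> wt a = x}" for x
  have "\<exists>f. inj_on f (wt ` A) \<and> (\<forall>x\<in>wt ` A. f x \<in> N x)"
  proof (rule hall)
    fix J assume J: "J \<subseteq> wt ` A"
    have finJ: "finite J" using J fin finite_subset by blast
    define NJ where "NJ = \<Union>(N ` J)"
    have NJ: "NJ \<subseteq> bt ` A" unfolding NJ_def N_def by blast
    have finNJ: "finite NJ" using NJ fin finite_subset by blast
    have "card J * h = (\<Sum>x\<in>J. \<Sum>a\<in>{a \<in> A. wt a = x}. k a)" using J W by (simp add: subset_iff)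
    also have "\<dots> = (\<Sum>x\<in>J. \<Sum>a\<in>{a \<in> {a \<in> A. wt a \<in> J}. wt a = x}. k a)" by (intro sum.cong) auto
    also have "\<dots> = (\<Sum>a\<in>{a \<in> A. wt a \<in> J}. k a)" using fin finJ by (intro sum.group) auto
    also have "\<dots> = (\<Sum>a\<in>{a \<in> A. wt a \<in> J \<and> k a > 0}. k a)" using fin by (intro sum.mono_neutral_right) auto
    also have "\<dots> \<le> (\<Sum>a\<in>{a \<in> A. bt a \<in> NJ}. k a)"
      using fin by (intro sum_mono2) (auto simp: NJ_def N_def)
    also have "\<dots> = (\<Sum>x\<in>NJ. \<Sum>a\<in>{a \<in> {a \<in> A. bt a \<in> NJ}. bt a = x}. k a)"
      using fin finNJ by (intro sum.group[symmetric]) auto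
    also have "\<dots> = (\<Sum>x\<in>NJ. \<Sum>a\<in>{a \<in> A. bt a = x}. k a)" by (intro sum.cong) auto
    also have "\<dots> = card NJ * h" using NJ B by (simp add: subset_iff)
    finally show "card J \<le> card (\<Union>(N ` J))" using h unfolding NJ_def by simp
  qed (use fin in \<open>auto simp: N_def\<close>)
  then obtain f where f: "inj_on f (wt ` A)" "\<And>x. x \<in> wt ` A \<Longrightarrow> f x \<in> N x" by blast
  have "\<exists>s. \<forall>x\<in>wt ` A. s x \<in> A \<and> k (s x) > 0 \<and> wt (s x) = x \<and> bt (s x) = f x"
    by (rule bchoice) (use f(2) in \<open>fastforce simp: N_def\<close>)
  then obtain s where s: "\<And>x. x \<in> wt ` A \<Longrightarrow> s x \<in> A \<and> k (s x) > 0 \<and> wt (s x) = x \<and> bt (s x) = f x" by blast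
  define M where "M = s ` wt ` A"
  have MA: "M \<subseteq> {a \<in> A. k a > 0}" unfolding M_def using s by auto
  have "card (wt ` A) * h = sum k A"
  proof -
    have "card (wt ` A) * h = (\<Sum>x\<in>wt ` A. \<Sum>a\<in>{a \<in> A. wt a = x}. k a)" using W by simp
    also have "\<dots> = sum k A" using fin by (intro sum.group) auto
    finally show ?thesis .
  qed
  moreover have "card (bt ` A) * h = sum k A"
  proof -
    have "card (bt ` A) * h = (\<Sum>x\<in>bt ` A. \<Sum>a\<in>{a \<in> A. bt a = x}. k a)" using B by simp
    also have "\<dots> = sum k A" using fin by (intro sum.group) auto
    finally show ?thesis .
  qed
  ultimately have "card (wt ` A) = card (bt ` A)" using h by (metis mult_right_cancel not_gr0)
  moreover have "f ` wt ` A \<subseteq> bt ` A" using s by (metis image_subsetI imageI)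
  ultimately have fim: "f ` wt ` A = bt ` A"
    using card_subset_eq[of "bt ` A" "f ` wt ` A"] fin card_image[OF f(1)] by simp
  have "matching_on A wt M"
    unfolding matching_on_def using MA s by (auto simp: M_def)
  moreover have "matching_on A bt M"
    unfolding matching_on_def
  proof (intro conjI ballI)
    fix y assume "y \<in> bt ` A"
    then obtain x where x: "x \<in> wt ` A" "y = f x" using fim by blast
    show "\<exists>!a. a \<in> M \<and> bt a = y"
    proof (rule ex1I[of _ "s x"])
      show "s x \<in> M \<and> bt (s x) = y" using x s by (auto simp: M_def)
      fix a assume a: "a \<in> M \<and> bt a = y"
      then obtain x' where x': "x' \<in> wt ` A" "a = s x'" by (auto simp: M_def)
      then have "f x' = f x" using a x s by metis
      then show "a = s x" using f(1) x x' by (auto dest: inj_onD)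
    qed
  qed (use MA in auto)
  ultimately show ?thesis using MA by blast
qed

lemma sum_matching_on:
  assumes "finite A" "matching_on A p M" "x \<in> p ` A"
  shows "(\<Sum>a\<in>{a \<in> A. p a = x}. if a \<in> M then 1 else 0 :: 'n::comm_semiring_1) = 1"
proof -
  obtain a where a: "a \<in> M" "p a = x" "\<And>b. b \<in> M \<Longrightarrow> p b = x \<Longrightarrow> b = a"
    using assms(2,3) unfolding matching_on_def by metis
  have "(\<Sum>b\<in>{b \<in> A. p b = x}. if b \<in> M then 1 else 0 :: 'n) = (\<Sum>b\<in>{b \<in> A. p b = x}. if b = a then 1 else 0)"
  proof (rule sum.cong[OF refl])
    fix b assume "b \<in> {b \<in> A. p b = x}"
    then have "b \<in> M \<longleftrightarrow> b = a" using a by blast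
    then show "(if b \<in> M then 1 else 0 :: 'n) = (if b = a then 1 else 0)" by simp
  qed
  also have "\<dots> = 1"
  proof -
    have "a \<in> A" using assms(2) a(1) unfolding matching_on_def by blast
    then show ?thesis using sum.delta[of "{b \<in> A. p b = x}" a "\<lambda>_. 1 :: 'n"] assms(1) a(2) by simp
  qed
  finally show ?thesis .
qed

text \<open>Removing a matching from the weights keeps them regular, with \<open>h\<close> lowered
  by one. As long as the matchings miss \<open>c\<close>, its weight stays positive, which is
  impossible once \<open>h\<close> is zero.\<close>

lemma regular_matching_through:
  fixes wt :: "'a \<Rightarrow> 'c" and bt :: "'a \<Rightarrow> 'd" and k :: "'a \<Rightarrow> nat"
  assumes fin: "finite A"
    and "\<And>x. x \<in> wt ` A \<Longrightarrow> (\<Sum>a\<in>{a \<in> A. wt a = x}. k a) = h"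
    and "\<And>x. x \<in> bt ` A \<Longrightarrow> (\<Sum>a\<in>{a \<in> A. bt a = x}. k a) = h"
    and "c \<in> A" "k c > 0"
  shows "\<exists>M. c \<in> M \<and> M \<subseteq> {a \<in> A. k a > 0} \<and> matching_on A wt M \<and> matching_on A bt M"
  using assms(2-)
proof (induction h arbitrary: k)
  case 0
  have "(\<Sum>a\<in>{a \<in> A. wt a = wt c}. k a) = 0" using 0 by simp
  then have "k c = 0" using fin 0(3) by simp
  then show ?case using 0(4) by simp
next
  case (Suc h)
  obtain M where M: "M \<subseteq> {a \<in> A. k a > 0}" "matching_on A wt M" "matching_on A bt M"
    using regular_matching[of A "Suc h" wt k bt] fin Suc.prems by blast
  show ?case
  proof (cases "c \<in> M")
    case False
    define k' where "k' a = k a - (if a \<in> M then 1 else 0)" for a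
    have dec: "(\<Sum>a\<in>{a \<in> A. p a = x}. k' a) = h"
      if "matching_on A p M" "x \<in> p ` A" "(\<Sum>a\<in>{a \<in> A. p a = x}. k a) = Suc h" for p :: "'a \<Rightarrow> 'e" and x
    proof -
      have "(\<Sum>a\<in>{a \<in> A. p a = x}. k' a) + (\<Sum>a\<in>{a \<in> A. p a = x}. if a \<in> M then 1 else 0) = (\<Sum>a\<in>{a \<in> A. p a = x}. k a)"
        unfolding sum.distrib[symmetric] k'_def using M(1) by (intro sum.cong) auto
      then show ?thesis using sum_matching_on[OF fin that(1,2), where 'n = nat] that(3) by simp
    qed
    have "\<exists>M. c \<in> M \<and> M \<subseteq> {a \<in> A. k' a > 0} \<and> matching_on A wt M \<and> matching_on A bt M"
      using Suc.IH[of k'] dec[OF M(2)] dec[OF M(3)] Suc.prems False by (simp add: k'_def)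
    then show ?thesis unfolding k'_def by fastforce
  qed (use M in blast)
qed

context dimer_geometry begin

subsection \<open>Isomorphisms and stability\<close>

lemma cas_snoc: "pre_digraph.cas Q u p (tail Q a) \<Longrightarrow> pre_digraph.cas Q u (p @ [a]) (head Q a)"
  by (induction p arbitrary: u) (auto simp: pre_digraph.cas.simps)

lemma cas_snocD: "pre_digraph.cas Q u (p @ [a]) v \<Longrightarrow> pre_digraph.cas Q u p (tail Q a) \<and> v = head Q a"
  by (induction p arbitrary: u) (auto simp: pre_digraph.cas.simps)

definition \<delta> :: "(torus_tile \<Rightarrow> 'b::group_add) \<Rightarrow> torus_edge \<Rightarrow> 'b" where
  "\<delta> m a = m (head Q a) - m (tail Q a)"

lemma cas_sum:
  fixes m :: "torus_tile \<Rightarrow> 'b::ab_group_add"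
  shows "pre_digraph.cas Q u p v \<Longrightarrow> sum_list (map (\<delta> m) p) = m v - m u"
  by (induction p arbitrary: u) (auto simp: pre_digraph.cas.simps \<delta>_def)

definition walk :: "torus_edge set \<Rightarrow> torus_tile \<Rightarrow> torus_edge list \<Rightarrow> torus_tile \<Rightarrow> bool" where
  "walk Z u p v \<longleftrightarrow> pre_digraph.cas Q u p v \<and> set p \<subseteq> arcs Q - Z"

lemma walk_snoc: "walk Z u p (tail Q a) \<Longrightarrow> a \<in> arcs Q - Z \<Longrightarrow> walk Z u (p @ [a]) (head Q a)"
  by (simp add: walk_def cas_snoc)

lemma walk_mono: "walk Z u p v \<Longrightarrow> Z' \<subseteq> Z \<Longrightarrow> walk Z' u p v"
  by (auto simp: walk_def)

lemma walk_sum_eq_0: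
  fixes f :: "torus_edge \<Rightarrow> 'b::comm_monoid_add"
  shows "walk Z u p v \<Longrightarrow> (\<And>a. a \<in> arcs Q - Z \<Longrightarrow> f a = 0) \<Longrightarrow> sum_list (map f p) = 0"
proof -
  assume "walk Z u p v" and f: "\<And>a. a \<in> arcs Q - Z \<Longrightarrow> f a = 0"
  then have "map f p = map (\<lambda>_. 0) p" unfolding walk_def by auto
  then show ?thesis by (simp only: sum_list_0)
qed

definition gauge :: "(torus_tile \<Rightarrow> complex) \<Rightarrow> (torus_edge \<Rightarrow> complex) \<Rightarrow> torus_edge \<Rightarrow> complex" where
  "gauge g v a = (if a \<in> arcs Q then g (head Q a) * v a / g (tail Q a) else 0)"

lemma iso_class_gauge: "iso_class D v = {gauge g v | g. \<forall>i\<in>verts Q. g i \<noteq> 0}"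
  unfolding iso_class_def gauge_def by simp

lemma gauge_cas:
  assumes g: "\<And>i. i \<in> verts Q \<Longrightarrow> g i \<noteq> 0"
  shows "pre_digraph.cas Q u p w \<Longrightarrow> set p \<subseteq> arcs Q \<Longrightarrow> u \<in> verts Q \<Longrightarrow>
    prod_list (map (gauge g v) p) = g w * prod_list (map v p) / g u"
proof (induction p arbitrary: u)
  case Nil
  then show ?case using g[of u] by (simp add: pre_digraph.cas.simps)
next
  case (Cons a p)
  then have "g (head Q a) \<noteq> 0" using g head_in_verts by simp
  moreover have "gauge g v a = g (head Q a) * v a / g u"
    using Cons.prems by (simp add: pre_digraph.cas.simps gauge_def)
  moreover have "prod_list (map (gauge g v) p) = g w * prod_list (map v p) / g (head Q a)"
    using Cons.prems by (intro Cons.IH head_in_verts) (auto simp: pre_digraph.cas.simps)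
  ultimately show ?case by simp
qed

definition supported :: "(torus_edge \<Rightarrow> complex) \<Rightarrow> bool" where
  "supported v \<longleftrightarrow> (\<forall>a. a \<notin> arcs Q \<longrightarrow> v a = 0)"

lemma reps_supported: "v \<in> reps D \<Longrightarrow> supported v"
  by (simp add: reps_def supported_def)

lemma supported_gauge: "supported (gauge g v)"
  by (simp add: supported_def gauge_def)

lemma gauge_gauge: "gauge g (gauge h v) = gauge (\<lambda>i. g i * h i) v"
  by (auto simp: gauge_def fun_eq_iff mult_ac)

lemma gauge_one: "supported v \<Longrightarrow> gauge (\<lambda>_. 1) v = v"
  by (auto simp: gauge_def fun_eq_iff supported_def)

lemma iso_class_refl: "supported v \<Longrightarrow> v \<in> iso_class D v"
  unfolding iso_class_gauge by (intro CollectI exI[of _ "\<lambda>_. 1"]) (simp add: gauge_one)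

lemma iso_class_eq:
  assumes "supported v" "u \<in> iso_class D v"
  shows "iso_class D u = iso_class D v"
proof -
  obtain h where h: "u = gauge h v" "\<And>i. i \<in> verts Q \<Longrightarrow> h i \<noteq> 0" using assms(2) unfolding iso_class_gauge by blast
  have v: "v = gauge (\<lambda>i. inverse (h i)) u"
  proof -
    have "gauge (\<lambda>i. inverse (h i)) u a = v a" for a
      using assms(1) h(2) head_in_verts[of a] tail_in_verts[of a] unfolding h(1) supported_def
      by (simp add: gauge_def)
    then show ?thesis by auto
  qed
  have "iso_class D u \<subseteq> iso_class D v"
  proof
    fix x assume "x \<in> iso_class D u"
    then obtain g where g: "x = gauge g u" "\<forall>i\<in>verts Q. g i \<noteq> 0" unfolding iso_class_gauge by blast
    then have "x = gauge (\<lambda>i. g i * h i) v" using h(1) by (simp add: gauge_gauge)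
    moreover have "\<forall>i\<in>verts Q. g i * h i \<noteq> 0" using g(2) h(2) by simp
    ultimately show "x \<in> iso_class D v" unfolding iso_class_gauge by blast
  qed
  moreover have "iso_class D v \<subseteq> iso_class D u"
  proof
    fix x assume "x \<in> iso_class D v"
    then obtain g where g: "x = gauge g v" "\<forall>i\<in>verts Q. g i \<noteq> 0" unfolding iso_class_gauge by blast
    then have "x = gauge (\<lambda>i. g i * inverse (h i)) u" using v by (metis gauge_gauge)
    moreover have "\<forall>i\<in>verts Q. g i * inverse (h i) \<noteq> 0" using g(2) h(2) by simp
    ultimately show "x \<in> iso_class D u" unfolding iso_class_gauge by blast
  qed
  ultimately show ?thesis by blast
qed

definition zeros :: "(torus_edge \<Rightarrow> complex) \<Rightarrow> torus_edge set" where
  "zeros v = {a \<in> arcs Q. v a = 0}"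

lemma zeros_iso_class: "u \<in> iso_class D v \<Longrightarrow> zeros u = zeros v"
  using head_in_verts tail_in_verts unfolding iso_class_gauge zeros_def gauge_def by auto

lemma reps_iso_class:
  assumes "v \<in> reps D" "u \<in> iso_class D v"
  shows "u \<in> reps D"
proof -
  obtain g where g: "u = gauge g v" "\<And>i. i \<in> verts Q \<Longrightarrow> g i \<noteq> 0" using assms(2) unfolding iso_class_gauge by blast
  have "prod_list (map u (plus_path D e)) = prod_list (map u (minus_path D e))" if e: "e \<in> edges D" for e
  proof -
    have h: "head Q (edge_proj e) \<in> verts Q" using head_in_verts e by (simp add: arcs_Q)
    have "prod_list (map v (plus_path D e)) = prod_list (map v (minus_path D e))"
      using assms(1) e by (simp add: reps_def)
    then show ?thesis unfolding g(1)
      using gauge_cas[OF g(2) plus_path_cas[OF e] plus_path_arcs[OF e] h]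
        gauge_cas[OF g(2) minus_path_cas[OF e] minus_path_arcs[OF e] h] by simp
  qed
  then show ?thesis using supported_gauge[of g v] by (simp add: reps_def supported_def g(1))
qed

lemma subspace_complex: "vector_space_over_itself.subspace (N :: complex set) \<Longrightarrow> N = {0} \<or> N = UNIV"
proof -
  assume N: "vector_space_over_itself.subspace N"
  have "N = UNIV" if x: "x \<in> N" "x \<noteq> 0" for x
  proof -
    have "y \<in> N" for y
    proof -
      have "(y / x) * x \<in> N" using vector_space_over_itself.subspace_scale[OF N x(1)] .
      then show ?thesis using x(2) by simp
    qed
    then show ?thesis by blast
  qed
  then show ?thesis using vector_space_over_itself.subspace_0[OF N] by blast
qed

lemma dim_complex: "vector_space_over_itself.dim (UNIV :: complex set) = 1"
  "vector_space_over_itself.dim {0 :: complex} = 0"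
proof -
  show "vector_space_over_itself.dim (UNIV :: complex set) = 1"
    using vector_space_over_itself.dim_UNIV[where 'a = complex] by (simp add: dimension_eq_1)
  show "vector_space_over_itself.dim {0 :: complex} = 0"
    using vector_space_over_itself.dim_le_card[of "{0 :: complex}" "{}"] by simp
qed

text \<open>The additive form of the Jacobian relations. The type is left open because it is applied
  to integral one-parameter subgroups and to real points of cones.\<close>

definition balanced :: "(torus_edge \<Rightarrow> 'b::monoid_add) \<Rightarrow> bool" where
  "balanced k \<longleftrightarrow> (\<forall>e\<in>edges D. sum_list (map k (plus_path D e)) = sum_list (map k (minus_path D e)))"

lemma int_weights_balanced: "k \<in> int_weights D \<longleftrightarrow> balanced k \<and> (\<forall>a. a \<notin> arcs Q \<longrightarrow> k a = 0)"
  by (auto simp: int_weights_def balanced_def)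

text \<open>The two paths of a relation have the same ends, so a coboundary contributes equally to
  both.\<close>

lemma balanced_add_\<delta>:
  fixes k :: "torus_edge \<Rightarrow> 'b::ab_group_add"
  assumes "balanced k"
  shows "balanced (\<lambda>a. if a \<in> arcs Q then k a + \<delta> m a else 0)"
  unfolding balanced_def
proof
  fix e assume e: "e \<in> edges D"
  have *: "sum_list (map (\<lambda>a. if a \<in> arcs Q then k a + \<delta> m a else 0) p) = sum_list (map k p) + (m v - m u)"
    if p: "set p \<subseteq> arcs Q" "pre_digraph.cas Q u p v" for p u v
  proof -
    have eq: "map (\<lambda>a. if a \<in> arcs Q then k a + \<delta> m a else 0) p = map (\<lambda>a. k a + \<delta> m a) p" using p(1) by auto
    show ?thesis unfolding eq using cas_sum[OF p(2), of m] by (simp add: sum_list_addf)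
  qed
  have "sum_list (map k (plus_path D e)) = sum_list (map k (minus_path D e))"
    using assms e by (simp add: balanced_def)
  then show "sum_list (map (\<lambda>a. if a \<in> arcs Q then k a + \<delta> m a else 0) (plus_path D e)) =
      sum_list (map (\<lambda>a. if a \<in> arcs Q then k a + \<delta> m a else 0) (minus_path D e))"
    using *[OF plus_path_arcs[OF e] plus_path_cas[OF e]] *[OF minus_path_arcs[OF e] minus_path_cas[OF e]] by simp
qed

lemma int_weights_add_\<delta>:
  "k \<in> int_weights D \<Longrightarrow> (\<lambda>a. if a \<in> arcs Q then k a + \<delta> m a else 0) \<in> int_weights D"
  unfolding int_weights_balanced using balanced_add_\<delta>[of k m] by simp

end

locale zero_generated_stability = dimer_geometry D for D +
  fixes i0 :: torus_tile and \<theta> :: "torus_tile \<Rightarrow> rat"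
  assumes i0: "i0 \<in> verts (dual_quiver D)" and \<theta>: "zero_generated D i0 \<theta>"
begin

definition reachable :: "torus_edge set \<Rightarrow> bool" where
  "reachable Z \<longleftrightarrow> (\<forall>j\<in>verts Q. \<exists>p. walk Z i0 p j)"

lemma reachable_mono: "reachable Z \<Longrightarrow> Z' \<subseteq> Z \<Longrightarrow> reachable Z'"
  unfolding reachable_def using walk_mono by blast

lemma theta_pos: "i \<in> verts Q \<Longrightarrow> i \<noteq> i0 \<Longrightarrow> \<theta> i > 0"
  and theta_sum: "(\<Sum>i\<in>verts Q. \<theta> i) = 0"
  using \<theta> by (auto simp: zero_generated_def)

text \<open>The vertices reachable from \<open>i0\<close> carry a submodule. If it were proper, its
  value under \<open>\<theta>\<close> would be minus a nonempty sum of positive terms over the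
  remaining vertices.\<close>

lemma stable_reachable:
  assumes "stable D \<theta> v"
  shows "reachable (zeros v)"
proof (rule ccontr)
  assume nr: "\<not> reachable (zeros v)"
  define R where "R = {j. \<exists>p. walk (zeros v) i0 p j}"
  define N where "N i = (if i \<in> R then UNIV else {0 :: complex})" for i
  have i0R: "i0 \<in> R" unfolding R_def walk_def by (auto intro!: exI[of _ "[]"] simp: pre_digraph.cas.simps)
  obtain j where j: "j \<in> verts Q" "j \<notin> R" using nr unfolding reachable_def R_def by blast
  have "submodule D v N"
    unfolding submodule_def
  proof (intro conjI ballI)
    fix a assume a: "a \<in> arcs Q"
    show "(\<lambda>x. v a * x) ` N (tail Q a) \<subseteq> N (head Q a)"
    proof (cases "v a \<noteq> 0 \<and> tail Q a \<in> R")
      case True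
      then obtain p where "walk (zeros v) i0 p (tail Q a)" unfolding R_def by blast
      then have "walk (zeros v) i0 (p @ [a]) (head Q a)" using True a by (intro walk_snoc) (auto simp: zeros_def)
      then show ?thesis unfolding N_def R_def by auto
    qed (auto simp: N_def)
  qed (auto simp: N_def)
  moreover have "\<exists>i\<in>verts Q. N i \<noteq> {0}" using i0 i0R UNIV_not_singleton unfolding N_def by (intro bexI[of _ i0]) auto
  moreover have "\<exists>i\<in>verts Q. N i \<noteq> UNIV" using j UNIV_not_singleton unfolding N_def by (intro bexI[of _ j]) auto
  ultimately have "(\<Sum>i\<in>verts Q. \<theta> i * of_nat (vector_space_over_itself.dim (N i))) > 0"
    using assms unfolding stable_def by blast
  moreover have "(\<Sum>i\<in>verts Q. \<theta> i * of_nat (vector_space_over_itself.dim (N i))) = (\<Sum>i\<in>verts Q \<inter> R. \<theta> i)"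
    unfolding sum.inter_restrict[OF finite_verts] by (intro sum.cong) (auto simp: N_def dim_complex)
  moreover have "(\<Sum>i\<in>verts Q \<inter> R. \<theta> i) = - (\<Sum>i\<in>verts Q - R. \<theta> i)"
    using theta_sum sum.Int_Diff[OF finite_verts, of \<theta> R] by simp
  moreover have "(\<Sum>i\<in>verts Q - R. \<theta> i) > 0"
    using j i0R theta_pos finite_verts by (intro sum_pos) auto
  ultimately show False by simp
qed

text \<open>A submodule that is nonzero at \<open>i0\<close> is carried along the nonzero arrows to
  every vertex. So a proper one vanishes at \<open>i0\<close>, and only positive values of
  \<open>\<theta>\<close> enter its sum.\<close>

lemma reachable_stable:
  assumes "reachable (zeros v)"
  shows "stable D \<theta> v"
  unfolding stable_def
proof (intro allI impI, elim conjE)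
  fix N assume N: "submodule D v N" and ne: "\<exists>i\<in>verts Q. N i \<noteq> {0}" and nu: "\<exists>i\<in>verts Q. N i \<noteq> UNIV"
  have sub: "N i = {0} \<or> N i = UNIV" if "i \<in> verts Q" for i
    using N that subspace_complex unfolding submodule_def by blast
  have N0: "N i0 = {0}"
  proof (rule ccontr)
    assume "N i0 \<noteq> {0}"
    then have U: "N i0 = UNIV" using sub i0 by blast
    have "N j = UNIV" if "walk (zeros v) i0 p j" for p j
      using that
    proof (induction p arbitrary: j rule: rev_induct)
      case Nil
      then show ?case using U by (simp add: walk_def pre_digraph.cas.simps)
    next
      case (snoc a p)
      have a: "a \<in> arcs Q" "v a \<noteq> 0" "j = head Q a" "walk (zeros v) i0 p (tail Q a)"
        using snoc.prems cas_snocD unfolding walk_def zeros_def by auto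
      then have "(\<lambda>x. v a * x) ` UNIV \<subseteq> N j" using snoc.IH N unfolding submodule_def by metis
      then have "v a * 1 \<in> N j" by blast
      then have "N j \<noteq> {0}" using a(2) by auto
      then show ?case using sub head_in_verts a by blast
    qed
    then have "N j = UNIV" if "j \<in> verts Q" for j using assms that unfolding reachable_def by blast
    then show False using nu by blast
  qed
  have nonneg: "\<theta> i * of_nat (vector_space_over_itself.dim (N i)) \<ge> 0" if "i \<in> verts Q" for i
    using theta_pos[OF that] N0 by (cases "i = i0") (auto simp: dim_complex)
  obtain j where j: "j \<in> verts Q" "N j \<noteq> {0}" using ne by blast
  then have "N j = UNIV" "j \<noteq> i0" using sub N0 by auto
  then have "\<theta> j * of_nat (vector_space_over_itself.dim (N j)) > 0" using theta_pos[OF j(1)] by (simp add: dim_complex)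
  then show "(\<Sum>i\<in>verts Q. \<theta> i * of_nat (vector_space_over_itself.dim (N i))) > 0"
    using nonneg finite_verts j(1) by (intro sum_pos2) auto
qed

lemma stable_reps_iff: "v \<in> stable_reps D \<theta> \<longleftrightarrow> v \<in> reps D \<and> reachable (zeros v)"
  using stable_reachable reachable_stable by (auto simp: stable_reps_def)

lemma stable_reps_iso_class: "v \<in> stable_reps D \<theta> \<Longrightarrow> iso_class D v \<subseteq> stable_reps D \<theta>"
  using reps_iso_class zeros_iso_class by (auto simp: stable_reps_iff)

lemma stable_reps_supported: "v \<in> stable_reps D \<theta> \<Longrightarrow> supported v"
  by (simp add: stable_reps_def reps_supported)

subsection \<open>Limits in the moduli space\<close>

text \<open>\<open>topology\<close> has the intended open sets only if the predicate is a topology.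
  The intersection axiom holds because distinct isomorphism classes are disjoint.\<close>

lemma openin_moduli: "openin (moduli_topology D \<theta>) U \<longleftrightarrow>
    U \<subseteq> moduli D \<theta> \<and> openin (top_of_set (stable_reps D \<theta>)) (\<Union>U)"
proof -
  have int: "\<Union>(S \<inter> T) = \<Union>S \<inter> \<Union>T" if ST: "S \<subseteq> moduli D \<theta>" "T \<subseteq> moduli D \<theta>" for S T
  proof -
    have "x \<in> \<Union>(S \<inter> T)" if x: "x \<in> s" "s \<in> S" "x \<in> t" "t \<in> T" for x s t
    proof -
      obtain u w where "s = iso_class D u" "t = iso_class D w" "supported u" "supported w"
        using ST x stable_reps_supported unfolding moduli_def by blast
      then have "s = t" using iso_class_eq x by metis
      then show ?thesis using x by blast
    qed
    then show ?thesis by blast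
  qed
  have "istopology (\<lambda>U. U \<subseteq> moduli D \<theta> \<and> openin (top_of_set (stable_reps D \<theta>)) (\<Union>U))"
    unfolding istopology_def
  proof (intro conjI allI impI)
    fix S T assume "S \<subseteq> moduli D \<theta> \<and> openin (top_of_set (stable_reps D \<theta>)) (\<Union>S)"
      "T \<subseteq> moduli D \<theta> \<and> openin (top_of_set (stable_reps D \<theta>)) (\<Union>T)"
    then show "openin (top_of_set (stable_reps D \<theta>)) (\<Union>(S \<inter> T))" using int[of S T] openin_Int by metis
  next
    fix \<K> assume K: "\<forall>K\<in>\<K>. K \<subseteq> moduli D \<theta> \<and> openin (top_of_set (stable_reps D \<theta>)) (\<Union>K)"
    have "\<Union>(\<Union>\<K>) = \<Union>(Union ` \<K>)" by blast
    then show "openin (top_of_set (stable_reps D \<theta>)) (\<Union>(\<Union>\<K>))" using K openin_Union[of "Union ` \<K>"] by auto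
  qed blast+
  then show ?thesis unfolding moduli_topology_def by simp
qed

lemma topspace_moduli: "topspace (moduli_topology D \<theta>) = moduli D \<theta>"
proof -
  have "\<Union>(moduli D \<theta>) = stable_reps D \<theta>"
    using stable_reps_iso_class iso_class_refl stable_reps_supported unfolding moduli_def by blast
  then have "openin (moduli_topology D \<theta>) (moduli D \<theta>)" by (simp add: openin_moduli)
  then show ?thesis using openin_subset openin_moduli openin_topspace by blast
qed

text \<open>For stable \<open>Z\<close> this represents the distinguished point of a torus orbit,
  with entries 0 and 1.\<close>

definition unit_rep :: "torus_edge set \<Rightarrow> torus_edge \<Rightarrow> complex" where
  "unit_rep Z a = (if a \<in> arcs Q \<and> a \<notin> Z then 1 else 0)"

lemma zeros_unit_rep: "Z \<subseteq> arcs Q \<Longrightarrow> zeros (unit_rep Z) = Z"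
  by (auto simp: zeros_def unit_rep_def)

lemma supported_unit_rep: "supported (unit_rep Z)"
  by (simp add: supported_def unit_rep_def)

text \<open>The lattice points in the relative interior of the cone with zero set \<open>Z\<close>:
  modulo a coboundary they are nonnegative with support exactly \<open>Z\<close>.\<close>

definition normalized_weights :: "torus_edge set \<Rightarrow> (torus_edge \<Rightarrow> int) set" where
  "normalized_weights Z = {k \<in> int_weights D. \<exists>m. (\<forall>a\<in>arcs Q. k a + \<delta> m a \<ge> 0) \<and> (\<forall>a\<in>arcs Q. k a + \<delta> m a = 0 \<longleftrightarrow> a \<notin> Z)}"

text \<open>For a negative exponent, multiplying by the opposite power gives the constant 1,
  although the product would have to tend to 0.\<close>

lemma tendsto_powi_0:
  fixes c :: complex
  assumes "((\<lambda>t. t powi n) \<longlongrightarrow> c) (at 0)"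
  shows "n \<ge> 0 \<and> c = (if n = 0 then 1 else 0)"
proof (cases "n \<ge> 0")
  case True
  then obtain k where k: "n = int k" using nonneg_int_cases by blast
  have "((\<lambda>t::complex. t ^ k) \<longlongrightarrow> 0 ^ k) (at 0)" by (intro tendsto_intros)
  then have "((\<lambda>t::complex. t powi n) \<longlongrightarrow> 0 ^ k) (at 0)" using k by simp
  then have "c = 0 ^ k" using assms tendsto_unique[OF _ assms] by (metis at_neq_bot)
  then show ?thesis using True k by simp
next
  case False
  define k where "k = nat (- n)"
  have k: "n = - int k" "k > 0" using False by (auto simp: k_def)
  have "((\<lambda>t::complex. t ^ k) \<longlongrightarrow> 0 ^ k) (at 0)" by (intro tendsto_intros)
  from tendsto_mult[OF assms this] have lim: "((\<lambda>t::complex. t powi n * t ^ k) \<longlongrightarrow> c * 0 ^ k) (at 0)" .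
  have "t powi n * t ^ k = 1" if "t \<noteq> 0" for t :: complex
    using that by (simp add: k(1) power_int_minus)
  then have "eventually (\<lambda>t::complex. t powi n * t ^ k = 1) (at 0)"
    by (simp add: eventually_at_filter)
  then have "((\<lambda>t::complex. 1) \<longlongrightarrow> c * 0 ^ k) (at 0)" using lim by (rule Lim_transform_eventually[rotated])
  then have "1 = c * 0 ^ k" using tendsto_unique[OF at_neq_bot tendsto_const] by blast
  then show ?thesis using zero_power[OF k(2), where 'a = complex] by simp
qed

lemma prod_list_powi:
  "t \<noteq> 0 \<Longrightarrow> prod_list (map (\<lambda>a. t powi k a) p) = (t::complex) powi sum_list (map k p)"
  by (induction p) (auto simp: power_int_add)

lemma one_parameter_reps:
  assumes "k \<in> int_weights D" "t \<noteq> 0"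
  shows "one_parameter D k t \<in> reps D"
proof -
  have "prod_list (map (one_parameter D k t) p) = t powi sum_list (map k p)" if "set p \<subseteq> arcs Q" for p
  proof -
    have eq: "map (one_parameter D k t) p = map (\<lambda>a. t powi k a) p" using that by (auto simp: one_parameter_def)
    show ?thesis unfolding eq by (rule prod_list_powi[OF assms(2)])
  qed
  then show ?thesis using assms(1) plus_path_arcs minus_path_arcs
    by (simp add: reps_def int_weights_def one_parameter_def)
qed

lemma one_parameter_gauge:
  assumes "t \<noteq> 0"
  shows "one_parameter D (\<lambda>a. if a \<in> arcs Q then k a + \<delta> m a else 0) t \<in> iso_class D (one_parameter D k t)"
proof -
  have "one_parameter D (\<lambda>a. if a \<in> arcs Q then k a + \<delta> m a else 0) t = gauge (\<lambda>i. t powi m i) (one_parameter D k t)"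
    using assms by (auto simp: one_parameter_def gauge_def fun_eq_iff \<delta>_def power_int_add power_int_diff)
  then show ?thesis unfolding iso_class_gauge using assms by auto
qed

text \<open>The invariant functions \<open>u(p) u(a) / u(q)\<close> for paths \<open>p\<close>, \<open>q\<close> from \<open>i0\<close> to the tail and head of
  an arrow \<open>a\<close> recover the normalised representation, so no separation property of the moduli space
  is needed to identify the limit.\<close>

lemma limit_one_parameter:
  assumes k: "k \<in> int_weights D" and w: "w \<in> stable_reps D \<theta>"
    and lim: "limitin (moduli_topology D \<theta>) (\<lambda>t. iso_class D (one_parameter D k t)) (iso_class D w) (at 0)"
  shows "k \<in> normalized_weights (zeros w) \<and> unit_rep (zeros w) \<in> iso_class D w"
proof -
  have "reachable (zeros w)" using w by (simp add: stable_reps_iff)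
  then obtain p where p: "\<And>j. j \<in> verts Q \<Longrightarrow> walk (zeros w) i0 (p j) j"
    unfolding reachable_def by metis
  then have cas: "pre_digraph.cas Q i0 (p j) j" and sub: "set (p j) \<subseteq> arcs Q" if "j \<in> verts Q" for j
    using that unfolding walk_def by blast+
  define pr where "pr u j = prod_list (map u (p j))" for u :: "torus_edge \<Rightarrow> complex" and j
  define f where "f a u = pr u (tail Q a) * u a / pr u (head Q a)" for a u
  define S where "S = {u. \<forall>j\<in>verts Q. pr u j \<noteq> 0}"
  \<comment> \<open>The exponent of \<open>f a\<close> on the one-parameter subgroup, that is,
    \<open>k\<close> shifted by the coboundary that makes its sums along the chosen walks
    zero.\<close>
  define \<phi> where "\<phi> a = k a + \<delta> (\<lambda>j. - sum_list (map k (p j))) a" for a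
  have cpr: "continuous_on UNIV (\<lambda>u. pr u j)" for j
  proof -
    have "continuous_on UNIV (\<lambda>u::torus_edge \<Rightarrow> complex. prod_list (map u q))" for q
      by (induction q) (auto intro!: continuous_intros)
    then show ?thesis unfolding pr_def .
  qed
  have "S = (\<Inter>j\<in>verts Q. (\<lambda>u. pr u j) -` (- {0}))" by (auto simp: S_def)
  then have openS: "open S" using finite_verts
    by (auto intro!: open_INT open_vimage cpr)
  have contf: "continuous_on S (f a)" if "a \<in> arcs Q" for a
    unfolding f_def using head_in_verts[OF that]
    by (intro continuous_intros continuous_on_subset[OF cpr] continuous_on_product_then_coordinatewise[OF continuous_on_id])
      (auto simp: S_def)
  have inv: "pr u j = 0 \<longleftrightarrow> pr u' j = 0" if u: "u' \<in> iso_class D u" "j \<in> verts Q" for u u' j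
  proof -
    obtain g where g: "u' = gauge g u" "\<And>i. i \<in> verts Q \<Longrightarrow> g i \<noteq> 0" using u(1) unfolding iso_class_gauge by blast
    have "pr u' j = g j * pr u j / g i0"
      using gauge_cas[OF g(2) cas[OF u(2)] sub[OF u(2)] i0] unfolding g(1) pr_def by simp
    then show ?thesis using g(2)[OF u(2)] g(2)[OF i0] by simp
  qed
  have invf: "f a u' = f a u" if u: "u' \<in> iso_class D u" "a \<in> arcs Q" for u u' a
  proof -
    obtain g where g: "u' = gauge g u" "\<And>i. i \<in> verts Q \<Longrightarrow> g i \<noteq> 0" using u(1) unfolding iso_class_gauge by blast
    have V: "tail Q a \<in> verts Q" "head Q a \<in> verts Q" using head_in_verts tail_in_verts u(2) by auto
    have "pr u' (tail Q a) = g (tail Q a) * pr u (tail Q a) / g i0" "pr u' (head Q a) = g (head Q a) * pr u (head Q a) / g i0"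
      using gauge_cas[OF g(2) cas[OF V(1)] sub[OF V(1)] i0] gauge_cas[OF g(2) cas[OF V(2)] sub[OF V(2)] i0]
      unfolding g(1) pr_def by simp_all
    moreover have "u' a = g (head Q a) * u a / g (tail Q a)" using u(2) by (simp add: g(1) gauge_def)
    ultimately show ?thesis using g(2)[OF V(1)] g(2)[OF V(2)] g(2)[OF i0] by (simp add: f_def)
  qed
  have wS: "w \<in> S"
  proof -
    have "pr w j \<noteq> 0" if "j \<in> verts Q" for j
      using p[OF that] unfolding pr_def walk_def zeros_def by (auto simp: prod_list_zero_iff)
    then show ?thesis by (simp add: S_def)
  qed
  have tend: "((\<lambda>t. f a (one_parameter D k t)) \<longlongrightarrow> f a w) (at 0)" if a: "a \<in> arcs Q" for a
    unfolding tendsto_def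
  proof (intro allI impI)
    fix W assume W: "open W" "f a w \<in> W"
    \<comment> \<open>Both \<open>S\<close> and \<open>f a\<close> are invariant under isomorphism,
      so \<open>T\<close> is a union of classes. Hence it defines an open set of the quotient, on
      which the convergence can be tested.\<close>
    define T where "T = stable_reps D \<theta> \<inter> (S \<inter> f a -` W)"
    define U where "U = iso_class D ` T"
    have "\<Union>U = T"
    proof
      show "T \<subseteq> \<Union>U" using iso_class_refl stable_reps_supported unfolding T_def U_def by blast
      show "\<Union>U \<subseteq> T"
      proof
        fix u' assume "u' \<in> \<Union>U"
        then obtain u where u: "u \<in> T" "u' \<in> iso_class D u" unfolding U_def by blast
        then have "u' \<in> stable_reps D \<theta>" using stable_reps_iso_class unfolding T_def by blast
        moreover have "u' \<in> S" using u inv[OF u(2)] unfolding T_def S_def by auto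
        moreover have "f a u' \<in> W" using invf[OF u(2) a] u(1) unfolding T_def by simp
        ultimately show "u' \<in> T" unfolding T_def by simp
      qed
    qed
    moreover have "openin (top_of_set (stable_reps D \<theta>)) T"
      unfolding T_def using continuous_open_preimage[OF contf[OF a] openS W(1)] by (rule openin_open_Int)
    moreover have "U \<subseteq> moduli D \<theta>" unfolding U_def T_def moduli_def by blast
    ultimately have "openin (moduli_topology D \<theta>) U" by (simp add: openin_moduli)
    moreover have "iso_class D w \<in> U" using w wS W(2) unfolding U_def T_def by blast
    ultimately have "eventually (\<lambda>t. iso_class D (one_parameter D k t) \<in> U) (at 0)"
      using limitinD[OF lim] by blast
    then show "eventually (\<lambda>t. f a (one_parameter D k t) \<in> W) (at 0)"
    proof (rule eventually_mono)
      fix t assume "iso_class D (one_parameter D k t) \<in> U"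
      then obtain u where u: "u \<in> T" "iso_class D (one_parameter D k t) = iso_class D u" unfolding U_def by blast
      have "one_parameter D k t \<in> iso_class D u"
        unfolding u(2)[symmetric] by (rule iso_class_refl) (simp add: supported_def one_parameter_def)
      then have "f a (one_parameter D k t) = f a u" using invf a by blast
      then show "f a (one_parameter D k t) \<in> W" using u(1) unfolding T_def by simp
    qed
  qed
  have f1: "f a (one_parameter D k t) = t powi \<phi> a" if a: "a \<in> arcs Q" and t: "t \<noteq> 0" for a t
  proof -
    have V: "tail Q a \<in> verts Q" "head Q a \<in> verts Q" using head_in_verts tail_in_verts a by auto
    have "pr (one_parameter D k t) j = t powi sum_list (map k (p j))" if "j \<in> verts Q" for j
    proof -
      have eq: "map (one_parameter D k t) (p j) = map (\<lambda>a. t powi k a) (p j)"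
        using sub[OF that] by (auto simp: one_parameter_def)
      show ?thesis unfolding pr_def eq by (rule prod_list_powi[OF t])
    qed
    then show ?thesis using V a t
      by (simp add: f_def \<phi>_def \<delta>_def one_parameter_def power_int_add power_int_diff power_int_minus field_simps)
  qed
  have key: "\<phi> a \<ge> 0 \<and> f a w = (if \<phi> a = 0 then 1 else 0)" if a: "a \<in> arcs Q" for a
  proof (rule tendsto_powi_0)
    have "eventually (\<lambda>t. f a (one_parameter D k t) = t powi \<phi> a) (at 0)"
      using f1[OF a] by (auto simp: eventually_at_filter)
    then show "((\<lambda>t. t powi \<phi> a) \<longlongrightarrow> f a w) (at 0)" by (rule Lim_transform_eventually[OF tend[OF a]])
  qed
  have fz: "f a w = 0 \<longleftrightarrow> a \<in> zeros w" if a: "a \<in> arcs Q" for a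
    using wS a head_in_verts[OF a] tail_in_verts[OF a] by (auto simp: f_def S_def zeros_def)
  have "\<phi> a = 0 \<longleftrightarrow> a \<notin> zeros w" if a: "a \<in> arcs Q" for a
    using key[OF a] fz[OF a] by (metis zero_neq_one)
  then have "k \<in> normalized_weights (zeros w)"
    unfolding normalized_weights_def using k key unfolding \<phi>_def by blast
  \<comment> \<open>Rescaling each vertex by the value of \<open>w\<close> along its walk turns the
    entry at \<open>a\<close> into the invariant \<open>f a w\<close>, which is 0 or 1.\<close>
  moreover have "unit_rep (zeros w) = gauge (\<lambda>j. inverse (pr w j)) w"
  proof
    fix a
    show "unit_rep (zeros w) a = gauge (\<lambda>j. inverse (pr w j)) w a"
    proof (cases "a \<in> arcs Q")
      case True
      then have "gauge (\<lambda>j. inverse (pr w j)) w a = f a w" by (simp add: gauge_def f_def divide_inverse mult_ac)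
      moreover have "f a w = (if a \<in> zeros w then 0 else 1)"
        using key[OF True] fz[OF True] by (metis zero_neq_one)
      ultimately show ?thesis using True by (simp add: unit_rep_def)
    qed (simp add: unit_rep_def gauge_def)
  qed
  moreover have "\<forall>j\<in>verts Q. inverse (pr w j) \<noteq> 0" using wS by (simp add: S_def)
  ultimately show ?thesis unfolding iso_class_gauge by blast
qed

text \<open>Rescaling vertex \<open>i\<close> by \<open>t powi m i\<close> makes all exponents
  nonnegative, so the rescaled representations converge to \<open>unit_rep Z\<close> already before
  passing to classes.\<close>

lemma limit_one_parameterI:
  assumes u: "unit_rep Z \<in> stable_reps D \<theta>" and Z: "Z \<subseteq> arcs Q" and k: "k \<in> normalized_weights Z"
  shows "limitin (moduli_topology D \<theta>) (\<lambda>t. iso_class D (one_parameter D k t)) (iso_class D (unit_rep Z)) (at 0)"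
proof -
  obtain m where m: "\<And>a. a \<in> arcs Q \<Longrightarrow> k a + \<delta> m a \<ge> 0" "\<And>a. a \<in> arcs Q \<Longrightarrow> k a + \<delta> m a = 0 \<longleftrightarrow> a \<notin> Z"
    using k unfolding normalized_weights_def by auto
  have kw: "k \<in> int_weights D" using k unfolding normalized_weights_def by simp
  define k' where "k' = (\<lambda>a. if a \<in> arcs Q then k a + \<delta> m a else 0)"
  have k': "k' \<in> int_weights D" unfolding k'_def by (rule int_weights_add_\<delta>[OF kw])
  define v where "v t = one_parameter D k' t" for t
  have reach: "reachable Z" using u zeros_unit_rep[OF Z] by (simp add: stable_reps_iff)
  have vst: "v t \<in> stable_reps D \<theta>" if t: "t \<noteq> 0" for t
  proof -
    have "zeros (v t) = {}" using t by (auto simp: zeros_def v_def one_parameter_def)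
    then show ?thesis using one_parameter_reps[OF k' t] reachable_mono[OF reach] by (simp add: stable_reps_iff v_def)
  qed
  have "((\<lambda>t. v t a) \<longlongrightarrow> unit_rep Z a) (at 0)" for a
  proof (cases "a \<in> arcs Q")
    case True
    obtain n where n: "k' a = int n" using m(1)[OF True] True nonneg_int_cases[of "k' a"] unfolding k'_def by auto
    have "((\<lambda>t::complex. t ^ n) \<longlongrightarrow> 0 ^ n) (at 0)" by (intro tendsto_intros)
    moreover have "(0::complex) ^ n = unit_rep Z a" using m(2)[OF True] n True by (auto simp: k'_def unit_rep_def power_0_left)
    ultimately show ?thesis using True n by (simp add: v_def one_parameter_def)
  qed (simp add: v_def one_parameter_def unit_rep_def)
  then have vlim: "(v \<longlongrightarrow> unit_rep Z) (at 0)"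
    using limitin_componentwise[of "\<lambda>_. euclidean" UNIV v "unit_rep Z" "at 0"]
    by (simp add: euclidean_product_topology)
  show ?thesis unfolding limitin_def topspace_moduli
  proof (intro conjI allI impI)
    show "iso_class D (unit_rep Z) \<in> moduli D \<theta>" using u unfolding moduli_def by blast
    fix U assume U: "openin (moduli_topology D \<theta>) U \<and> iso_class D (unit_rep Z) \<in> U"
    then have Uo: "openin (top_of_set (stable_reps D \<theta>)) (\<Union>U)" and Um: "U \<subseteq> moduli D \<theta>" by (simp_all add: openin_moduli)
    obtain W where W: "open W" "\<Union>U = stable_reps D \<theta> \<inter> W" using Uo by (auto simp: openin_open)
    have "unit_rep Z \<in> W" using U iso_class_refl[OF supported_unit_rep] W(2) by blast
    then have "eventually (\<lambda>t. v t \<in> W) (at 0)" using vlim W(1) topological_tendstoD by blast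
    moreover have "eventually (\<lambda>t::complex. t \<noteq> 0) (at 0)" by (simp add: eventually_at_filter)
    ultimately show "eventually (\<lambda>t. iso_class D (one_parameter D k t) \<in> U) (at 0)"
    proof eventually_elim
      case (elim t)
      then have "v t \<in> \<Union>U" using vst W(2) by blast
      then obtain c where c: "c \<in> U" "v t \<in> c" by blast
      then obtain w where w: "c = iso_class D w" "w \<in> stable_reps D \<theta>" using Um unfolding moduli_def by blast
      have "iso_class D (v t) = c" using iso_class_eq[OF stable_reps_supported[OF w(2)]] c(2) w(1) by simp
      moreover have "iso_class D (v t) = iso_class D (one_parameter D k t)"
        using iso_class_eq[OF _ one_parameter_gauge[OF elim(2), of k m]]
        by (simp add: v_def k'_def supported_def one_parameter_def)
      ultimately show ?case using c(1) by simp
    qed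
  qed
qed

subsection \<open>Torus orbits\<close>

lemma unit_torus_rep: "(\<lambda>a. if a \<in> arcs Q then 1 else 0) \<in> torus_reps D"
proof -
  have "prod_list (map (\<lambda>a. if a \<in> arcs Q then 1 else 0 :: complex) p) = 1" if "set p \<subseteq> arcs Q" for p
    using that by (induction p) auto
  then show ?thesis using plus_path_arcs minus_path_arcs by (auto simp: torus_reps_def reps_def)
qed

lemma prod_list_mult: "prod_list (map (\<lambda>a. f a * g a) p) = prod_list (map f p) * prod_list (map g p)"
  for f g :: "'c \<Rightarrow> complex"
  by (induction p) auto

lemma torus_reps_mult: "s \<in> torus_reps D \<Longrightarrow> s' \<in> torus_reps D \<Longrightarrow> (\<lambda>a. s a * s' a) \<in> torus_reps D"
  by (simp add: torus_reps_def reps_def prod_list_mult)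

lemma torus_reps_inverse: "s \<in> torus_reps D \<Longrightarrow> (\<lambda>a. inverse (s a)) \<in> torus_reps D"
proof -
  have "prod_list (map (\<lambda>a. inverse (s a)) p) = inverse (prod_list (map s p))" for p by (induction p) auto
  then show "s \<in> torus_reps D \<Longrightarrow> ?thesis" by (simp add: torus_reps_def reps_def)
qed

lemma torus_orbit_iso_class:
  assumes "supported v"
  shows "torus_orbit D (iso_class D v) = {iso_class D (\<lambda>a. s a * v a) | s. s \<in> torus_reps D}"
proof -
  have *: "iso_class D (\<lambda>a. s a * u a) = iso_class D (\<lambda>a. s a * v a)" if u: "u \<in> iso_class D v" for s u
  proof -
    obtain g where g: "u = gauge g v" "\<forall>i\<in>verts Q. g i \<noteq> 0" using u unfolding iso_class_gauge by blast
    have "(\<lambda>a. s a * u a) = gauge g (\<lambda>a. s a * v a)" by (auto simp: g(1) gauge_def fun_eq_iff)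
    then have "(\<lambda>a. s a * u a) \<in> iso_class D (\<lambda>a. s a * v a)" unfolding iso_class_gauge using g(2) by blast
    moreover have "supported (\<lambda>a. s a * v a)" using assms by (simp add: supported_def)
    ultimately show ?thesis using iso_class_eq by blast
  qed
  show ?thesis
  proof (intro equalityI subsetI)
    fix x assume "x \<in> torus_orbit D (iso_class D v)"
    then obtain s u where "x = iso_class D (\<lambda>a. s a * u a)" "s \<in> torus_reps D" "u \<in> iso_class D v"
      unfolding torus_orbit_def by blast
    then show "x \<in> {iso_class D (\<lambda>a. s a * v a) | s. s \<in> torus_reps D}" using * by blast
  next
    fix x assume "x \<in> {iso_class D (\<lambda>a. s a * v a) | s. s \<in> torus_reps D}"
    then show "x \<in> torus_orbit D (iso_class D v)" unfolding torus_orbit_def using iso_class_refl[OF assms] by blast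
  qed
qed

lemma iso_class_in_torus_orbit:
  assumes "supported v"
  shows "iso_class D v \<in> torus_orbit D (iso_class D v)"
proof -
  have "(\<lambda>a. (if a \<in> arcs Q then 1 else 0) * v a) = v" using assms by (auto simp: supported_def)
  then show ?thesis unfolding torus_orbit_iso_class[OF assms] using unit_torus_rep
    by (intro CollectI exI[of _ "\<lambda>a. if a \<in> arcs Q then 1 else 0"]) simp
qed

lemma torus_orbit_eq:
  assumes v: "supported v" and w: "supported w" "iso_class D w \<in> torus_orbit D (iso_class D v)"
  shows "torus_orbit D (iso_class D w) = torus_orbit D (iso_class D v)" "zeros w = zeros v"
proof -
  obtain s where s: "s \<in> torus_reps D" "iso_class D w = iso_class D (\<lambda>a. s a * v a)"
    using w(2) unfolding torus_orbit_iso_class[OF v] by blast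
  have sv: "supported (\<lambda>a. s a * v a)" using v by (simp add: supported_def)
  have nz: "a \<in> arcs Q \<Longrightarrow> s a \<noteq> 0" for a using s(1) by (simp add: torus_reps_def)
  have "w \<in> iso_class D (\<lambda>a. s a * v a)" using iso_class_refl[OF w(1)] s(2) by simp
  then have "zeros w = zeros (\<lambda>a. s a * v a)" by (rule zeros_iso_class)
  then show "zeros w = zeros v" using nz by (auto simp: zeros_def)
  have "{iso_class D (\<lambda>a. r a * (s a * v a)) | r. r \<in> torus_reps D} = {iso_class D (\<lambda>a. r a * v a) | r. r \<in> torus_reps D}"
  proof (intro equalityI subsetI)
    fix x assume "x \<in> {iso_class D (\<lambda>a. r a * (s a * v a)) | r. r \<in> torus_reps D}"
    then obtain r where "r \<in> torus_reps D" "x = iso_class D (\<lambda>a. (r a * s a) * v a)" by (auto simp: mult.assoc)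
    then show "x \<in> {iso_class D (\<lambda>a. r a * v a) | r. r \<in> torus_reps D}" using torus_reps_mult[OF _ s(1)]
      by (intro CollectI exI[of _ "\<lambda>a. r a * s a"]) auto
  next
    fix x assume "x \<in> {iso_class D (\<lambda>a. r a * v a) | r. r \<in> torus_reps D}"
    then obtain r where r: "r \<in> torus_reps D" "x = iso_class D (\<lambda>a. r a * v a)" by blast
    have "(\<lambda>a. r a * v a) = (\<lambda>a. (r a * inverse (s a)) * (s a * v a))"
    proof
      fix a show "r a * v a = (r a * inverse (s a)) * (s a * v a)"
        using v nz[of a] by (cases "a \<in> arcs Q") (auto simp: supported_def)
    qed
    then have "x = iso_class D (\<lambda>a. (r a * inverse (s a)) * (s a * v a))" using r(2) by metis
    then show "x \<in> {iso_class D (\<lambda>a. r a * (s a * v a)) | r. r \<in> torus_reps D}"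
      using torus_reps_mult[OF r(1) torus_reps_inverse[OF s(1)]]
      by (intro CollectI exI[of _ "\<lambda>a. r a * inverse (s a)"]) auto
  qed
  then show "torus_orbit D (iso_class D w) = torus_orbit D (iso_class D v)"
    unfolding s(2) torus_orbit_iso_class[OF v] torus_orbit_iso_class[OF sv] .
qed

end

text \<open>The scaling is written exactly as in \<open>weight_dim\<close>, which thereby becomes
  \<open>wv.dim\<close>.\<close>

interpretation wv: vector_space "\<lambda>(c::real) (u::torus_edge \<Rightarrow> real). \<lambda>a. c * u a"
  by unfold_locales (auto simp: fun_eq_iff algebra_simps)

lemma tendsto_fun_iff:
  fixes f :: "'i \<Rightarrow> 'a \<Rightarrow> 'b::topological_space"
  shows "(f \<longlongrightarrow> l) F \<longleftrightarrow> (\<forall>a. ((\<lambda>i. f i a) \<longlongrightarrow> l a) F)"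
  using limitin_componentwise[of "\<lambda>_. euclidean" UNIV f l F] by (simp add: euclidean_product_topology)

context dimer_geometry begin

subsection \<open>Perfect matchings\<close>

definition perfect :: "torus_edge set \<Rightarrow> bool" where
  "perfect M \<longleftrightarrow> M \<subseteq> arcs Q \<and> (\<forall>n\<in>nodes. \<exists>!e. e \<in> edges_at D n \<and> edge_proj e \<in> M)"

definition ind :: "torus_edge set \<Rightarrow> torus_edge \<Rightarrow> int" where
  "ind M a = (if a \<in> M then 1 else 0)"

lemma nsum_single:
  assumes "e \<in> edges_at D n" "\<And>e'. e' \<in> edges_at D n \<Longrightarrow> e' \<noteq> e \<Longrightarrow> f (edge_proj e') = 0"
  shows "nsum f n = f (edge_proj e)"
proof -
  have "nsum f n = f (edge_proj e) + (\<Sum>e'\<in>edges_at D n - {e}. f (edge_proj e'))"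
    unfolding nsum_def by (rule sum.remove[OF finite_edges_at assms(1)])
  also have "(\<Sum>e'\<in>edges_at D n - {e}. f (edge_proj e')) = 0" by (intro sum.neutral) (use assms(2) in auto)
  finally show ?thesis by simp
qed

lemma nsum_perfect:
  assumes "perfect M" "n \<in> nodes" "\<And>a. a \<notin> M \<Longrightarrow> f a = 0"
  shows "\<exists>e\<in>edges_at D n. edge_proj e \<in> M \<and> nsum f n = f (edge_proj e)"
proof -
  obtain e where e: "e \<in> edges_at D n" "edge_proj e \<in> M"
    "\<And>e'. e' \<in> edges_at D n \<Longrightarrow> edge_proj e' \<in> M \<Longrightarrow> e' = e"
    using assms(1,2) unfolding perfect_def by metis
  have "nsum f n = f (edge_proj e)" by (rule nsum_single[OF e(1)]) (use assms(3) e(3) in blast)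
  then show ?thesis using e by blast
qed

lemma nsum_ind: "perfect M \<Longrightarrow> n \<in> nodes \<Longrightarrow> nsum (ind M) n = 1"
  using nsum_perfect[of M n "ind M"] by (auto simp: ind_def)

lemma balanced_nsum:
  fixes k :: "torus_edge \<Rightarrow> 'b::cancel_comm_monoid_add"
  shows "balanced k \<longleftrightarrow> (\<forall>e\<in>edges D. nsum k (fst e) = nsum k (snd e))"
proof -
  have "sum_list (map k (plus_path D e)) = sum_list (map k (minus_path D e)) \<longleftrightarrow> nsum k (fst e) = nsum k (snd e)"
    if "e \<in> edges D" for e
    using plus_path_sum[OF that, of k, symmetric] minus_path_sum[OF that, of k, symmetric] by simp
  then show ?thesis unfolding balanced_def by blast
qed

lemma balanced_nsum_constant:
  fixes k :: "torus_edge \<Rightarrow> 'b::cancel_comm_monoid_add"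
  assumes "balanced k" "n \<in> nodes" "n' \<in> nodes"
  shows "nsum k n = nsum k n'"
  using assms(1) nodes_connected[OF _ assms(2,3), of "nsum k"] balanced_nsum by blast

lemma ind_int_weights:
  assumes "perfect M"
  shows "ind M \<in> int_weights D"
proof -
  have "balanced (ind M)" unfolding balanced_nsum using nsum_ind[OF assms] edge_ends by metis
  then show ?thesis using assms unfolding int_weights_balanced perfect_def ind_def by auto
qed

text \<open>Lets the values of a function supported on a matching be read off from node sums: at the
  white end of \<open>a\<close> no other arrow of \<open>M\<close> occurs.\<close>

lemma perfect_arc_node:
  assumes "perfect M" "a \<in> M"
  shows "\<exists>n\<in>nodes. \<forall>f::torus_edge \<Rightarrow> 'b::comm_monoid_add. (\<forall>b. b \<notin> M \<longrightarrow> f b = 0) \<longrightarrow> nsum f n = f a"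
proof -
  obtain e where e: "e \<in> edges D" "a = edge_proj e" using assms unfolding perfect_def arcs_Q by blast
  have n: "fst e \<in> nodes" "e \<in> edges_at D (fst e)" using edge_ends[OF e(1)] e(1) by (auto simp: edges_at_def)
  have "nsum f (fst e) = f a" if f: "\<forall>b. b \<notin> M \<longrightarrow> f b = 0" for f :: "torus_edge \<Rightarrow> 'b"
  proof -
    have "edge_proj e' \<notin> M" if "e' \<in> edges_at D (fst e)" "e' \<noteq> e" for e'
      using assms n e(2) that unfolding perfect_def by metis
    then show ?thesis unfolding e(2) using f by (intro nsum_single n) auto
  qed
  then show ?thesis using n(1) by blast
qed

lemma perfect_subset_eq:
  assumes "perfect M" "perfect M'" "M \<subseteq> M'"
  shows "M = M'"
proof -
  have "a \<in> M" if a: "a \<in> M'" for a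
  proof -
    obtain n where n: "n \<in> nodes" "\<And>f::torus_edge \<Rightarrow> int. (\<forall>b. b \<notin> M' \<longrightarrow> f b = 0) \<Longrightarrow> nsum f n = f a"
      using perfect_arc_node[OF assms(2) a, where 'b = int] by blast
    have "\<forall>b. b \<notin> M' \<longrightarrow> ind M b = 0" using assms(3) by (auto simp: ind_def)
    then have "ind M a = 1" using n(2)[of "ind M"] nsum_ind[OF assms(1) n(1)] by simp
    then show ?thesis by (simp add: ind_def split: if_splits)
  qed
  then show ?thesis using assms(3) by blast
qed

text \<open>The relations and connectedness of the skeleton make the node sums of \<open>k\<close>
  equal everywhere. So \<open>k\<close> is a regular weight on the finite bipartite graph in the
  torus, whose matchings lift to the cover.\<close>

lemma perfect_matching_through:
  assumes k: "k \<in> int_weights D" "\<And>a. a \<in> arcs Q \<Longrightarrow> k a \<ge> 0" and c: "c \<in> arcs Q" "k c > 0"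
  shows "\<exists>M. perfect M \<and> c \<in> M \<and> M \<subseteq> {a \<in> arcs Q. k a > 0}"
proof -
  obtain ec where ec: "ec \<in> edges D" "c = edge_proj ec" using c unfolding arcs_Q by blast
  define n0 where "n0 = fst ec"
  have n0: "n0 \<in> nodes" using edge_ends[OF ec(1)] by (simp add: n0_def)
  define kn where "kn a = nat (k a)" for a
  have kn: "int (kn a) = k a" if "a \<in> arcs Q" for a using k(2)[OF that] by (simp add: kn_def)
  define h where "h = nsum kn n0"
  have "int (nsum kn n) = nsum k n" for n
    unfolding nsum_def of_nat_sum by (intro sum.cong) (auto simp: kn edges_at_def arcs_Q)
  then have hconst: "nsum kn n = h" if "n \<in> nodes" for n
    using balanced_nsum_constant[of k n n0] k(1) n0 that unfolding int_weights_balanced h_def by (metis of_nat_eq_iff)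
  have hpos: "h > 0"
  proof -
    have "ec \<in> edges_at D n0" using ec(1) by (simp add: edges_at_def n0_def)
    then have "kn (edge_proj ec) \<le> nsum kn n0" unfolding nsum_def using finite_edges_at
      by (intro member_le_sum) auto
    then show ?thesis using c ec(2) by (simp add: h_def kn_def)
  qed
  have edges_at_ne: "edges_at D n \<noteq> {}" if "n \<in> nodes" for n
    using hconst[OF that] hpos unfolding nsum_def by (metis less_irrefl sum.empty)
  \<comment> \<open>The white and the black end of an arrow as points of the torus; all lifts of the
    arrow yield the same points.\<close>
  define wt where "wt a = (THE w. \<exists>e\<in>edges D. edge_proj e = a \<and> w = torus_proj (fst e))" for a
  define bt where "bt a = (THE b. \<exists>e\<in>edges D. edge_proj e = a \<and> b = torus_proj (snd e))" for a
  have same: "torus_proj (fst e) = torus_proj (fst e') \<and> torus_proj (snd e) = torus_proj (snd e')"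
    if "e \<in> edges D" "e' \<in> edges D" "edge_proj e = edge_proj e'" for e e'
    using edge_proj_eq_iff[OF that(1,2)] that(3) torus_proj_add_lattice by auto
  have wt: "wt (edge_proj e) = torus_proj (fst e)" and bt: "bt (edge_proj e) = torus_proj (snd e)" if "e \<in> edges D" for e
    unfolding wt_def bt_def using that same by (intro the_equality; blast)+
  have fibre: "{a \<in> arcs Q. q a = torus_proj n} = edge_proj ` edges_at D n"
    if q: "\<And>e. e \<in> edges D \<Longrightarrow> q (edge_proj e) = torus_proj (p e)" and n: "n \<in> N"
      and pN: "\<And>e. e \<in> edges D \<Longrightarrow> e \<in> edges_at D (p e)" "\<And>e n. e \<in> edges_at D n \<Longrightarrow> n \<in> N \<Longrightarrow> p e = n"
      and ptr: "\<And>e z. p (fst e + z, snd e + z) = p e + z"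
    for q :: "torus_edge \<Rightarrow> complex \<times> complex" and p N n
  proof (intro equalityI subsetI)
    fix a assume "a \<in> {a \<in> arcs Q. q a = torus_proj n}"
    then obtain e where e: "e \<in> edges D" "a = edge_proj e" "torus_proj (p e) = torus_proj n"
      using q unfolding arcs_Q by auto
    define z where "z = n - p e"
    have z: "z \<in> int_lattice" using e(3) torus_proj_eq_iff by (simp add: z_def)
    define e' where "e' = (fst e + z, snd e + z)"
    have e': "e' \<in> edges D" "p e' = n" using edge_translate[OF e(1) z] ptr by (auto simp: e'_def z_def)
    have "edge_proj e' = a" using edge_proj_eq_iff[OF e(1) e'(1)] z e(2) by (auto simp: e'_def)
    then show "a \<in> edge_proj ` edges_at D n" using pN(1)[OF e'(1)] e'(2) by blast
  next
    fix a assume "a \<in> edge_proj ` edges_at D n"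
    then obtain e where e: "e \<in> edges_at D n" "a = edge_proj e" by blast
    then have "e \<in> edges D" by (simp add: edges_at_def)
    then show "a \<in> {a \<in> arcs Q. q a = torus_proj n}" using q[of e] pN(2)[OF e(1) n] e(2) by (simp add: arcs_Q)
  qed
  have fw: "{a \<in> arcs Q. wt a = torus_proj n} = edge_proj ` edges_at D n" if "n \<in> white D" for n
  proof (rule fibre[of wt fst, OF wt that])
    show "fst e = n" if "e \<in> edges_at D n" "n \<in> white D" for e n
      using that edge_ends[of e] white_Int_black unfolding edges_at_def by auto
  qed (auto simp: edges_at_def)
  have fb: "{a \<in> arcs Q. bt a = torus_proj n} = edge_proj ` edges_at D n" if "n \<in> black D" for n
  proof (rule fibre[of bt snd, OF bt that])
    show "snd e = n" if "e \<in> edges_at D n" "n \<in> black D" for e n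
      using that edge_ends[of e] white_Int_black unfolding edges_at_def by auto
  qed (auto simp: edges_at_def)
  have sums: "(\<Sum>a\<in>edge_proj ` edges_at D n. kn a) = h" if "n \<in> nodes" for n
    using hconst[OF that] sum.reindex[OF inj_on_edge_proj, of kn n] by (simp add: nsum_def)
  have "\<exists>M. c \<in> M \<and> M \<subseteq> {a \<in> arcs Q. kn a > 0} \<and> matching_on (arcs Q) wt M \<and> matching_on (arcs Q) bt M"
  proof (rule regular_matching_through[OF finite_arcs _ _ c(1)])
    fix x assume "x \<in> wt ` arcs Q"
    then obtain e where e: "e \<in> edges D" "x = torus_proj (fst e)" using wt unfolding arcs_Q by auto
    then show "(\<Sum>a\<in>{a \<in> arcs Q. wt a = x}. kn a) = h" using fw sums edge_ends[OF e(1)] by simp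
  next
    fix x assume "x \<in> bt ` arcs Q"
    then obtain e where e: "e \<in> edges D" "x = torus_proj (snd e)" using bt unfolding arcs_Q by auto
    then show "(\<Sum>a\<in>{a \<in> arcs Q. bt a = x}. kn a) = h" using fb sums edge_ends[OF e(1)] by simp
  qed (use c(2) in \<open>simp add: kn_def\<close>)
  then obtain M where M: "c \<in> M" "M \<subseteq> {a \<in> arcs Q. kn a > 0}" "matching_on (arcs Q) wt M" "matching_on (arcs Q) bt M"
    by blast
  have "perfect M"
    unfolding perfect_def
  proof (intro conjI ballI)
    fix n assume n: "n \<in> nodes"
    have ex1: "\<exists>!e. e \<in> edges_at D n \<and> edge_proj e \<in> M"
      if q: "matching_on (arcs Q) q M" "{a \<in> arcs Q. q a = torus_proj n} = edge_proj ` edges_at D n" for q :: "torus_edge \<Rightarrow> complex \<times> complex"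
    proof -
      obtain e0 where "e0 \<in> edges_at D n" using edges_at_ne[OF n] by blast
      then have "edge_proj e0 \<in> {a \<in> arcs Q. q a = torus_proj n}" using q(2) by blast
      then have "torus_proj n \<in> q ` arcs Q" by (metis (mono_tags, lifting) imageI mem_Collect_eq)
      then obtain a where a: "a \<in> M" "q a = torus_proj n" "\<And>b. b \<in> M \<Longrightarrow> q b = torus_proj n \<Longrightarrow> b = a"
        using q(1) unfolding matching_on_def by metis
      have "a \<in> arcs Q" using a(1) M(2) by blast
      then obtain e where e: "e \<in> edges_at D n" "a = edge_proj e" using a(2) q(2) by blast
      show ?thesis
      proof (rule ex1I[of _ e])
        fix e' assume e': "e' \<in> edges_at D n \<and> edge_proj e' \<in> M"
        then have "q (edge_proj e') = torus_proj n" using q(2) by blast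
        then have "edge_proj e' = edge_proj e" using a(3) e' e(2) by blast
        then show "e' = e" using inj_on_edge_proj e' e(1) by (auto dest: inj_onD)
      qed (use e a(1) in auto)
    qed
    show "\<exists>!e. e \<in> edges_at D n \<and> edge_proj e \<in> M"
      using n ex1[OF M(3) fw] ex1[OF M(4) fb] unfolding nodes_def by blast
  qed (use M(2) in auto)
  moreover have "M \<subseteq> {a \<in> arcs Q. k a > 0}" using M(2) unfolding kn_def by auto
  ultimately show ?thesis using M(1) by blast
qed

end

context zero_generated_stability begin

subsection \<open>Cones of the fan\<close>

definition unit_orbit :: "torus_edge set \<Rightarrow> (torus_edge \<Rightarrow> complex) set set" where
  "unit_orbit Z = torus_orbit D (iso_class D (unit_rep Z))"

definition cone :: "torus_edge set \<Rightarrow> (torus_edge \<Rightarrow> real) set" where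
  "cone Z = orbit_cone D \<theta> (unit_orbit Z)"

text \<open>The zero sets of those orbits that contain a limit of a one-parameter subgroup. All
  cones of nonzero \<open>weight_dim\<close> arise from such sets.\<close>

definition valid :: "torus_edge set \<Rightarrow> bool" where
  "valid Z \<longleftrightarrow> Z \<subseteq> arcs Q \<and> unit_rep Z \<in> stable_reps D \<theta> \<and> normalized_weights Z \<noteq> {}"

text \<open>The lattice points of the closed cone, in contrast to those of its relative interior in
  \<open>normalized_weights\<close>: zeros inside \<open>Z\<close> are allowed.\<close>

definition face_weights :: "torus_edge set \<Rightarrow> (torus_edge \<Rightarrow> int) set" where
  "face_weights Z = {k \<in> int_weights D. \<exists>m. (\<forall>a\<in>arcs Q. k a + \<delta> m a \<ge> 0) \<and> (\<forall>a\<in>arcs Q - Z. k a + \<delta> m a = 0)}"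

lemma valid_reachable: "valid Z \<Longrightarrow> reachable Z"
  using stable_reps_iff zeros_unit_rep unfolding valid_def by metis

lemma limit_weights_unit_orbit:
  assumes "Z \<subseteq> arcs Q" "unit_rep Z \<in> stable_reps D \<theta>"
  shows "limit_weights D \<theta> (unit_orbit Z) = normalized_weights Z"
proof (intro equalityI subsetI)
  fix k assume "k \<in> limit_weights D \<theta> (unit_orbit Z)"
  then obtain y where k: "k \<in> int_weights D" and y: "y \<in> unit_orbit Z"
    "limitin (moduli_topology D \<theta>) (\<lambda>t. iso_class D (one_parameter D k t)) y (at 0)"
    unfolding limit_weights_def by blast
  have "y \<in> moduli D \<theta>" using limitin_topspace[OF y(2)] topspace_moduli by simp
  then obtain w where w: "w \<in> stable_reps D \<theta>" "y = iso_class D w" unfolding moduli_def by blast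
  have "zeros w = zeros (unit_rep Z)"
    using torus_orbit_eq(2)[OF supported_unit_rep stable_reps_supported[OF w(1)]] y(1) w(2)
    unfolding unit_orbit_def by blast
  then show "k \<in> normalized_weights Z"
    using limit_one_parameter[OF k w(1)] y(2) w(2) zeros_unit_rep[OF assms(1)] by simp
next
  fix k assume k: "k \<in> normalized_weights Z"
  have "iso_class D (unit_rep Z) \<in> unit_orbit Z"
    unfolding unit_orbit_def by (rule iso_class_in_torus_orbit[OF supported_unit_rep])
  then show "k \<in> limit_weights D \<theta> (unit_orbit Z)"
    using limit_one_parameterI[OF assms(2,1) k] k unfolding limit_weights_def normalized_weights_def by blast
qed

lemma orbit_is_unit_orbit:
  assumes "Orb \<in> torus_orbits D \<theta>" "limit_weights D \<theta> Orb \<noteq> {}"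
  shows "\<exists>Z. valid Z \<and> Orb = unit_orbit Z"
proof -
  obtain v where v: "v \<in> stable_reps D \<theta>" "Orb = torus_orbit D (iso_class D v)"
    using assms(1) unfolding torus_orbits_def moduli_def by blast
  obtain k y where k: "k \<in> int_weights D" and y: "y \<in> Orb"
    "limitin (moduli_topology D \<theta>) (\<lambda>t. iso_class D (one_parameter D k t)) y (at 0)"
    using assms(2) unfolding limit_weights_def by blast
  have "y \<in> moduli D \<theta>" using limitin_topspace[OF y(2)] topspace_moduli by simp
  then obtain w where w: "w \<in> stable_reps D \<theta>" "y = iso_class D w" unfolding moduli_def by blast
  have lim: "k \<in> normalized_weights (zeros w)" "unit_rep (zeros w) \<in> iso_class D w"
    using limit_one_parameter[OF k w(1)] y(2) w(2) by simp_all
  have "torus_orbit D (iso_class D w) = Orb"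
    using torus_orbit_eq(1)[OF stable_reps_supported[OF v(1)] stable_reps_supported[OF w(1)]] y(1) w(2) v(2) by blast
  then have "Orb = unit_orbit (zeros w)"
    using iso_class_eq[OF stable_reps_supported[OF w(1)] lim(2)] by (simp add: unit_orbit_def)
  moreover have "valid (zeros w)"
    using lim stable_reps_iso_class[OF w(1)] unfolding valid_def zeros_def by blast
  ultimately show ?thesis by blast
qed

lemma cone_eq:
  assumes "valid Z"
  shows "cone Z = closure {\<lambda>a. \<Sum>k\<in>K. c k * real_of_int (k a) | K c.
    finite K \<and> K \<subseteq> normalized_weights Z \<and> (\<forall>k\<in>K. c k \<ge> 0)}"
  using limit_weights_unit_orbit assms unfolding cone_def orbit_cone_def valid_def by simp

text \<open>An orbit containing no limit has only the zero weight in its cone, which a positive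
  dimension excludes.\<close>

lemma fan_cone_is_cone:
  assumes "Orb \<in> torus_orbits D \<theta>" "weight_dim (orbit_cone D \<theta> Orb) > 0"
  shows "\<exists>Z. valid Z \<and> Orb = unit_orbit Z"
proof (rule orbit_is_unit_orbit[OF assms(1)])
  show "limit_weights D \<theta> Orb \<noteq> {}"
  proof
    assume e: "limit_weights D \<theta> Orb = {}"
    have "closed {x :: torus_edge \<Rightarrow> real. \<forall>a. x a = 0}"
      by (intro closed_Collect_all closed_Collect_eq continuous_on_product_then_coordinatewise[OF continuous_on_id] continuous_on_const)
    then have "orbit_cone D \<theta> Orb \<subseteq> {x. \<forall>a. x a = 0}"
      unfolding orbit_cone_def e by (intro closure_minimal) auto
    also have "\<dots> = {0}" by (auto simp: fun_eq_iff)
    finally have "orbit_cone D \<theta> Orb \<subseteq> wv.span {}" by simp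
    then have "weight_dim (orbit_cone D \<theta> Orb) \<le> 0"
      unfolding weight_dim_def using wv.dim_le_card[of _ "{}"] by fastforce
    then show False using assms(2) by simp
  qed
qed

lemma fan_cones_cone:
  assumes "\<sigma> \<in> fan_cones D \<theta> d" "d > 0"
  shows "\<exists>Z. valid Z \<and> \<sigma> = cone Z"
proof -
  obtain Orb where "Orb \<in> torus_orbits D \<theta>" "\<sigma> = orbit_cone D \<theta> Orb" "weight_dim \<sigma> > 0"
    using assms unfolding fan_cones_def fan_def by auto
  then show ?thesis using fan_cone_is_cone unfolding cone_def by metis
qed

section \<open>Normalisation of weights along walks\<close>

lemma sum_list_combination:
  "sum_list (map (\<lambda>a. \<Sum>k\<in>K. c k * real_of_int (k a)) p) = (\<Sum>k\<in>K. c k * real_of_int (sum_list (map k p)))"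
  by (induction p) (auto simp: sum.distrib distrib_left)

text \<open>Vanishing outside \<open>Z\<close> determines \<open>m\<close> up to a constant by the
  sums of \<open>k\<close> along walks from \<open>i0\<close>. This normalisation is linear and
  continuous in \<open>k\<close>, so it passes to combinations and limits.\<close>

lemma normalized_along_walks:
  fixes k :: "torus_edge \<Rightarrow> 'b::ab_group_add"
  assumes p: "\<And>j. j \<in> verts Q \<Longrightarrow> walk Z i0 (p j) j"
    and m: "\<And>a. a \<in> arcs Q - Z \<Longrightarrow> k a + \<delta> m a = 0" and a: "a \<in> arcs Q"
  shows "k a + \<delta> (\<lambda>j. - sum_list (map k (p j))) a = k a + \<delta> m (a :: torus_edge)"
proof -
  have "m j = m i0 - sum_list (map k (p j))" if "j \<in> verts Q" for j
  proof -
    have "sum_list (map (\<lambda>a. k a + \<delta> m a) (p j)) = 0" by (rule walk_sum_eq_0[OF p[OF that] m])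
    then have "sum_list (map k (p j)) + (m j - m i0) = 0"
      using cas_sum[of i0 "p j" j m] p[OF that] by (simp add: sum_list_addf walk_def)
    then have "m j - m i0 = - sum_list (map k (p j))" by (simp only: add_eq_0_iff)
    then show ?thesis by (simp add: diff_eq_eq)
  qed
  from this[OF head_in_verts[OF a]] this[OF tail_in_verts[OF a]] show ?thesis by (simp add: \<delta>_def algebra_simps)
qed

text \<open>With the walks fixed, all four conclusions are closed conditions on \<open>x\<close>.
  They hold for nonnegative combinations of normalised weights and hence on the closure.\<close>

lemma cone_normalized:
  assumes Z: "valid Z" and p: "\<And>j. j \<in> verts Q \<Longrightarrow> walk Z i0 (p j) j" and x: "x \<in> cone Z"
  defines "m \<equiv> \<lambda>j. - sum_list (map x (p j))"
  shows "\<forall>a\<in>arcs Q. x a + \<delta> m a \<ge> 0" "\<forall>a\<in>arcs Q - Z. x a + \<delta> m a = 0"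
    "\<forall>a. a \<notin> arcs Q \<longrightarrow> x a = 0" "balanced x"
proof -
  define \<phi> where "\<phi> x a = x a + \<delta> (\<lambda>j. - sum_list (map x (p j))) a" for x :: "torus_edge \<Rightarrow> real" and a
  define S where "S = (\<Inter>a\<in>arcs Q. {x. \<phi> x a \<ge> 0}) \<inter> (\<Inter>a\<in>arcs Q - Z. {x. \<phi> x a = 0}) \<inter>
    (\<Inter>a\<in>- arcs Q. {x. x a = 0}) \<inter>
    (\<Inter>e\<in>edges D. {x. sum_list (map x (plus_path D e)) = sum_list (map x (minus_path D e))})"
  have c1: "continuous_on UNIV (\<lambda>x::torus_edge \<Rightarrow> real. x a)" for a
    by (rule continuous_on_product_then_coordinatewise[OF continuous_on_id])
  have c2: "continuous_on UNIV (\<lambda>x::torus_edge \<Rightarrow> real. sum_list (map x q))" for q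
    by (induction q) (auto intro!: continuous_intros c1)
  have c3: "continuous_on UNIV (\<lambda>x. \<phi> x a)" for a
    unfolding \<phi>_def \<delta>_def by (intro continuous_intros c1 c2)
  have "closed S"
    unfolding S_def
    by (intro closed_Int closed_INT ballI closed_Collect_le closed_Collect_eq continuous_on_const c1 c2 c3)
  moreover have "{\<lambda>a. \<Sum>k\<in>K. c k * real_of_int (k a) | K c.
      finite K \<and> K \<subseteq> normalized_weights Z \<and> (\<forall>k\<in>K. c k \<ge> 0)} \<subseteq> S"
  proof
    fix y assume "y \<in> {\<lambda>a. \<Sum>k\<in>K. c k * real_of_int (k a) | K c.
      finite K \<and> K \<subseteq> normalized_weights Z \<and> (\<forall>k\<in>K. c k \<ge> 0)}"
    then obtain K c where K: "finite K" "K \<subseteq> normalized_weights Z" "\<forall>k\<in>K. c k \<ge> 0"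
      and y: "y = (\<lambda>a. \<Sum>k\<in>K. c k * real_of_int (k a))" by auto
    have \<phi>y: "\<phi> y a = (\<Sum>k\<in>K. c k * real_of_int (k a + \<delta> (\<lambda>j. - sum_list (map k (p j))) a))" for a
      unfolding \<phi>_def \<delta>_def y sum_list_combination
      by (simp add: sum.distrib distrib_left right_diff_distrib sum_subtractf sum_negf)
    have k: "k a + \<delta> (\<lambda>j. - sum_list (map k (p j))) a \<ge> 0"
      "a \<notin> Z \<Longrightarrow> k a + \<delta> (\<lambda>j. - sum_list (map k (p j))) a = 0"
      if kK: "k \<in> K" and a: "a \<in> arcs Q" for k a
    proof -
      obtain m where m: "\<forall>a\<in>arcs Q. k a + \<delta> m a \<ge> 0" "\<forall>a\<in>arcs Q. k a + \<delta> m a = 0 \<longleftrightarrow> a \<notin> Z"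
        using K(2) kK unfolding normalized_weights_def by auto
      have "k a + \<delta> (\<lambda>j. - sum_list (map k (p j))) a = k a + \<delta> m a"
        by (rule normalized_along_walks[OF p _ a]) (use m in auto)
      then show "k a + \<delta> (\<lambda>j. - sum_list (map k (p j))) a \<ge> 0"
        "a \<notin> Z \<Longrightarrow> k a + \<delta> (\<lambda>j. - sum_list (map k (p j))) a = 0" using m a by auto
    qed
    have iw: "K \<subseteq> int_weights D" using K(2) unfolding normalized_weights_def by blast
    show "y \<in> S"
      unfolding S_def
    proof (intro IntI INT_I CollectI)
      fix a assume "a \<in> arcs Q"
      then show "0 \<le> \<phi> y a" unfolding \<phi>y
        using K(3) k(1) by (intro sum_nonneg mult_nonneg_nonneg) (simp_all only: of_int_0_le_iff)
    next
      fix a assume "a \<in> arcs Q - Z"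
      then show "\<phi> y a = 0" unfolding \<phi>y using k(2) by (intro sum.neutral) auto
    next
      fix a assume "a \<in> - arcs Q"
      then show "y a = 0" unfolding y using iw by (intro sum.neutral) (auto simp: int_weights_def)
    next
      fix e assume "e \<in> edges D"
      then show "sum_list (map y (plus_path D e)) = sum_list (map y (minus_path D e))"
        unfolding y sum_list_combination using iw by (intro sum.cong) (auto simp: int_weights_def)
    qed
  qed
  ultimately have "cone Z \<subseteq> S" unfolding cone_eq[OF Z] by (rule closure_minimal[rotated])
  then have "x \<in> S" using x by blast
  then show "\<forall>a\<in>arcs Q. x a + \<delta> m a \<ge> 0" "\<forall>a\<in>arcs Q - Z. x a + \<delta> m a = 0"
    "\<forall>a. a \<notin> arcs Q \<longrightarrow> x a = 0" "balanced x"
    unfolding S_def \<phi>_def m_def balanced_def by auto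
qed

lemma reachable_walks: "reachable Z \<Longrightarrow> \<exists>p. \<forall>j\<in>verts Q. walk Z i0 (p j) j"
  unfolding reachable_def by (rule bchoice)

text \<open>For an integral point the normalising potential consists of sums of integers along
  walks, so it is integral as well.\<close>

lemma face_weights_of_cone:
  assumes Z: "valid Z" and k: "k \<in> int_weights D" "(\<lambda>a. real_of_int (k a)) \<in> cone Z"
  shows "k \<in> face_weights Z"
proof -
  obtain p where p: "\<And>j. j \<in> verts Q \<Longrightarrow> walk Z i0 (p j) j" using reachable_walks[OF valid_reachable[OF Z]] by blast
  have sl: "sum_list (map (\<lambda>a. real_of_int (k a)) q) = real_of_int (sum_list (map k q))" for q
    by (induction q) auto
  have eq: "real_of_int (k a) + \<delta> (\<lambda>j. - sum_list (map (\<lambda>a. real_of_int (k a)) (p j))) a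
      = real_of_int (k a + \<delta> (\<lambda>j. - sum_list (map k (p j))) a)" for a
    unfolding sl \<delta>_def by simp
  have "\<forall>a\<in>arcs Q. k a + \<delta> (\<lambda>j. - sum_list (map k (p j))) a \<ge> 0"
    "\<forall>a\<in>arcs Q - Z. k a + \<delta> (\<lambda>j. - sum_list (map k (p j))) a = 0"
    using cone_normalized(1,2)[OF Z p k(2)] unfolding eq of_int_0_le_iff of_int_eq_0_iff by blast+
  then show ?thesis unfolding face_weights_def using k(1) by blast
qed

lemma closed_cone: "closed (cone Z)"
  unfolding cone_def orbit_cone_def by simp

text \<open>With \<open>\<kappa>\<close> in the relative interior, every
  \<open>\<kappa> + (n + 1) * k\<close> is normalised. Dividing by \<open>n + 1\<close> and letting
  \<open>n\<close> grow recovers \<open>k\<close> as a limit of points of the cone.\<close>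

lemma face_combination_in_cone:
  assumes Z: "valid Z" and K: "finite K" "K \<subseteq> face_weights Z" "\<forall>k\<in>K. c k \<ge> 0"
  shows "(\<lambda>a. \<Sum>k\<in>K. c k * real_of_int (k a)) \<in> cone Z"
proof -
  obtain \<kappa> where \<kappa>: "\<kappa> \<in> normalized_weights Z" using Z unfolding valid_def by blast
  define x where "x = (\<lambda>n a. \<Sum>k\<in>K. c k / real (Suc n) * real_of_int (\<kappa> a + int (Suc n) * k a))"
  have "x n \<in> cone Z" for n
  proof -
    define h where "h k = (\<lambda>a. \<kappa> a + int (Suc n) * k a)" for k
    have inj: "inj_on h K"
    proof (rule inj_onI)
      fix k k' assume "h k = h k'"
      then have "\<kappa> a + int (Suc n) * k a = \<kappa> a + int (Suc n) * k' a" for a unfolding h_def by metis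
      then show "k = k'" by auto
    qed
    have hN: "h k \<in> normalized_weights Z" if kK: "k \<in> K" for k
    proof -
      obtain m where m: "\<forall>a\<in>arcs Q. \<kappa> a + \<delta> m a \<ge> 0" "\<forall>a\<in>arcs Q. \<kappa> a + \<delta> m a = 0 \<longleftrightarrow> a \<notin> Z"
        using \<kappa> unfolding normalized_weights_def by auto
      obtain m' where m': "\<forall>a\<in>arcs Q. k a + \<delta> m' a \<ge> 0" "\<forall>a\<in>arcs Q - Z. k a + \<delta> m' a = 0"
        using K(2) kK unfolding face_weights_def by auto
      have iw: "\<kappa> \<in> int_weights D" "k \<in> int_weights D"
        using \<kappa> K(2) kK unfolding normalized_weights_def face_weights_def by auto
      have "sum_list (map (h k) q) = sum_list (map \<kappa> q) + int (Suc n) * sum_list (map k q)" for q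
        unfolding h_def by (simp only: sum_list_addf sum_list_const_mult)
      then have "h k \<in> int_weights D" using iw by (simp add: int_weights_def h_def)
      moreover have eq: "h k a + \<delta> (\<lambda>j. m j + int (Suc n) * m' j) a = (\<kappa> a + \<delta> m a) + int (Suc n) * (k a + \<delta> m' a)" for a
        unfolding h_def \<delta>_def by (simp only: algebra_simps)
      have "\<forall>a\<in>arcs Q. h k a + \<delta> (\<lambda>j. m j + int (Suc n) * m' j) a \<ge> 0"
      proof
        fix a assume a: "a \<in> arcs Q"
        have "0 \<le> int (Suc n) * (k a + \<delta> m' a)" using m'(1) a by (intro mult_nonneg_nonneg) auto
        moreover have "0 \<le> \<kappa> a + \<delta> m a" using m(1) a by blast
        ultimately show "h k a + \<delta> (\<lambda>j. m j + int (Suc n) * m' j) a \<ge> 0"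
          unfolding eq by (rule add_nonneg_nonneg[rotated])
      qed
      moreover have "\<forall>a\<in>arcs Q. h k a + \<delta> (\<lambda>j. m j + int (Suc n) * m' j) a = 0 \<longleftrightarrow> a \<notin> Z"
      proof
        fix a assume a: "a \<in> arcs Q"
        have "(\<kappa> a + \<delta> m a) + int (Suc n) * (k a + \<delta> m' a) = 0 \<longleftrightarrow> \<kappa> a + \<delta> m a = 0 \<and> int (Suc n) * (k a + \<delta> m' a) = 0"
        proof (rule add_nonneg_eq_0_iff)
          show "0 \<le> int (Suc n) * (k a + \<delta> m' a)" using m'(1) a by (intro mult_nonneg_nonneg) auto
        qed (use m(1) a in blast)
        then show "h k a + \<delta> (\<lambda>j. m j + int (Suc n) * m' j) a = 0 \<longleftrightarrow> a \<notin> Z"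
          unfolding eq using m(2) m'(2) a by auto
      qed
      ultimately show ?thesis unfolding normalized_weights_def by blast
    qed
    have "x n = (\<lambda>a. \<Sum>k\<in>h ` K. (c (inv_into K h k) / real (Suc n)) * real_of_int (k a))"
      unfolding sum.reindex[OF inj] o_def x_def h_def[symmetric]
    proof
      fix a
      show "(\<Sum>k\<in>K. c k / real (Suc n) * real_of_int (\<kappa> a + int (Suc n) * k a)) =
          (\<Sum>k\<in>K. c (inv_into K h (h k)) / real (Suc n) * real_of_int (h k a))"
      proof (rule sum.cong[OF refl])
        fix k assume "k \<in> K"
        then have "inv_into K h (h k) = k" by (rule inv_into_f_f[OF inj])
        then show "c k / real (Suc n) * real_of_int (\<kappa> a + int (Suc n) * k a) =
            c (inv_into K h (h k)) / real (Suc n) * real_of_int (h k a)" by (simp only: h_def)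
      qed
    qed
    moreover have "finite (h ` K)" "h ` K \<subseteq> normalized_weights Z" using K(1) hN by auto
    moreover have "\<forall>k\<in>h ` K. c (inv_into K h k) / real (Suc n) \<ge> 0" using K(3) by (auto simp: inv_into_f_f[OF inj])
    ultimately have "x n \<in> {\<lambda>a. \<Sum>k\<in>K. c k * real_of_int (k a) | K c.
        finite K \<and> K \<subseteq> normalized_weights Z \<and> (\<forall>k\<in>K. c k \<ge> 0)}"
      by (intro CollectI exI[of _ "h ` K"] exI[of _ "\<lambda>k. c (inv_into K h k) / real (Suc n)"] conjI)
    then show ?thesis unfolding cone_eq[OF Z] by (rule subsetD[OF closure_subset])
  qed
  moreover have "x \<longlonglongrightarrow> (\<lambda>a. \<Sum>k\<in>K. c k * real_of_int (k a))"
    unfolding tendsto_fun_iff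
  proof
    fix a
    have "x n a = (\<Sum>k\<in>K. c k * real_of_int (k a) + (c k * real_of_int (\<kappa> a)) * inverse (real (Suc n)))" for n
    proof -
      have "c k / real (Suc n) * real_of_int (\<kappa> a + int (Suc n) * k a) = c k * real_of_int (k a) + (c k * real_of_int (\<kappa> a)) * inverse (real (Suc n))" for k
      proof -
        have "d / N * (u + N * v) = d * v + (d * u) * inverse N" if "N \<noteq> 0" for d N u v :: real
          using that by (simp add: field_simps)
        from this[of "real (Suc n)" "c k" "real_of_int (\<kappa> a)" "real_of_int (k a)"]
        show ?thesis by (simp del: of_nat_Suc)
      qed
      then show ?thesis by (simp only: x_def)
    qed
    moreover have "(\<lambda>n. \<Sum>k\<in>K. c k * real_of_int (k a) + (c k * real_of_int (\<kappa> a)) * inverse (real (Suc n)))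
        \<longlonglongrightarrow> (\<Sum>k\<in>K. c k * real_of_int (k a) + (c k * real_of_int (\<kappa> a)) * 0)"
      by (intro tendsto_intros LIMSEQ_inverse_real_of_nat)
    ultimately show "(\<lambda>n. x n a) \<longlonglongrightarrow> (\<Sum>k\<in>K. c k * real_of_int (k a))" by simp
  qed
  ultimately show ?thesis using closed_cone Lim_in_closed_set[of "cone Z" x sequentially] by simp
qed

lemma face_weight_in_cone:
  assumes "valid Z" "k \<in> face_weights Z"
  shows "(\<lambda>a. real_of_int (k a)) \<in> cone Z"
  using face_combination_in_cone[OF assms(1), of "{k}" "\<lambda>_. 1"] assms(2) by simp

lemma face_weights_mono: "Z \<subseteq> Z' \<Longrightarrow> face_weights Z \<subseteq> face_weights Z'"
  unfolding face_weights_def by blast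

lemma normalized_face_weights: "normalized_weights Z \<subseteq> face_weights Z"
  unfolding normalized_weights_def face_weights_def by auto

lemma cone_mono:
  assumes "valid Z" "valid Z'" "Z \<subseteq> Z'"
  shows "cone Z \<subseteq> cone Z'"
  unfolding cone_eq[OF assms(1)]
proof (rule closure_minimal[OF subsetI closed_cone])
  fix x assume "x \<in> {\<lambda>a. \<Sum>k\<in>K. c k * real_of_int (k a) | K c.
    finite K \<and> K \<subseteq> normalized_weights Z \<and> (\<forall>k\<in>K. c k \<ge> 0)}"
  then obtain K c where K: "finite K" "K \<subseteq> normalized_weights Z" "\<forall>k\<in>K. c k \<ge> 0"
    and x: "x = (\<lambda>a. \<Sum>k\<in>K. c k * real_of_int (k a))" by auto
  have "K \<subseteq> face_weights Z'"
    using K(2) normalized_face_weights[of Z] face_weights_mono[OF assms(3)] by (rule subset_trans[OF _ subset_trans])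
  then show "x \<in> cone Z'" unfolding x using face_combination_in_cone[OF assms(2) K(1) _ K(3)] by simp
qed

text \<open>Along a walk from \<open>i0\<close> outside \<open>Z\<close> the weight shifted by
  \<open>m\<close> sums to zero, while the one shifted by \<open>m'\<close> has nonnegative sum.
  This bounds \<open>m j - m i0\<close> by \<open>m' j - m' i0\<close>, and exchanging the roles
  gives equality.\<close>

lemma normalization_unique:
  fixes k :: "torus_edge \<Rightarrow> int"
  assumes "reachable Z" "reachable Z'" "a \<in> arcs Q"
    and m: "\<And>a. a \<in> arcs Q \<Longrightarrow> k a + \<delta> m a \<ge> 0" "\<And>a. a \<in> arcs Q - Z \<Longrightarrow> k a + \<delta> m a = 0"
    and m': "\<And>a. a \<in> arcs Q \<Longrightarrow> k a + \<delta> m' a \<ge> 0" "\<And>a. a \<in> arcs Q - Z' \<Longrightarrow> k a + \<delta> m' a = 0"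
  shows "\<delta> m a = \<delta> m' a"
proof -
  have le: "m j - m i0 \<le> m' j - m' i0"
    if Z: "reachable Z" and m: "\<And>a. a \<in> arcs Q - Z \<Longrightarrow> k a + \<delta> m a = 0"
      and m': "\<And>a. a \<in> arcs Q \<Longrightarrow> k a + \<delta> m' a \<ge> 0" and j: "j \<in> verts Q" for m m' :: "torus_tile \<Rightarrow> int" and Z j
  proof -
    obtain p where p: "walk Z i0 p j" using Z j unfolding reachable_def by blast
    then have cas: "pre_digraph.cas Q i0 p j" and sub: "set p \<subseteq> arcs Q" unfolding walk_def by auto
    have "sum_list (map (\<lambda>a. k a + \<delta> m a) p) = 0" by (rule walk_sum_eq_0[OF p m])
    moreover have "sum_list (map (\<lambda>a. k a + \<delta> m' a) p) \<ge> 0" using sub m' by (intro sum_list_nonneg) auto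
    ultimately show ?thesis using cas_sum[OF cas, of m] cas_sum[OF cas, of m'] by (simp add: sum_list_addf)
  qed
  have "m j - m i0 = m' j - m' i0" if j: "j \<in> verts Q" for j
    using le[OF assms(1) m(2) m'(1) j] le[OF assms(2) m'(2) m(1) j] by simp
  from this[OF head_in_verts[OF assms(3)]] this[OF tail_in_verts[OF assms(3)]] show ?thesis unfolding \<delta>_def by simp
qed

lemma normalized_in_face:
  assumes "reachable Z" "reachable Z'" "k \<in> normalized_weights Z" "k \<in> face_weights Z'" "Z \<subseteq> arcs Q"
  shows "Z \<subseteq> Z'"
proof
  fix a assume a: "a \<in> Z"
  obtain m where m: "\<forall>a\<in>arcs Q. k a + \<delta> m a \<ge> 0" "\<forall>a\<in>arcs Q. k a + \<delta> m a = 0 \<longleftrightarrow> a \<notin> Z"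
    using assms(3) unfolding normalized_weights_def by auto
  obtain m' where m': "\<forall>a\<in>arcs Q. k a + \<delta> m' a \<ge> 0" "\<forall>a\<in>arcs Q - Z'. k a + \<delta> m' a = 0"
    using assms(4) unfolding face_weights_def by auto
  have aQ: "a \<in> arcs Q" using a assms(5) by blast
  have "\<delta> m a = \<delta> m' a"
    by (rule normalization_unique[OF assms(1,2) aQ, of k]) (use m m' in auto)
  then show "a \<in> Z'" using m(2) m'(2) aQ a by (metis DiffI)
qed

text \<open>A lattice point in the relative interior of the smaller cone lies in the larger one, and
  its unique normalisation compares the supports. In particular a cone determines its zero
  set.\<close>

lemma cone_subset_imp:
  assumes "valid Z" "valid Z'" "cone Z \<subseteq> cone Z'"
  shows "Z \<subseteq> Z'"
proof -
  obtain k where k: "k \<in> normalized_weights Z" using assms(1) unfolding valid_def by blast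
  then have "(\<lambda>a. real_of_int (k a)) \<in> cone Z'"
    using face_weight_in_cone[OF assms(1)] normalized_face_weights assms(3) by blast
  then have "k \<in> face_weights Z'"
    using face_weights_of_cone[OF assms(2)] k unfolding normalized_weights_def by blast
  then show ?thesis using normalized_in_face[OF valid_reachable[OF assms(1)] valid_reachable[OF assms(2)] k] assms(1)
    unfolding valid_def by blast
qed

text \<open>Positive dimension gives uniqueness in the definite description: it makes every orbit
  with this cone come from a valid set, and the cone determines that set.\<close>

lemma orbit_of_cone:
  assumes Z: "valid Z" and d: "cone Z \<in> fan_cones D \<theta> d" "d > 0"
  shows "orbit_of D \<theta> (cone Z) = unit_orbit Z"
  unfolding orbit_of_def
proof (rule the_equality)
  have "iso_class D (unit_rep Z) \<in> moduli D \<theta>" using Z unfolding valid_def moduli_def by blast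
  then show "unit_orbit Z \<in> torus_orbits D \<theta> \<and> orbit_cone D \<theta> (unit_orbit Z) = cone Z"
    unfolding unit_orbit_def torus_orbits_def cone_def by blast
  fix Orb assume Orb: "Orb \<in> torus_orbits D \<theta> \<and> orbit_cone D \<theta> Orb = cone Z"
  have "weight_dim (cone Z) > 0" using d unfolding fan_cones_def by auto
  then obtain Z' where Z': "valid Z'" "Orb = unit_orbit Z'" using fan_cone_is_cone Orb by metis
  then have "cone Z' = cone Z" using Orb by (simp add: cone_def)
  then have "Z' = Z" using cone_subset_imp[OF Z Z'(1)] cone_subset_imp[OF Z'(1) Z] by blast
  then show "Orb = unit_orbit Z" using Z'(2) by simp
qed

lemma ray_matching_cone:
  assumes Z: "valid Z" and d: "cone Z \<in> fan_cones D \<theta> d" "d > 0"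
  shows "ray_matching D \<theta> (cone Z) = Z"
proof -
  define v where "v = (SOME v. v \<in> stable_reps D \<theta> \<and> iso_class D v \<in> unit_orbit Z)"
  have "unit_rep Z \<in> stable_reps D \<theta> \<and> iso_class D (unit_rep Z) \<in> unit_orbit Z"
    using Z iso_class_in_torus_orbit[OF supported_unit_rep] unfolding valid_def unit_orbit_def by blast
  then have v: "v \<in> stable_reps D \<theta>" "iso_class D v \<in> unit_orbit Z"
    unfolding v_def by (metis (mono_tags, lifting) someI_ex)+
  have "zeros v = zeros (unit_rep Z)"
    using torus_orbit_eq(2)[OF supported_unit_rep stable_reps_supported[OF v(1)]] v(2) unfolding unit_orbit_def by blast
  also have "\<dots> = Z" using Z zeros_unit_rep unfolding valid_def by blast
  finally show ?thesis
    unfolding ray_matching_def orbit_of_cone[OF assms] Let_def v_def[symmetric] zeros_def .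
qed


subsection \<open>Rays and perfect matchings\<close>

text \<open>For nonnegative \<open>k\<close> the product along a path is 1 if the sum of
  \<open>k\<close> along it is zero, and 0 otherwise; the sums along both paths of a relation
  agree.\<close>

lemma unit_rep_reps:
  assumes k: "k \<in> int_weights D" "\<And>a. a \<in> arcs Q \<Longrightarrow> k a \<ge> 0"
  shows "unit_rep {a \<in> arcs Q. k a \<noteq> 0} \<in> reps D"
proof -
  have *: "prod_list (map (unit_rep {a \<in> arcs Q. k a \<noteq> 0}) p) = (if sum_list (map k p) = 0 then 1 else 0)"
    if "set p \<subseteq> arcs Q" for p
    using that
  proof (induction p)
    case (Cons a p)
    have "\<And>b. b \<in> set p \<Longrightarrow> k b \<ge> 0" using Cons.prems by (intro k(2)) auto
    then have "k a \<ge> 0" "sum_list (map k p) \<ge> 0" using Cons.prems k(2)[of a] by (auto intro!: sum_list_nonneg)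
    then show ?case using Cons by (auto simp: unit_rep_def)
  qed simp
  have "sum_list (map k (plus_path D e)) = sum_list (map k (minus_path D e))" if "e \<in> edges D" for e
    using k(1) that by (simp add: int_weights_def)
  then show ?thesis using *[OF plus_path_arcs] *[OF minus_path_arcs] by (auto simp: reps_def unit_rep_def)
qed

lemma ind_face_weights: "perfect M \<Longrightarrow> M \<subseteq> Z \<Longrightarrow> ind M \<in> face_weights Z"
  unfolding face_weights_def using ind_int_weights
  by (auto intro!: exI[of _ "\<lambda>_. 0"] simp: \<delta>_def ind_def)

lemma valid_perfect:
  assumes "valid Z" "perfect M" "M \<subseteq> Z"
  shows "valid M"
proof -
  have M: "M \<subseteq> arcs Q" using assms(2) by (simp add: perfect_def)
  then have "{a \<in> arcs Q. ind M a \<noteq> 0} = M" by (auto simp: ind_def)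
  then have "unit_rep M \<in> reps D" using unit_rep_reps[OF ind_int_weights[OF assms(2)]] by (simp add: ind_def)
  moreover have "reachable M" using valid_reachable[OF assms(1)] assms(3) by (rule reachable_mono)
  ultimately have "unit_rep M \<in> stable_reps D \<theta>" using zeros_unit_rep[OF M] by (simp add: stable_reps_iff)
  moreover have "ind M \<in> normalized_weights M"
    unfolding normalized_weights_def using ind_int_weights[OF assms(2)]
    by (auto intro!: exI[of _ "\<lambda>_. 0"] simp: \<delta>_def ind_def)
  ultimately show ?thesis using M unfolding valid_def by blast
qed

text \<open>After normalisation, a weight from the relative interior is nonnegative with support
  exactly \<open>Z\<close>, so every matching within its support lies in \<open>Z\<close>.\<close>

lemma perfect_through:
  assumes Z: "valid Z" and a: "a \<in> Z"
  shows "\<exists>M. perfect M \<and> a \<in> M \<and> M \<subseteq> Z"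
proof -
  obtain k where k: "k \<in> normalized_weights Z" using Z unfolding valid_def by blast
  then obtain m where m: "\<forall>a\<in>arcs Q. k a + \<delta> m a \<ge> 0" "\<forall>a\<in>arcs Q. k a + \<delta> m a = 0 \<longleftrightarrow> a \<notin> Z"
    unfolding normalized_weights_def by auto
  have aQ: "a \<in> arcs Q" using Z a unfolding valid_def by blast
  define k' where "k' = (\<lambda>a. if a \<in> arcs Q then k a + \<delta> m a else 0)"
  have "k' \<in> int_weights D" unfolding k'_def using k by (intro int_weights_add_\<delta>) (simp add: normalized_weights_def)
  moreover have "k' b \<ge> 0" if "b \<in> arcs Q" for b using m(1) that by (simp add: k'_def)
  moreover have "k' a > 0"
  proof -
    have "k a + \<delta> m a \<noteq> 0" "k a + \<delta> m a \<ge> 0" using m aQ a by auto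
    then show ?thesis using aQ by (simp add: k'_def)
  qed
  ultimately obtain M where M: "perfect M" "a \<in> M" "M \<subseteq> {a \<in> arcs Q. k' a > 0}"
    using perfect_matching_through[of k' a] aQ by blast
  have "b \<in> Z" if "b \<in> M" for b
  proof -
    have "b \<in> arcs Q" "k b + \<delta> m b > 0" using M(3) that by (auto simp: k'_def)
    then show ?thesis using m(2) by force
  qed
  then show ?thesis using M by blast
qed

lemma arcs_nonempty: "arcs Q \<noteq> {}"
  using verts_are_ends i0 by auto

lemma perfect_nonempty: "perfect M \<Longrightarrow> M \<noteq> {}"
proof
  assume M: "perfect M" "M = {}"
  obtain e where e: "e \<in> edges D" using arcs_nonempty unfolding arcs_Q by blast
  then have "fst e \<in> nodes" using edge_ends by blast
  then show False using M unfolding perfect_def by blast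
qed

lemma walk_constant:
  fixes m :: "torus_tile \<Rightarrow> 'b::ab_group_add"
  assumes "reachable Z" "\<And>a. a \<in> arcs Q - Z \<Longrightarrow> \<delta> m a = 0" "a \<in> arcs Q"
  shows "\<delta> m a = 0"
proof -
  have "m j = m i0" if j: "j \<in> verts Q" for j
  proof -
    obtain p where p: "walk Z i0 p j" using assms(1) j unfolding reachable_def by blast
    have "sum_list (map (\<delta> m) p) = 0" by (rule walk_sum_eq_0[OF p assms(2)])
    then show ?thesis using cas_sum[of i0 p j m] p unfolding walk_def by simp
  qed
  from this[OF head_in_verts[OF assms(3)]] this[OF tail_in_verts[OF assms(3)]] show ?thesis unfolding \<delta>_def by simp
qed

section \<open>Dimensions of cones modulo coboundaries\<close>

definition coboundary :: "(torus_tile \<Rightarrow> real) \<Rightarrow> torus_edge \<Rightarrow> real" where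
  "coboundary m a = (if a \<in> arcs Q then \<delta> m a else 0)"

lemma coboundaries_eq: "coboundaries D = range coboundary"
  unfolding coboundaries_def coboundary_def \<delta>_def by auto

definition vertex_coboundary :: "torus_tile \<Rightarrow> torus_edge \<Rightarrow> real" where
  "vertex_coboundary i = coboundary (\<lambda>j. if j = i then 1 else 0)"

lemma coboundary_in_span: "coboundary m \<in> wv.span (vertex_coboundary ` verts Q)"
proof -
  have "coboundary m = (\<Sum>i\<in>verts Q. (\<lambda>a. m i * vertex_coboundary i a))"
  proof
    fix a
    have pt: "(\<Sum>i\<in>verts Q. (\<lambda>a. m i * vertex_coboundary i a)) a = (\<Sum>i\<in>verts Q. m i * vertex_coboundary i a)"
      using finite_verts by (induction rule: finite_induct) auto
    show "coboundary m a = (\<Sum>i\<in>verts Q. (\<lambda>a. m i * vertex_coboundary i a)) a"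
    proof (cases "a \<in> arcs Q")
      case True
      have one: "(\<Sum>i\<in>verts Q. m i * (if j = i then 1 else 0)) = m j" if "j \<in> verts Q" for j
        using finite_verts that by (simp add: if_distrib sum.delta cong: if_cong)
      have "(\<Sum>i\<in>verts Q. m i * vertex_coboundary i a) =
          (\<Sum>i\<in>verts Q. m i * (if head Q a = i then 1 else 0)) - (\<Sum>i\<in>verts Q. m i * (if tail Q a = i then 1 else 0))"
        using True by (simp add: vertex_coboundary_def coboundary_def \<delta>_def right_diff_distrib sum_subtractf)
      then show ?thesis unfolding pt using one head_in_verts[OF True] tail_in_verts[OF True] True
        by (simp add: coboundary_def \<delta>_def)
    next
      case False
      then show ?thesis unfolding pt by (simp add: coboundary_def vertex_coboundary_def)
    qed
  qed
  moreover have "(\<Sum>i\<in>verts Q. (\<lambda>a. m i * vertex_coboundary i a)) \<in> wv.span (vertex_coboundary ` verts Q)"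
    by (intro wv.span_sum wv.span_scale wv.span_base) simp
  ultimately show ?thesis by simp
qed

text \<open>A coboundary normalises to zero. Hence it lies in every cone, in accordance with the
  encoding of cones by their preimages.\<close>

lemma vertex_coboundary_in_cone:
  assumes "valid Z"
  shows "vertex_coboundary i \<in> cone Z"
proof -
  define m where "m j = (if j = i then 1 else 0 :: int)" for j
  define k where "k = (\<lambda>a. if a \<in> arcs Q then 0 + \<delta> m a else 0)"
  have "(\<lambda>a. 0) \<in> int_weights D" by (simp add: int_weights_def)
  then have "k \<in> int_weights D" unfolding k_def by (rule int_weights_add_\<delta>)
  moreover have "k a + \<delta> (\<lambda>j. - m j) a = 0" if "a \<in> arcs Q" for a
    using that by (simp add: k_def \<delta>_def)
  ultimately have "k \<in> face_weights Z" unfolding face_weights_def by force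
  moreover have "(\<lambda>a. real_of_int (k a)) = vertex_coboundary i"
    by (auto simp: k_def m_def vertex_coboundary_def coboundary_def \<delta>_def fun_eq_iff)
  ultimately show ?thesis using face_weight_in_cone[OF assms] by metis
qed

text \<open>The space of all weights has infinite dimension, so dimensions of cones are found by
  extending this explicit finite basis.\<close>

lemma coboundary_basis:
  "\<exists>B. finite B \<and> wv.independent B \<and> B \<subseteq> vertex_coboundary ` verts Q \<and> wv.span B = coboundaries D
     \<and> card B = weight_dim (coboundaries D)"
proof -
  obtain B where B: "B \<subseteq> vertex_coboundary ` verts Q" "wv.independent B" "vertex_coboundary ` verts Q \<subseteq> wv.span B"
    using wv.maximal_independent_subset by blast
  have fin: "finite B" using B(1) finite_verts finite_subset by blast
  have sub: "coboundaries D \<subseteq> wv.span B"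
    unfolding coboundaries_eq using coboundary_in_span wv.span_mono[OF B(3)] wv.span_span by blast
  have "wv.subspace (coboundaries D)"
  proof (rule wv.subspaceI)
    show "0 \<in> coboundaries D" unfolding coboundaries_eq
      by (auto simp: coboundary_def \<delta>_def fun_eq_iff intro!: image_eqI[of _ _ "\<lambda>_. 0"])
    fix x y assume "x \<in> coboundaries D" "y \<in> coboundaries D"
    then obtain m m' where "x = coboundary m" "y = coboundary m'" unfolding coboundaries_eq by blast
    then have "x + y = coboundary (\<lambda>j. m j + m' j)" by (auto simp: coboundary_def \<delta>_def fun_eq_iff)
    then show "x + y \<in> coboundaries D" unfolding coboundaries_eq by blast
  next
    fix c x assume "x \<in> coboundaries D"
    then obtain m where "x = coboundary m" unfolding coboundaries_eq by blast
    then have "(\<lambda>a. c * x a) = coboundary (\<lambda>j. c * m j)" by (auto simp: coboundary_def \<delta>_def fun_eq_iff right_diff_distrib)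
    then show "(\<lambda>a. c * x a) \<in> coboundaries D" unfolding coboundaries_eq by blast
  qed
  moreover have Bc: "B \<subseteq> coboundaries D" using B(1) unfolding coboundaries_eq vertex_coboundary_def by blast
  ultimately have "wv.span B \<subseteq> coboundaries D" by (intro wv.span_minimal)
  moreover have "weight_dim (coboundaries D) = card B"
    unfolding weight_dim_def by (rule wv.dim_unique[OF Bc sub B(2) refl])
  ultimately show ?thesis using B fin sub by auto
qed

text \<open>After normalisation \<open>x\<close> is supported on \<open>M\<close> and has the same
  sum at all nodes. Each arrow of \<open>M\<close> is alone at its nodes, so it carries this common
  sum, which is the coefficient \<open>c\<close>.\<close>

lemma cone_perfect:
  assumes M: "valid M" "perfect M" and x: "x \<in> cone M"
  shows "\<exists>c m. x = (\<lambda>a. c * real_of_int (ind M a) + coboundary m a)"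
proof -
  obtain p where p: "\<And>j. j \<in> verts Q \<Longrightarrow> walk M i0 (p j) j" using reachable_walks[OF valid_reachable[OF M(1)]] by blast
  define m where "m j = - sum_list (map x (p j))" for j
  have xm: "\<forall>a\<in>arcs Q - M. x a + \<delta> m a = 0" "\<forall>a. a \<notin> arcs Q \<longrightarrow> x a = 0" "balanced x"
    using cone_normalized[OF M(1) p x] unfolding m_def[abs_def] by blast+
  define y where "y a = (if a \<in> arcs Q then x a + \<delta> m a else 0)" for a
  have bal: "balanced y" using balanced_add_\<delta>[OF xm(3)] by (simp add: y_def[abs_def])
  have y0: "\<forall>b. b \<notin> M \<longrightarrow> y b = 0" using xm(1) by (simp add: y_def)
  obtain n0 where n0: "n0 \<in> nodes" using arcs_nonempty edge_ends unfolding arcs_Q by blast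
  have ya: "y a = nsum y n0" if a: "a \<in> M" for a
  proof -
    obtain n where n: "n \<in> nodes" "\<And>f::torus_edge \<Rightarrow> real. (\<forall>b. b \<notin> M \<longrightarrow> f b = 0) \<Longrightarrow> nsum f n = f a"
      using perfect_arc_node[OF M(2) a, where 'b = real] by blast
    then show ?thesis using y0 balanced_nsum_constant[OF bal n(1) n0] by metis
  qed
  have "x a = nsum y n0 * real_of_int (ind M a) + coboundary (\<lambda>j. - m j) a" for a
  proof (cases "a \<in> arcs Q")
    case True
    then have "x a = y a + coboundary (\<lambda>j. - m j) a" by (simp add: y_def coboundary_def \<delta>_def)
    moreover have "y a = nsum y n0 * real_of_int (ind M a)" using ya y0 by (simp add: ind_def)
    ultimately show ?thesis by simp
  next
    case False
    then have "a \<notin> M" using M(2) unfolding perfect_def by blast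
    then show ?thesis using False xm(2) by (simp add: ind_def coboundary_def)
  qed
  then show ?thesis by blast
qed

text \<open>The indicator of \<open>M\<close> adds one dimension: were it a coboundary, it would
  vanish along the walks outside \<open>M\<close> that reach every vertex, hence everywhere.\<close>

lemma weight_dim_cone_perfect:
  assumes M: "valid M" "perfect M"
  shows "weight_dim (cone M) = 1 + weight_dim (coboundaries D)"
proof -
  obtain B where B: "finite B" "wv.independent B" "B \<subseteq> vertex_coboundary ` verts Q" "wv.span B = coboundaries D"
    "card B = weight_dim (coboundaries D)"
    using coboundary_basis by blast
  define r where "r = (\<lambda>a. real_of_int (ind M a))"
  have "r \<notin> coboundaries D"
  proof
    assume "r \<in> coboundaries D"
    then obtain m where m: "r = coboundary m" unfolding coboundaries_eq by blast
    obtain a where a: "a \<in> M" "a \<in> arcs Q" using perfect_nonempty[OF M(2)] M(2) unfolding perfect_def by blast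
    have "\<delta> m a = 0"
    proof (rule walk_constant[OF valid_reachable[OF M(1)] _ a(2)])
      fix b assume b: "b \<in> arcs Q - M"
      then have "r b = 0" by (simp add: r_def ind_def)
      then show "\<delta> m b = 0" using b m by (simp add: coboundary_def)
    qed
    then have "r a = 0" using m a(2) by (simp add: coboundary_def)
    then show False using a(1) by (simp add: r_def ind_def)
  qed
  then have rB: "r \<notin> wv.span B" using B(4) by simp
  have ind: "wv.independent (insert r B)" using wv.independent_insertI[OF rB B(2)] .
  have "r \<in> cone M" unfolding r_def by (rule face_weight_in_cone[OF M(1) ind_face_weights[OF M(2) order_refl]])
  then have "insert r B \<subseteq> cone M" using B(3) vertex_coboundary_in_cone[OF M(1)] by blast
  moreover have "cone M \<subseteq> wv.span (insert r B)"
  proof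
    fix x assume "x \<in> cone M"
    then obtain c m where x: "x = (\<lambda>a. c * real_of_int (ind M a) + coboundary m a)" using cone_perfect[OF M] by blast
    have "coboundary m \<in> wv.span (insert r B)"
      using B(4) coboundaries_eq wv.span_mono[of B "insert r B"] by blast
    moreover have "(\<lambda>a. c * r a) \<in> wv.span (insert r B)" by (intro wv.span_scale wv.span_base) simp
    ultimately have "(\<lambda>a. c * r a) + coboundary m \<in> wv.span (insert r B)" by (intro wv.span_add)
    moreover have "x = (\<lambda>a. c * r a) + coboundary m" unfolding x r_def by (simp add: fun_eq_iff)
    ultimately show "x \<in> wv.span (insert r B)" by simp
  qed
  moreover have "card (insert r B) = 1 + weight_dim (coboundaries D)"
  proof -
    have "r \<notin> B" using rB wv.span_base by blast
    then show ?thesis using B(1,5) by simp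
  qed
  ultimately show ?thesis unfolding weight_dim_def using wv.dim_unique[OF _ _ ind] by metis
qed

lemma cone_perfect_ray:
  assumes M: "valid M" "perfect M"
  shows "cone M \<in> fan_cones D \<theta> 1"
proof -
  have "iso_class D (unit_rep M) \<in> moduli D \<theta>" using M(1) unfolding valid_def moduli_def by blast
  then have "cone M \<in> fan D \<theta>" unfolding fan_def torus_orbits_def cone_def unit_orbit_def by blast
  then show ?thesis using weight_dim_cone_perfect[OF M] by (simp add: fan_cones_def)
qed

text \<open>A ray inside the cone has its zero set inside \<open>Z\<close>. Conversely each arrow of
  \<open>Z\<close> lies on a perfect matching within \<open>Z\<close>, whose cone is such a
  ray.\<close>

lemma Union_ray_matchings:
  assumes Z: "valid Z"
  shows "(\<Union>\<rho>\<in>rays D \<theta> (cone Z). ray_matching D \<theta> \<rho>) = Z"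
proof (intro equalityI subsetI)
  fix a assume "a \<in> (\<Union>\<rho>\<in>rays D \<theta> (cone Z). ray_matching D \<theta> \<rho>)"
  then obtain \<rho> where r: "\<rho> \<in> fan_cones D \<theta> 1" "\<rho> \<subseteq> cone Z" "a \<in> ray_matching D \<theta> \<rho>" unfolding rays_def by blast
  obtain Z' where Z': "valid Z'" "\<rho> = cone Z'" using fan_cones_cone[OF r(1)] by auto
  have "ray_matching D \<theta> \<rho> = Z'" using ray_matching_cone[OF Z'(1)] r(1) Z'(2) by auto
  then show "a \<in> Z" using cone_subset_imp[OF Z'(1) Z] r(2,3) Z'(2) by blast
next
  fix a assume "a \<in> Z"
  then obtain M where M: "perfect M" "a \<in> M" "M \<subseteq> Z" using perfect_through[OF Z] by blast
  have v: "valid M" by (rule valid_perfect[OF Z M(1,3)])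
  have ray: "cone M \<in> fan_cones D \<theta> 1" by (rule cone_perfect_ray[OF v M(1)])
  have "cone M \<in> rays D \<theta> (cone Z)" using ray cone_mono[OF v Z M(3)] by (simp add: rays_def)
  moreover have "ray_matching D \<theta> (cone M) = M" using ray_matching_cone[OF v ray] by simp
  ultimately show "a \<in> (\<Union>\<rho>\<in>rays D \<theta> (cone Z). ray_matching D \<theta> \<rho>)" using M(2) by blast
qed

text \<open>Without a matching, \<open>T\<close> is empty and the cone contains only coboundaries;
  with just one, \<open>T\<close> equals it and the cone is a ray. Both contradict dimension
  two.\<close>

lemma two_perfect_matchings:
  assumes T: "valid T" and d: "cone T \<in> fan_cones D \<theta> 2"
  shows "\<exists>M M'. perfect M \<and> perfect M' \<and> M \<noteq> M' \<and> M \<subseteq> T \<and> M' \<subseteq> T"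
proof (rule ccontr)
  assume one: "\<not> ?thesis"
  have dim: "weight_dim (cone T) = 2 + weight_dim (coboundaries D)" using d by (simp add: fan_cones_def)
  show False
  proof (cases "T = {}")
    case True
    obtain B where B: "finite B" "wv.span B = coboundaries D" "card B = weight_dim (coboundaries D)"
      using coboundary_basis by blast
    have "cone T \<subseteq> wv.span B"
    proof
      fix x assume x: "x \<in> cone T"
      obtain p where p: "\<And>j. j \<in> verts Q \<Longrightarrow> walk T i0 (p j) j" using reachable_walks[OF valid_reachable[OF T]] by blast
      define m where "m j = - sum_list (map x (p j))" for j
      have xm: "\<forall>a\<in>arcs Q - T. x a + \<delta> m a = 0" "\<forall>a. a \<notin> arcs Q \<longrightarrow> x a = 0"
        using cone_normalized[OF T p x] unfolding m_def[abs_def] by blast+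
      have "x = coboundary (\<lambda>j. - m j)"
      proof
        fix a show "x a = coboundary (\<lambda>j. - m j) a"
          using xm True by (cases "a \<in> arcs Q") (auto simp: coboundary_def \<delta>_def)
      qed
      then show "x \<in> wv.span B" using B(2) coboundaries_eq by auto
    qed
    then have "weight_dim (cone T) \<le> card B" unfolding weight_dim_def using B(1) by (rule wv.dim_le_card)
    then show False using dim B(3) by simp
  next
    case False
    then obtain a where "a \<in> T" by blast
    then obtain M where M: "perfect M" "M \<subseteq> T" using perfect_through[OF T] by blast
    have "T \<subseteq> M"
    proof
      fix b assume "b \<in> T"
      then obtain M' where M': "perfect M'" "b \<in> M'" "M' \<subseteq> T" using perfect_through[OF T] by blast
      then show "b \<in> M" using one M by blast
    qed
    then have "T = M" using M(2) by blast
    then show False using weight_dim_cone_perfect T M(1) dim by simp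
  qed
qed

subsection \<open>Crossing a wall\<close>

text \<open>Acts as a test of independence: a combination of matchings within one cone that is a
  coboundary must vanish arrow by arrow.\<close>

lemma supported_coboundary_zero:
  fixes f :: "torus_edge \<Rightarrow> int"
  assumes Z: "valid Z" and f: "\<And>a. a \<in> arcs Q \<Longrightarrow> f a = \<delta> m a" "\<And>a. a \<in> arcs Q \<Longrightarrow> a \<notin> Z \<Longrightarrow> f a = 0"
    and a: "a \<in> arcs Q"
  shows "f a = 0"
  using walk_constant[OF valid_reachable[OF Z], of m a] f a by auto

text \<open>The assumptions are symmetric in \<open>Zp\<close> and \<open>Zm\<close>, so what
  follows applies in both directions across the wall.\<close>

context
  fixes Zp Zm T M1 M2
  assumes Zp: "valid Zp" and Zm: "valid Zm" and T: "valid T" and wall: "cone T = cone Zp \<inter> cone Zm"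
    and M1: "perfect M1" "M1 \<subseteq> T" and M2: "perfect M2" "M2 \<subseteq> T" and M12: "M1 \<noteq> M2"
begin

lemma T_sub: "T \<subseteq> Zp" "T \<subseteq> Zm"
  using cone_subset_imp[OF T Zp] cone_subset_imp[OF T Zm] wall by blast+

text \<open>The coefficients \<open>c0\<close> and \<open>c3\<close> have the same sign: otherwise a combination of the rays of
  one cone in which \<open>M0\<close> has a positive coefficient would lie in the other cone, hence in the wall.\<close>

lemma wall_relation:
  assumes M0: "perfect M0" "M0 \<subseteq> Zp" "\<not> M0 \<subseteq> T" and M3: "perfect M3" "M3 \<subseteq> Zm" "\<not> M3 \<subseteq> T"
  shows "\<exists>c0 c1 c2 c3 (m :: torus_tile \<Rightarrow> int). c0 > 0 \<and> c3 > 0 \<and>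
    (\<forall>a\<in>arcs Q. c0 * ind M0 a + c1 * ind M1 a + c2 * ind M2 a + c3 * ind M3 a = \<delta> m a)"
proof -
  have sub: "M0 \<subseteq> arcs Q" "M1 \<subseteq> arcs Q" "M2 \<subseteq> arcs Q" "M3 \<subseteq> arcs Q"
    using M0(1) M1(1) M2(1) M3(1) by (auto simp: perfect_def)
  obtain a0 where a0: "a0 \<in> M0" "a0 \<notin> T" using M0(3) by blast
  obtain a3 where a3: "a3 \<in> M3" "a3 \<notin> T" using M3(3) by blast
  have n: "nsum (\<lambda>a. ind M a - ind M1 a) n = 0" if "perfect M" "n \<in> nodes" for M n
    using nsum_ind[OF that] nsum_ind[OF M1(1) that(2)] by (simp add: nsum_def sum_subtractf)
  obtain a b c m where abc: "a \<noteq> 0 \<or> b \<noteq> 0 \<or> c \<noteq> (0::int)"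
    "\<And>r. r \<in> arcs Q \<Longrightarrow> a * (ind M0 r - ind M1 r) + b * (ind M2 r - ind M1 r) + c * (ind M3 r - ind M1 r) = \<delta> m r"
    using zero_sum_relation[OF n[OF M0(1)] n[OF M2(1)] n[OF M3(1)]] unfolding \<delta>_def by blast
  \<comment> \<open>All differences are taken against \<open>M1\<close>, whose coefficient therefore
    balances the other three. A change of sign, if needed, makes the first nonzero one of the outer
    coefficients positive.\<close>
  have "\<exists>a c1 b c m. (a \<noteq> 0 \<or> b \<noteq> 0 \<or> c \<noteq> (0::int)) \<and> a \<ge> 0 \<and> (a = 0 \<longrightarrow> c \<ge> 0) \<and> a + c1 + b + c = 0 \<and>
    (\<forall>r\<in>arcs Q. a * ind M0 r + c1 * ind M1 r + b * ind M2 r + c * ind M3 r = \<delta> m r)"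
  proof (cases "a > 0 \<or> a = 0 \<and> c \<ge> 0")
    case True
    then show ?thesis using abc
      by (intro exI[of _ a] exI[of _ "- (a + b + c)"] exI[of _ b] exI[of _ c] exI[of _ m]) (auto simp: algebra_simps)
  next
    case False
    have "- a * ind M0 r + (a + b + c) * ind M1 r + - b * ind M2 r + - c * ind M3 r = \<delta> (\<lambda>j. - m j) r" if "r \<in> arcs Q" for r
      using abc(2)[OF that] by (simp add: \<delta>_def algebra_simps)
    then show ?thesis using abc(1) False
      by (intro exI[of _ "- a"] exI[of _ "a + b + c"] exI[of _ "- b"] exI[of _ "- c"] exI[of _ "\<lambda>j. - m j"]) auto
  qed
  then obtain c0 c1 c2 c3 m where nz: "c0 \<noteq> 0 \<or> c2 \<noteq> 0 \<or> c3 \<noteq> (0::int)" and c0: "c0 \<ge> 0" and c3: "c0 = 0 \<longrightarrow> c3 \<ge> 0"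
    and sum0: "c0 + c1 + c2 + c3 = 0"
    and rel: "\<And>r. r \<in> arcs Q \<Longrightarrow> c0 * ind M0 r + c1 * ind M1 r + c2 * ind M2 r + c3 * ind M3 r = \<delta> m r"
    by blast
  \<comment> \<open>With \<open>c3 = 0\<close> the relation is supported in \<open>Zp\<close> and
    hence trivial, but at \<open>a0\<close> only \<open>M0\<close> contributes. The same test at
    \<open>a3\<close> shows that \<open>c0 = 0\<close> forces \<open>c3 = 0\<close>.\<close>
  have c3_nz: "c3 \<noteq> 0 \<or> c0 = 0"
  proof (rule ccontr)
    assume *: "\<not> ?thesis"
    have "c0 * ind M0 a0 + c1 * ind M1 a0 + c2 * ind M2 a0 + c3 * ind M3 a0 = 0"
      by (rule supported_coboundary_zero[OF Zp rel]) (use * M0(2) M1(2) M2(2) T_sub a0 sub in \<open>auto simp: ind_def\<close>)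
    then show False using * a0 M1(2) M2(2) by (auto simp: ind_def split: if_splits)
  qed
  have c0_nz: "c0 \<noteq> 0 \<or> c3 = 0"
  proof (rule ccontr)
    assume *: "\<not> ?thesis"
    have "c0 * ind M0 a3 + c1 * ind M1 a3 + c2 * ind M2 a3 + c3 * ind M3 a3 = 0"
      by (rule supported_coboundary_zero[OF Zm rel]) (use * M3(2) M1(2) M2(2) T_sub a3 sub in \<open>auto simp: ind_def\<close>)
    then show False using * a3 M1(2) M2(2) by (auto simp: ind_def split: if_splits)
  qed
  \<comment> \<open>Otherwise only \<open>M1\<close> and \<open>M2\<close> remain, and the relation
    fails at an arrow of \<open>M2\<close> outside \<open>M1\<close>.\<close>
  have c0_pos: "c0 > 0"
  proof (rule ccontr)
    assume "\<not> ?thesis"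
    then have z: "c0 = 0" "c3 = 0" "c2 \<noteq> 0" using c0 c0_nz nz by auto
    obtain a2 where a2: "a2 \<in> M2" "a2 \<notin> M1" using perfect_subset_eq[OF M2(1) M1(1)] M12 by blast
    have "c0 * ind M0 a2 + c1 * ind M1 a2 + c2 * ind M2 a2 + c3 * ind M3 a2 = 0"
      by (rule supported_coboundary_zero[OF T rel]) (use z M1(2) M2(2) a2 sub in \<open>auto simp: ind_def\<close>)
    then show False using z a2 by (simp add: ind_def)
  qed
  have "c3 > 0"
  proof (rule ccontr)
    assume "\<not> ?thesis"
    then have c3_neg: "c3 < 0" using c3_nz c0_pos by auto
    \<comment> \<open>Adding \<open>N\<close> times both wall matchings makes the coefficients
      nonnegative: in the expression of \<open>k\<close> through \<open>M0\<close> over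
      \<open>Zp\<close>, and in the one through \<open>M3\<close> over \<open>Zm\<close> that the
      relation provides modulo a coboundary.\<close>
    define N where "N = \<bar>c1\<bar> + \<bar>c2\<bar>"
    have N: "N \<ge> 0" "c1 + N \<ge> 0" "c2 + N \<ge> 0" by (auto simp: N_def)
    define k where "k r = c0 * ind M0 r + (c1 + N) * ind M1 r + (c2 + N) * ind M2 r" for r
    have iw: "k \<in> int_weights D"
    proof -
      have "nsum k n = c0 * nsum (ind M0) n + (c1 + N) * nsum (ind M1) n + (c2 + N) * nsum (ind M2) n" for n
        by (simp add: nsum_def k_def sum.distrib sum_distrib_left)
      then have "nsum k n = c0 + (c1 + N) + (c2 + N)" if "n \<in> nodes" for n
        using nsum_ind[OF M0(1) that] nsum_ind[OF M1(1) that] nsum_ind[OF M2(1) that] by simp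
      then have "balanced k" unfolding balanced_nsum using edge_ends by metis
      then show ?thesis unfolding int_weights_balanced using sub by (auto simp: k_def ind_def)
    qed
    have kp: "k r + \<delta> (\<lambda>_. 0) r \<ge> 0" "r \<notin> Zp \<Longrightarrow> k r + \<delta> (\<lambda>_. 0) r = 0" for r
      using c0 N M0(2) M1(2) M2(2) T_sub by (auto simp: k_def \<delta>_def ind_def)
    have "k \<in> face_weights Zp" unfolding face_weights_def using iw kp by blast
    moreover have "k \<in> face_weights Zm"
    proof -
      have km: "k r + \<delta> (\<lambda>j. - m j) r = - c3 * ind M3 r + N * ind M1 r + N * ind M2 r" if "r \<in> arcs Q" for r
        using rel[OF that] by (simp add: k_def \<delta>_def algebra_simps)
      have "\<forall>r\<in>arcs Q. k r + \<delta> (\<lambda>j. - m j) r \<ge> 0" using c3_neg N by (auto simp: km ind_def)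
      moreover have "\<forall>r\<in>arcs Q - Zm. k r + \<delta> (\<lambda>j. - m j) r = 0"
        using M3(2) M1(2) M2(2) T_sub by (auto simp: km ind_def)
      ultimately show ?thesis unfolding face_weights_def using iw by blast
    qed
    ultimately have "(\<lambda>r. real_of_int (k r)) \<in> cone T"
      using face_weight_in_cone[OF Zp] face_weight_in_cone[OF Zm] wall by blast
    then have "k \<in> face_weights T" using face_weights_of_cone[OF T iw] by blast
    then obtain m' where m': "\<forall>r\<in>arcs Q. k r + \<delta> m' r \<ge> 0" "\<forall>r\<in>arcs Q - T. k r + \<delta> m' r = 0"
      unfolding face_weights_def by auto
    have a0Q: "a0 \<in> arcs Q" using a0 sub by blast
    have "\<delta> (\<lambda>_. 0) a0 = \<delta> m' a0"
      by (rule normalization_unique[OF valid_reachable[OF Zp] valid_reachable[OF T] a0Q, of k]) (use kp m' in auto)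
    then have "\<delta> m' a0 = 0" by (simp add: \<delta>_def)
    moreover have "k a0 + \<delta> m' a0 = 0" using m'(2) a0Q a0(2) by blast
    ultimately have "k a0 = 0" by simp
    moreover have "ind M1 a0 = 0" "ind M2 a0 = 0" using a0(2) M1(2) M2(2) by (auto simp: ind_def)
    ultimately show False using a0(1) c0_pos by (simp add: k_def ind_def)
  qed
  then show ?thesis using c0_pos rel by blast
qed

text \<open>Eliminating \<open>M0\<close> from the two wall relations leaves a coboundary
  \<open>f\<close> supported in \<open>Zm\<close>, which must vanish. Outside \<open>Zp\<close> only
  \<open>M3\<close> and \<open>M4\<close> contribute to it, with coefficients of opposite
  sign.\<close>

lemma wall_matchings_agree:
  assumes M0: "perfect M0" "M0 \<subseteq> Zp" "\<not> M0 \<subseteq> T" and M3: "perfect M3" "M3 \<subseteq> Zm" "\<not> M3 \<subseteq> T"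
    and M4: "perfect M4" "M4 \<subseteq> Zm" "\<not> M4 \<subseteq> T" and a: "a \<in> arcs Q" "a \<notin> Zp"
  shows "a \<in> M3 \<longleftrightarrow> a \<in> M4"
proof -
  obtain c0 c1 c2 c3 m where c: "c0 > (0::int)" "c3 > 0"
    "\<And>r. r \<in> arcs Q \<Longrightarrow> c0 * ind M0 r + c1 * ind M1 r + c2 * ind M2 r + c3 * ind M3 r = \<delta> m r"
    using wall_relation[OF M0 M3] by blast
  obtain d0 d1 d2 d4 m' where d: "d0 > (0::int)" "d4 > 0"
    "\<And>r. r \<in> arcs Q \<Longrightarrow> d0 * ind M0 r + d1 * ind M1 r + d2 * ind M2 r + d4 * ind M4 r = \<delta> m' r"
    using wall_relation[OF M0 M4] by blast
  define f where "f r = (d0 * c1 - c0 * d1) * ind M1 r + (d0 * c2 - c0 * d2) * ind M2 r + d0 * c3 * ind M3 r - c0 * d4 * ind M4 r" for r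
  have "f a = 0"
  proof (rule supported_coboundary_zero[OF Zm _ _ a(1)])
    fix r assume r: "r \<in> arcs Q"
    have "f r = d0 * (c0 * ind M0 r + c1 * ind M1 r + c2 * ind M2 r + c3 * ind M3 r)
        - c0 * (d0 * ind M0 r + d1 * ind M1 r + d2 * ind M2 r + d4 * ind M4 r)"
      by (simp add: f_def algebra_simps)
    also have "\<dots> = \<delta> (\<lambda>j. d0 * m j - c0 * m' j) r"
      unfolding c(3)[OF r] d(3)[OF r] by (simp add: \<delta>_def algebra_simps)
    finally show "f r = \<delta> (\<lambda>j. d0 * m j - c0 * m' j) r" .
    assume "r \<notin> Zm"
    then show "f r = 0" using M1(2) M2(2) M3(2) M4(2) T_sub by (auto simp: f_def ind_def)
  qed
  moreover have "ind M1 a = 0" "ind M2 a = 0" using M1(2) M2(2) T_sub a(2) by (auto simp: ind_def)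
  ultimately have "d0 * c3 * ind M3 a = c0 * d4 * ind M4 a" by (simp add: f_def)
  then show ?thesis using c d by (auto simp: ind_def split: if_splits)
qed

context
  fixes J :: "(complex \<times> complex) set"
  assumes J: "J = (THE J. J \<in> closure ` components (torus - \<Union>(Zp \<union> Zm)) \<and> i0 \<subseteq> J)"
begin

lemma piece_facts:
  shows "i0 \<subseteq> J"
    and "a \<in> arcs Q - (Zp \<union> Zm) \<Longrightarrow> head Q a \<subseteq> J \<longleftrightarrow> tail Q a \<subseteq> J"
    and "\<lbrakk>\<And>a. a \<in> arcs Q - (Zp \<union> Zm) \<Longrightarrow> f (head Q a) = f (tail Q a); i \<in> verts Q; i \<subseteq> J\<rbrakk> \<Longrightarrow> f i = f i0"
proof -
  have P: "Zp \<union> Zm \<subseteq> arcs Q" using Zp Zm unfolding valid_def by blast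
  have cover: "\<exists>e\<in>edges_at D n. edge_proj e \<in> Zp \<union> Zm" if "n \<in> nodes" for n
    using M1 T_sub that unfolding perfect_def by blast
  show "i0 \<subseteq> J" by (rule zero_tile_in_piece[OF P cover i0 J])
  show "a \<in> arcs Q - (Zp \<union> Zm) \<Longrightarrow> head Q a \<subseteq> J \<longleftrightarrow> tail Q a \<subseteq> J" by (rule arc_in_piece[OF P cover i0 J])
  show "\<lbrakk>\<And>a. a \<in> arcs Q - (Zp \<union> Zm) \<Longrightarrow> f (head Q a) = f (tail Q a); i \<in> verts Q; i \<subseteq> J\<rbrakk> \<Longrightarrow> f i = f i0"
    by (rule constant_on_piece[OF P cover i0 J])
qed

text \<open>Let \<open>m\<close> be the potential of a wall relation, so that \<open>m\<close> grows by \<open>c3\<close> along the arrows of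
  \<open>arcs Q - Zp\<close> that lie in \<open>M3\<close>, by \<open>c0\<close> along those of \<open>arcs Q - Zm\<close> that lie in \<open>M0\<close>, and is
  constant along the others. Relative to its value at \<open>i0\<close> it equals \<open>c3\<close> at a source \<open>i\<close>, so an
  arrow \<open>b\<close> of \<open>arcs Q - Zm\<close> into \<open>i\<close> starts at a vertex where it is a nonnegative multiple of
  \<open>c3\<close> less than \<open>c3\<close>, that is \<open>0\<close>.\<close>

lemma source_transfer:
  assumes i: "i \<in> verts Q" "\<not> i \<subseteq> J"
    and src: "\<And>a. a \<in> arcs Q - Zp \<Longrightarrow> head Q a = i \<Longrightarrow> tail Q a \<subseteq> J"
    and b: "b \<in> arcs Q - Zm" "head Q b = i"
  shows "tail Q b \<subseteq> J"
proof (rule ccontr)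
  assume tb: "\<not> tail Q b \<subseteq> J"
  \<comment> \<open>An arrow outside \<open>Zp\<close> with head \<open>i\<close> starts in
    \<open>J\<close> by \<open>src\<close>, which \<open>b\<close> does not.\<close>
  have bZ: "b \<in> Zp" using src b tb by blast
  obtain M0 where M0: "perfect M0" "b \<in> M0" "M0 \<subseteq> Zp" using perfect_through[OF Zp bZ] by blast
  have M0T: "\<not> M0 \<subseteq> T" using M0(2) b(1) T_sub by blast
  \<comment> \<open>The last arrow \<open>a\<close> of a walk to \<open>i\<close> outside
    \<open>Zp\<close> serves to compute the potential at \<open>i\<close>.\<close>
  obtain p where p: "walk Zp i0 p i" using valid_reachable[OF Zp] i(1) unfolding reachable_def by blast
  have "p \<noteq> []"
  proof
    assume "p = []"
    then have "i = i0" using p by (simp add: walk_def pre_digraph.cas.simps)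
    then show False using i(2) piece_facts(1) by simp
  qed
  then obtain p' a where pa: "p = p' @ [a]" by (metis rev_exhaust)
  have a: "a \<in> arcs Q - Zp" "head Q a = i" using p cas_snocD unfolding pa walk_def by auto
  have ta: "tail Q a \<subseteq> J" by (rule src[OF a])
  \<comment> \<open>An arrow outside both zero sets stays within its piece, so \<open>a\<close>
    would place \<open>i\<close> in \<open>J\<close>.\<close>
  have aZ: "a \<in> Zm" using piece_facts(2)[of a] a ta i(2) by blast
  obtain M3 where M3: "perfect M3" "a \<in> M3" "M3 \<subseteq> Zm" using perfect_through[OF Zm aZ] by blast
  have M3T: "\<not> M3 \<subseteq> T" using M3(2) a(1) T_sub by blast
  obtain c0 c1 c2 c3 and m :: "torus_tile \<Rightarrow> int" where c: "c0 > 0" "c3 > 0"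
    "\<And>r. r \<in> arcs Q \<Longrightarrow> c0 * ind M0 r + c1 * ind M1 r + c2 * ind M2 r + c3 * ind M3 r = \<delta> m r"
    using wall_relation[OF M0(1,3) M0T M3(1,3) M3T] by blast
  have \<delta>p: "\<delta> m r = c3 * ind M3 r" if "r \<in> arcs Q - Zp" for r
  proof -
    have "ind M0 r = 0" "ind M1 r = 0" "ind M2 r = 0" using that M0(3) M1(2) M2(2) T_sub by (auto simp: ind_def)
    then show ?thesis using c(3)[of r] that by simp
  qed
  have \<delta>m: "\<delta> m r = c0 * ind M0 r" if "r \<in> arcs Q - Zm" for r
  proof -
    have "ind M3 r = 0" "ind M1 r = 0" "ind M2 r = 0" using that M3(3) M1(2) M2(2) T_sub by (auto simp: ind_def)
    then show ?thesis using c(3)[of r] that by simp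
  qed
  have "m (head Q r) = m (tail Q r)" if r: "r \<in> arcs Q - (Zp \<union> Zm)" for r
  proof -
    have "ind M3 r = 0" using r M3(3) by (auto simp: ind_def)
    then show ?thesis using \<delta>p[of r] r by (simp add: \<delta>_def)
  qed
  then have "m (tail Q a) = m i0" using piece_facts(3)[of m "tail Q a"] ta tail_in_verts a(1) by blast
  then have mi: "m i = m i0 + c3" using \<delta>p[OF a(1)] M3(2) a(2) by (simp add: \<delta>_def ind_def)
  have mb: "m (tail Q b) = m i0 + c3 - c0" using \<delta>m[OF b(1)] M0(2) b(2) mi by (simp add: \<delta>_def ind_def)
  \<comment> \<open>On this walk the potential grows by \<open>c3\<close> with each arrow of
    \<open>M3\<close> and nowhere else. Its total growth is \<open>c3 - c0\<close>, less than
    \<open>c3\<close>, so no arrow of \<open>M3\<close> is used.\<close>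
  obtain q where q: "walk Zp i0 q (tail Q b)"
    using valid_reachable[OF Zp] tail_in_verts b(1) unfolding reachable_def by blast
  have cas: "pre_digraph.cas Q i0 q (tail Q b)" and qs: "set q \<subseteq> arcs Q - Zp" using q by (auto simp: walk_def)
  have eq: "map (\<delta> m) q = map (\<lambda>r. c3 * ind M3 r) q" using qs \<delta>p by auto
  have "c3 * sum_list (map (ind M3) q) = m (tail Q b) - m i0"
    using cas_sum[OF cas, of m] unfolding eq sum_list_const_mult .
  then have "c3 * sum_list (map (ind M3) q) < c3 * 1" using mb c(1) by simp
  then have "sum_list (map (ind M3) q) < 1" using c(2) by (simp only: mult_less_cancel_left_pos)
  moreover have nn: "sum_list (map (ind M3) q) \<ge> 0" by (intro sum_list_nonneg) (auto simp: ind_def)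
  ultimately have "sum_list (map (ind M3) q) = 0" by simp
  then have qM3: "r \<notin> M3" if "r \<in> set q" for r
  proof -
    have "\<And>x. x \<in> set (map (ind M3) q) \<Longrightarrow> x \<ge> 0" by (auto simp: ind_def)
    then have "\<forall>x\<in>set (map (ind M3) q). x = 0"
      using \<open>sum_list (map (ind M3) q) = 0\<close> sum_list_nonneg_eq_0_iff by blast
    then have "ind M3 r = 0" using that by simp
    then show ?thesis by (auto simp: ind_def split: if_splits)
  qed
  \<comment> \<open>An arrow of \<open>q\<close> in \<open>Zm\<close> would lie on some matching
    \<open>M4\<close> of the other cone. Outside \<open>Zp\<close> that matching agrees with
    \<open>M3\<close>, which \<open>q\<close> avoids. So \<open>q\<close> avoids both zero sets and
    never leaves \<open>J\<close>.\<close>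
  have qZ: "r \<notin> Zm" if r: "r \<in> set q" for r
  proof
    assume rZ: "r \<in> Zm"
    then obtain M4 where M4: "perfect M4" "r \<in> M4" "M4 \<subseteq> Zm" using perfect_through[OF Zm] by blast
    have rQ: "r \<in> arcs Q" "r \<notin> Zp" using qs r by auto
    have "\<not> M4 \<subseteq> T" using M4(2) rQ T_sub by blast
    then have "r \<in> M3"
      using wall_matchings_agree[OF M0(1,3) M0T M3(1,3) M3T M4(1,3) _ rQ] M4(2) by blast
    then show False using qM3 r by blast
  qed
  have "u \<subseteq> J \<Longrightarrow> v \<subseteq> J" if "pre_digraph.cas Q u s v" "set s \<subseteq> arcs Q - (Zp \<union> Zm)" for u s v
    using that
  proof (induction s arbitrary: u)
    case (Cons r s)
    then have "head Q r \<subseteq> J" using piece_facts(2)[of r] by (auto simp: pre_digraph.cas.simps)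
    then show ?case using Cons by (auto simp: pre_digraph.cas.simps)
  qed (simp add: pre_digraph.cas.simps)
  then have "tail Q b \<subseteq> J" using cas qs qZ piece_facts(1) by blast
  then show False using tb by blast
qed

end

end

text \<open>An arrow starting inside the zero piece is deleted together with its tail, so a source
  may still be the head of such arrows in the cone quiver.\<close>

lemma source_vertices_tau:
  assumes Z: "valid Z"
  shows "source_vertices (tau_quiver D i0 \<theta> \<sigma>p \<sigma>m (cone Z)) =
    {i \<in> verts Q. \<not> i \<subseteq> zero_piece D i0 \<theta> \<sigma>p \<sigma>m \<and>
      (\<forall>a\<in>arcs Q - Z. head Q a = i \<longrightarrow> tail Q a \<subseteq> zero_piece D i0 \<theta> \<sigma>p \<sigma>m)}"
proof -
  have "{a \<in> arcs Q. cone_module D \<theta> (cone Z) a \<noteq> 0} = arcs Q - Z"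
    using Z unfolding cone_module_def Union_ray_matchings[OF Z] by (auto split: if_splits)
  then have tq: "tau_quiver D i0 \<theta> \<sigma>p \<sigma>m (cone Z) =
      \<lparr>verts = {i \<in> verts Q. \<not> i \<subseteq> zero_piece D i0 \<theta> \<sigma>p \<sigma>m},
       arcs = {a \<in> arcs Q - Z. tail Q a \<in> {i \<in> verts Q. \<not> i \<subseteq> zero_piece D i0 \<theta> \<sigma>p \<sigma>m} \<and>
         head Q a \<in> {i \<in> verts Q. \<not> i \<subseteq> zero_piece D i0 \<theta> \<sigma>p \<sigma>m}},
       tail = tail Q, head = head Q\<rparr>"
    unfolding tau_quiver_def cone_quiver_def induce_subgraph_def by simp
  show ?thesis unfolding tq source_vertices_def in_arcs_def using tail_in_verts by auto
qed

theorem source_vertices_wall: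
  assumes \<sigma>: "\<sigma>p \<in> fan_cones D \<theta> 3" "\<sigma>m \<in> fan_cones D \<theta> 3" "\<sigma>p \<inter> \<sigma>m \<in> fan_cones D \<theta> 2"
  shows "source_vertices (tau_quiver D i0 \<theta> \<sigma>p \<sigma>m \<sigma>p) = source_vertices (tau_quiver D i0 \<theta> \<sigma>p \<sigma>m \<sigma>m)"
proof -
  obtain Zp Zm T where Z: "valid Zp" "\<sigma>p = cone Zp" "valid Zm" "\<sigma>m = cone Zm" "valid T" "\<sigma>p \<inter> \<sigma>m = cone T"
    using fan_cones_cone[OF \<sigma>(1)] fan_cones_cone[OF \<sigma>(2)] fan_cones_cone[OF \<sigma>(3)] by auto
  obtain M1 M2 where M: "perfect M1" "perfect M2" "M1 \<noteq> M2" "M1 \<subseteq> T" "M2 \<subseteq> T"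
    using two_perfect_matchings[OF Z(5)] \<sigma>(3) Z(6) by auto
  define J where "J = zero_piece D i0 \<theta> \<sigma>p \<sigma>m"
  have "(\<Union>\<rho>\<in>rays D \<theta> \<sigma>p \<union> rays D \<theta> \<sigma>m. ray_matching D \<theta> \<rho>) = Zp \<union> Zm"
    using Union_ray_matchings[OF Z(1)] Union_ray_matchings[OF Z(3)] Z(2,4) by auto
  then have J: "J = (THE J. J \<in> closure ` components (torus - \<Union>(Zp \<union> Zm)) \<and> i0 \<subseteq> J)"
    unfolding J_def zero_piece_def jigsaw_pieces_def by simp
  then have J': "J = (THE J. J \<in> closure ` components (torus - \<Union>(Zm \<union> Zp)) \<and> i0 \<subseteq> J)"
    by (simp only: Un_commute)
  have w: "cone T = cone Zp \<inter> cone Zm" "cone T = cone Zm \<inter> cone Zp" using Z by auto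
  note transfer = source_transfer[OF Z(1,3,5) w(1) M(1,4,2,5,3) J]
    source_transfer[OF Z(3,1,5) w(2) M(1,4,2,5,3) J']
  show ?thesis
    unfolding Z(2,4) source_vertices_tau[OF Z(1)] source_vertices_tau[OF Z(3)]
    unfolding Z(2,4)[symmetric] J_def[symmetric]
    using transfer by blast
qed

end

theorem corollary4p11:
  fixes \<Gamma> :: dimer
    and i0 :: torus_tile
    and \<theta> :: "torus_tile \<Rightarrow> rat"
    and \<sigma>p \<sigma>m \<tau> :: "(torus_edge \<Rightarrow> real) set"
  assumes "dimer_model \<Gamma>"
    and "consistent \<Gamma>"
    and "i0 \<in> verts (dual_quiver \<Gamma>)"
    and "zero_generated \<Gamma> i0 \<theta>"
    and "\<sigma>p \<in> fan_cones \<Gamma> \<theta> 3"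
    and "\<sigma>m \<in> fan_cones \<Gamma> \<theta> 3"
    and "\<tau> = \<sigma>p \<inter> \<sigma>m"
    and "\<tau> \<in> fan_cones \<Gamma> \<theta> 2"
  shows "source_vertices (tau_quiver \<Gamma> i0 \<theta> \<sigma>p \<sigma>m \<sigma>p) =
         source_vertices (tau_quiver \<Gamma> i0 \<theta> \<sigma>p \<sigma>m \<sigma>m)"
proof -
  interpret zero_generated_stability \<Gamma> i0 \<theta>
    by unfold_locales (use assms in auto)
  show ?thesis using source_vertices_wall assms by simp
qed

end
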